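(* Let $N \ge 1$ be an integer, $1 \le p < +\infty$, $\gamma < -p$, and let $u \in L^p(\mathbb{R}^N)$. Then $$\frac{K_{N,p}}{|\gamma|}\, \Phi(u) \le \limsup_{\lambda \to 0_+} \Phi_\lambda(u).$$ In particular, if the right-hand side is finite, then $u \in W^{1,p}(\mathbb{R}^N)$ if $p>1$, and $u \in BV(\mathbb{R}^N)$ if $p=1$.
   Context: Functions are real-valued. For $u \in L^p(\mathbb{R}^N)$: if $p>1$, $\Phi(u) = \int_{\mathbb{R}^N} |\nabla u|^p\,dx$ when $u \in W^{1,p}(\mathbb{R}^N)$ and $\Phi(u)=+\infty$ otherwise; if $p=1$, $\Phi(u) = \|\nabla u\|_{\mathcal{M}(\mathbb{R}^N)} := \sup\{ |\int_{\mathbb{R}^N} u\, \mathrm{div}\,\varphi\,dx| : \varphi \in C_c^\infty(\mathbb{R}^N;\mathbb{R}^N),\ \|\varphi\|_{L^\infty} \le 1\}$ (the total variation), which is $+\infty$ when $u \notin BV(\mathbb{R}^N)$. $K_{N,p} = \int_{\mathbb{S}^{N-1}} |e\cdot\sigma|^p\,d\sigma$ for any $e \in \mathbb{S}^{N-1}$ (surface measure on the unit sphere; for $N=1$ counting measure on $\{\pm 1\}$). For $\lambda>0$, and for the given $p$ and $\gamma$, $$\Phi_\lambda(u) = \lambda^p \iint_{\{(x,y)\in \mathbb{R}^N\times\mathbb{R}^N:\ |u(x)-u(y)|/|x-y|^{1+\gamma/p} > \lambda\}} |x-y|^{-N+\gamma}\,dx\,dy \in [0,+\infty].$$ *)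

theory Defs
  imports "HOL-Analysis.Analysis"
begin

text \<open>
  Throughout, \<open>\<real>\<^sup>N\<close> is a type \<open>'a::euclidean_space\<close>, with \<open>N = DIM('a) \<ge> 1\<close>. Elements of
  Lebesgue spaces are represented by arbitrary Lebesgue measurable functions.
\<close>

definition in_Lp :: "real \<Rightarrow> ('a::euclidean_space \<Rightarrow> 'b::euclidean_space) \<Rightarrow> bool" where
  "in_Lp p f \<longleftrightarrow> f \<in> borel_measurable lebesgue \<and> integrable lebesgue (\<lambda>x. norm (f x) powr p)"

primrec C_k :: "nat \<Rightarrow> ('a::euclidean_space \<Rightarrow> 'b::euclidean_space) \<Rightarrow> bool" where
  "C_k 0 f \<longleftrightarrow> continuous_on UNIV f"
| "C_k (Suc k) f \<longleftrightarrow>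
     (\<forall>x. f differentiable at x) \<and> (\<forall>v. C_k k (\<lambda>x. frechet_derivative f (at x) v))"

definition test_function :: "('a::euclidean_space \<Rightarrow> 'b::euclidean_space) \<Rightarrow> bool" where
  "test_function \<phi> \<longleftrightarrow> (\<forall>k. C_k k \<phi>) \<and> compact (closure {x. \<phi> x \<noteq> 0})"

definition divergence :: "('a::euclidean_space \<Rightarrow> 'a) \<Rightarrow> 'a \<Rightarrow> real" where
  "divergence \<phi> x = (\<Sum>b\<in>Basis. frechet_derivative \<phi> (at x) b \<bullet> b)"

definition is_weak_gradient :: "('a::euclidean_space \<Rightarrow> real) \<Rightarrow> ('a \<Rightarrow> 'a) \<Rightarrow> bool" where
  "is_weak_gradient u g \<longleftrightarrow>
     (\<forall>S. compact S \<longrightarrow> g absolutely_integrable_on S) \<and>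
     (\<forall>\<phi> :: 'a \<Rightarrow> real. test_function \<phi> \<longrightarrow>
        (\<forall>b\<in>Basis. (LINT x|lebesgue. u x * frechet_derivative \<phi> (at x) b)
                  = - (LINT x|lebesgue. (g x \<bullet> b) * \<phi> x)))"

text \<open>A weak gradient is unique up to a null set, so the choice is immaterial in integrals.\<close>

definition weak_gradient :: "('a::euclidean_space \<Rightarrow> real) \<Rightarrow> 'a \<Rightarrow> 'a" where
  "weak_gradient u = (SOME g. is_weak_gradient u g)"

definition in_W1p :: "real \<Rightarrow> ('a::euclidean_space \<Rightarrow> real) \<Rightarrow> bool" where
  "in_W1p p u \<longleftrightarrow> in_Lp p u \<and> (\<exists>g. is_weak_gradient u g \<and> in_Lp p g)"

definition total_variation :: "('a::euclidean_space \<Rightarrow> real) \<Rightarrow> ennreal" where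
  "total_variation u =
     (SUP \<phi> \<in> {\<phi> :: 'a \<Rightarrow> 'a. test_function \<phi> \<and> (AE x in lebesgue. norm (\<phi> x) \<le> 1)}.
        ennreal \<bar>LINT x|lebesgue. u x * divergence \<phi> x\<bar>)"

definition in_BV :: "('a::euclidean_space \<Rightarrow> real) \<Rightarrow> bool" where
  "in_BV u \<longleftrightarrow> in_Lp 1 u \<and> total_variation u < \<infinity>"

text \<open>Intended for \<open>p \<ge> 1\<close> and \<open>u\<close> in \<open>L\<^sup>p\<close>.\<close>

definition Phi :: "real \<Rightarrow> ('a::euclidean_space \<Rightarrow> real) \<Rightarrow> ennreal" where
  "Phi p u =
     (if p > 1
      then (if in_W1p p u
            then (\<integral>\<^sup>+x. ennreal (norm (weak_gradient u x) powr p) \<partial>lebesgue)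
            else \<infinity>)
      else total_variation u)"

text \<open>
  Surface measure on the unit sphere, defined through polar coordinates: a Borel subset \<open>A\<close> of the
  sphere has measure \<open>N\<close> times the volume of the cone \<open>{t \<sigma> | 0 < t \<le> 1, \<sigma> \<in> A}\<close>.
  For \<open>N = 1\<close> this is counting measure on \<open>{-1, 1}\<close>.
\<close>

definition sphere_measure :: "'a::euclidean_space measure" where
  "sphere_measure =
     scale_measure (of_nat DIM('a))
       (distr (restrict_space lborel (cball 0 1 - {0})) (restrict_space borel (sphere 0 1))
          (\<lambda>x. x /\<^sub>R norm x))"

text \<open>
  The constant \<open>K\<^sub>N\<^sub>,\<^sub>p\<close>, computed with the unit vector \<open>e\<close>; its value does not depend on \<open>e\<close>.
\<close>

definition K_const :: "'a::euclidean_space \<Rightarrow> real \<Rightarrow> real" where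
  "K_const e p = (LINT s|sphere_measure. \<bar>e \<bullet> s\<bar> powr p)"

text \<open>
  On the diagonal the quotient below is \<open>0\<close> by the convention \<open>a / 0 = 0\<close>, so the diagonal, a null
  set, does not belong to the domain of integration.
\<close>

definition Phi_lam ::
  "real \<Rightarrow> real \<Rightarrow> real \<Rightarrow> ('a::euclidean_space \<Rightarrow> real) \<Rightarrow> ennreal" where
  "Phi_lam p \<gamma> l u =
     ennreal (l powr p) *
     (\<integral>\<^sup>+(x, y) \<in> {(x, y). \<bar>u x - u y\<bar> / norm (x - y) powr (1 + \<gamma> / p) > l}.
        ennreal (norm (x - y) powr (- real DIM('a) + \<gamma>)) \<partial>lebesgue)"

end

theory Submission
  imports Defs "HOL-Probability.Probability" "HOL-Real_Asymp.Real_Asymp"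
begin

text \<open>
  Put \<open>Q = \<bar>u x - u y\<bar> / \<bar>x - y\<bar>\<^sup>1\<^sup>+\<^sup>\<gamma>\<^sup>/\<^sup>p\<close> and let \<open>\<nu>\<close> be the measure \<open>\<bar>x - y\<bar>\<^sup>\<gamma>\<^sup>-\<^sup>N dx dy\<close>. If \<open>\<Phi>\<^sub>\<lambda>(u) \<le> A\<close> for
  all small \<open>\<lambda>\<close>, integrating \<open>p \<lambda>\<^sup>p\<^sup>-\<^sup>1 \<nu>(Q > \<lambda>)\<close> over \<open>\<lambda>\<close> bounded below by \<open>\<tau>\<close> bounds the integral of
  \<open>(Q\<^sup>p - \<tau>\<^sup>p)\<^sub>+\<close> by \<open>A p ln (1/\<tau>) + O(1)\<close>. Since \<open>Q\<^sup>p \<bar>x - y\<bar>\<^sup>\<gamma>\<close> is the \<open>p\<close>-th power of the difference quotient,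
  this is a logarithmic version of the Bourgain-Brezis-Mironescu estimate with a convex integrand. It
  is therefore inherited by the mollifications of the truncations of \<open>u\<close>, and for these smooth
  functions Fatou's lemma turns it into \<open>K \<integral>\<bar>\<nabla>u\<^sub>n\<bar>\<^sup>p \<le> A \<bar>\<gamma>\<bar>\<close>. The total variation is lower semicontinuous;
  for \<open>p > 1\<close> uniform convexity yields an \<open>L\<^sup>p\<close> limit of approximate gradients.
\<close>

text \<open>The set where \<open>Q\<close> exceeds \<lambda> does not depend convexly on
  \<open>u\<close>, so Jensen's inequality cannot be applied to \<open>Phi_lam\<close> at a single
  level; the integration over \<lambda> restores convexity. The hypothesis says nothing about
  \<lambda> away from 0. Truncation in height deals with this: since \<gamma> < - p,
  \<open>Q\<close> is the difference of values times a positive power of the distance, so for a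
  bounded function \<open>Q\<close> stays below any given positive level near the diagonal, where
  the gradient is seen. The factor |\<gamma>| comes from counting logarithms. At inner radius
  exp(-k) the starting level satisfies p ln(1/\<tau>) = |\<gamma>| k + O(1), so the upper bound has
  slope A |\<gamma>| in k. The scale invariant weight |h|^(-N) makes the energy of a differentiable
  function grow, up to the threshold, at least with slope K times the integral of |grad|^p.
  Comparing slopes in k removes every constant that depends on the truncation height or the
  threshold, so the bound is uniform over the approximations. These approximations have gradients
  that converge only when paired with test functions, hence the separate passage to the
  limit.\<close>

abbreviation Lp_energy :: "real \<Rightarrow> 'x measure \<Rightarrow> ('x \<Rightarrow> 'b::real_normed_vector) \<Rightarrow> ennreal" where
  "Lp_energy p M f \<equiv> \<integral>\<^sup>+x. ennreal (norm (f x) powr p) \<partial>M"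

section \<open>Smooth bump functions\<close>

lemma C_k_continuous: "C_k k f \<Longrightarrow> continuous_on UNIV f"
  by (cases k) (auto intro!: differentiable_imp_continuous_on simp: differentiable_on_def
      differentiable_at_withinI)

lemma C_k_Suc_imp: "C_k (Suc k) f \<Longrightarrow> C_k k f"
proof (induction k arbitrary: f)
  case 0
  then show ?case using C_k_continuous by (metis C_k.simps(1))
next
  case (Suc k)
  then show ?case by (metis C_k.simps(2))
qed

text \<open>For a family closed under directional derivatives, such as \<open>range flat\<close>,
  this gives smoothness without formulas for higher derivatives.\<close>

lemma C_k_coinduct:
  assumes "f \<in> F" and "\<And>f x. f \<in> F \<Longrightarrow> f differentiable at x"
    and "\<And>f v. f \<in> F \<Longrightarrow> (\<lambda>x. frechet_derivative f (at x) v) \<in> F"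
  shows "C_k k f"
  using assms(1)
proof (induction k arbitrary: f)
  case 0
  then show ?case using assms(2)
    by (auto intro!: differentiable_imp_continuous_on simp: differentiable_on_def
      differentiable_at_withinI)
qed (use assms(2,3) in auto)

lemma C_k_const: "C_k k (\<lambda>x. c)"
  by (rule C_k_coinduct[where F = "range (\<lambda>c x. c)"]) (auto simp: frechet_derivative_const)

lemma C_k_add: "C_k k f \<Longrightarrow> C_k k g \<Longrightarrow> C_k k (\<lambda>x. f x + g x)"
proof (induction k arbitrary: f g)
  case (Suc k)
  have "frechet_derivative (\<lambda>x. f x + g x) (at x) =
     (\<lambda>v. frechet_derivative f (at x) v + frechet_derivative g (at x) v)" for x
    using Suc.prems
    by (intro frechet_derivative_at[symmetric] has_derivative_add) (auto simp: frechet_derivative_works[symmetric])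
  then show ?case using Suc by auto
qed (auto intro!: continuous_on_add)

lemma C_k_mult:
  fixes f g :: "'a::euclidean_space \<Rightarrow> real"
  shows "C_k k f \<Longrightarrow> C_k k g \<Longrightarrow> C_k k (\<lambda>x. f x * g x)"
proof (induction k arbitrary: f g)
  case 0
  then show ?case by (auto intro!: continuous_on_mult)
next
  case (Suc k)
  have "frechet_derivative (\<lambda>x. f x * g x) (at x) =
     (\<lambda>v. f x * frechet_derivative g (at x) v + frechet_derivative f (at x) v * g x)" for x
    using Suc.prems
    by (intro frechet_derivative_at[symmetric] has_derivative_mult) (auto simp: frechet_derivative_works)
  then show ?case
    using Suc C_k_Suc_imp[OF Suc.prems(1)] C_k_Suc_imp[OF Suc.prems(2)]
    by (auto intro!: C_k_add)
qed

lemma C_k_prod: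
  fixes f :: "'i \<Rightarrow> 'a::euclidean_space \<Rightarrow> real"
  shows "(\<And>i. i \<in> I \<Longrightarrow> C_k k (f i)) \<Longrightarrow> C_k k (\<lambda>x. \<Prod>i\<in>I. f i x)"
  by (induction I rule: infinite_finite_induct) (auto intro: C_k_mult C_k_const)

text \<open>By the chain rule the derivative in direction \<open>v\<close> is the constant
  \<open>v \<bullet> a\<close> times the derivative of \<open>h\<close> at the same affine argument,
  so the induction hypothesis, general in \<open>h\<close>, applies to that derivative.\<close>

lemma C_k_compose_affine:
  fixes h :: "real \<Rightarrow> real" and a :: "'a::euclidean_space"
  shows "C_k k h \<Longrightarrow> C_k k (\<lambda>x. h (x \<bullet> a + c))"
proof (induction k arbitrary: h)
  case 0
  then show ?case by (auto intro!: continuous_intros continuous_on_compose2[of UNIV h])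
next
  case (Suc k)
  have d: "((\<lambda>x. h (x \<bullet> a + c)) has_derivative
      (\<lambda>v. frechet_derivative h (at (x \<bullet> a + c)) (v \<bullet> a))) (at x)" for x
  proof -
    have h: "(h has_derivative frechet_derivative h (at (x \<bullet> a + c))) (at (x \<bullet> a + c))"
      using Suc.prems by (simp add: frechet_derivative_works[symmetric])
    have "((\<lambda>x. x \<bullet> a + c) has_derivative (\<lambda>v. v \<bullet> a)) (at x)"
      by (auto intro!: derivative_eq_intros)
    from has_derivative_compose[OF this h] show ?thesis .
  qed
  have lin: "frechet_derivative h (at t) s = s * frechet_derivative h (at t) 1" for t s
  proof -
    have "linear (frechet_derivative h (at t))"
      using Suc.prems by (auto intro: linear_frechet_derivative)
    from linear_scale[OF this, of s 1] show ?thesis by simp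
  qed
  have "frechet_derivative (\<lambda>x. h (x \<bullet> a + c)) (at x) v =
      (v \<bullet> a) * frechet_derivative h (at (x \<bullet> a + c)) 1" for x v
    using frechet_derivative_at[OF d[of x]] lin by metis
  moreover have "(\<lambda>x. h (x \<bullet> a + c)) differentiable at x" for x
    using d[of x] unfolding differentiable_def by blast
  moreover have "C_k k (\<lambda>x. frechet_derivative h (at (x \<bullet> a + c)) 1)"
    using Suc.IH[of "\<lambda>t. frechet_derivative h (at t) 1"] Suc.prems by simp
  ultimately show ?case by (simp add: C_k_mult C_k_const)
qed

lemma C_k_linear_compose:
  fixes T :: "'b::euclidean_space \<Rightarrow> 'c::euclidean_space"
  assumes "bounded_linear T"
  shows "C_k k f \<Longrightarrow> C_k k (\<lambda>x. T (f x))"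
proof (induction k arbitrary: f)
  case 0
  then show ?case
    by (auto intro!: bounded_linear.continuous_on[OF assms])
next
  case (Suc k)
  have d: "((\<lambda>x. T (f x)) has_derivative (\<lambda>v. T (frechet_derivative f (at x) v))) (at x)" for x
    using Suc.prems
    by (auto intro!: bounded_linear.has_derivative[OF assms] simp: frechet_derivative_works)
  have "frechet_derivative (\<lambda>x. T (f x)) (at x) v = T (frechet_derivative f (at x) v)" for x v
    using frechet_derivative_at[OF d[of x]] by metis
  moreover have "(\<lambda>x. T (f x)) differentiable at x" for x
    using d[of x] unfolding differentiable_def by blast
  ultimately show ?case using Suc by simp
qed

text \<open>The functions \<open>P(1/t) exp(-1/t)\<close> form a family that is closed under differentiation.\<close>

definition flat :: "real poly \<Rightarrow> real \<Rightarrow> real" where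
  "flat P t = (if t > 0 then poly P (1 / t) * exp (- (1 / t)) else 0)"

lemma poly_exp_tendsto_0: "((\<lambda>s. poly P s * exp (- s)) \<longlongrightarrow> (0::real)) at_top"
proof -
  have "((\<lambda>s. \<Sum>i\<le>degree P. coeff P i * (s ^ i / exp s)) \<longlongrightarrow> (\<Sum>i\<le>degree P. coeff P i * 0)) at_top"
    by (intro tendsto_intros tendsto_power_div_exp_0)
  then show ?thesis
    by (simp add: poly_altdef sum_distrib_right exp_minus divide_inverse mult.assoc)
qed

text \<open>With s = 1/t the chain rule reads d/dt = - s^2 d/ds, and d/ds of P(s) exp(-s) is (P' -
  P)(s) exp(-s). Hence the polynomial s^2 (P - P').\<close>

lemma flat_DERIV:
  "(flat P has_real_derivative flat ([:0, 0, 1:] * (P - pderiv P)) t) (at t)"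
proof (cases t "0::real" rule: linorder_cases)
  case less
  have "(flat P has_real_derivative 0) (at t)"
    by (rule has_field_derivative_transform_within_open[where f = "\<lambda>_. 0" and S = "{..<0}"])
      (use less in \<open>auto simp: flat_def\<close>)
  then show ?thesis using less by (simp add: flat_def)
next
  case greater
  have "((\<lambda>t. poly P (1 / t) * exp (- (1 / t))) has_real_derivative
      poly ([:0, 0, 1:] * (P - pderiv P)) (1 / t) * exp (- (1 / t))) (at t)"
    using greater
    by (auto intro!: derivative_eq_intros DERIV_chain'[where g = "poly P", OF _ poly_DERIV]
        simp: field_simps power2_eq_square)
  then have "(flat P has_real_derivative
      poly ([:0, 0, 1:] * (P - pderiv P)) (1 / t) * exp (- (1 / t))) (at t)"
    by (rule has_field_derivative_transform_within_open[where S = "{0<..}"])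
      (use greater in \<open>auto simp: flat_def\<close>)
  then show ?thesis using greater by (simp add: flat_def)
next
  case equal
  \<comment> \<open>At 0 the right difference quotient is again of exponential type: dividing by h
    multiplies the polynomial by s = 1/h.\<close>
  have "((\<lambda>s. poly ([:0, 1:] * P) s * exp (- s)) \<longlongrightarrow> 0) at_top"
    by (rule poly_exp_tendsto_0)
  then have "((\<lambda>h. poly ([:0, 1:] * P) (inverse h) * exp (- inverse h)) \<longlongrightarrow> 0) (at_right 0)"
    by (rule filterlim_compose) (rule filterlim_inverse_at_top_right)
  then have right: "((\<lambda>h. flat P h / h) \<longlongrightarrow> 0) (at_right 0)"
    by (rule Lim_transform_eventually)
      (auto simp: flat_def eventually_at_right_field divide_inverse intro!: exI[of _ 1])
  have left: "((\<lambda>h. flat P h / h) \<longlongrightarrow> 0) (at_left 0)"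
    by (rule Lim_transform_eventually[OF tendsto_const])
      (auto simp: flat_def eventually_at_left_field intro!: exI[of _ "-1"])
  have "((\<lambda>h. flat P h / h) \<longlongrightarrow> 0) (at 0)"
    using left right filterlim_split_at by blast
  then show ?thesis using equal by (simp add: DERIV_def flat_def)
qed

lemma flat_C_k: "C_k k (flat P)"
proof (rule C_k_coinduct[where F = "range flat"])
  have d: "(flat P has_derivative (\<lambda>v. flat ([:0, 0, 1:] * (P - pderiv P)) t * v)) (at t)" for P t
    using flat_DERIV[of P t] by (simp add: has_field_derivative_def)
  show "f differentiable at x" if "f \<in> range flat" for f :: "real \<Rightarrow> real" and x
    using that d by (auto simp: differentiable_def)
  show "(\<lambda>x. frechet_derivative f (at x) v) \<in> range flat"
    if f: "f \<in> range flat" for f :: "real \<Rightarrow> real" and v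
  proof -
    obtain P where P: "f = flat P" using f by auto
    \<comment> \<open>The direction \<open>v\<close> is a scalar and is absorbed into the
      polynomial, so the family is closed under directional derivatives.\<close>
    have "frechet_derivative f (at t) v = flat (smult v ([:0, 0, 1:] * (P - pderiv P))) t" for t
      using frechet_derivative_at[OF d[of P t], symmetric] by (simp add: P flat_def)
    then show ?thesis by auto
  qed
qed auto

text \<open>Since \<open>flat 1 (m t)\<close> tends to the indicator of \<open>t > 0\<close> as \<open>m\<close> grows, smooth bumps approximate the
  indicator of a box without any convolution.\<close>

definition bump :: "real \<Rightarrow> 'a \<Rightarrow> 'a \<Rightarrow> 'a::euclidean_space \<Rightarrow> real" where
  "bump m a c x = (\<Prod>b\<in>Basis. flat 1 (m * (x \<bullet> b - a \<bullet> b)) * flat 1 (m * (c \<bullet> b - x \<bullet> b)))"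

lemma flat_1_bounds: "0 \<le> flat 1 t" "flat 1 t \<le> 1"
  by (auto simp: flat_def)

lemma bump_bounds: "0 \<le> bump m a c x" "bump m a c x \<le> 1"
  unfolding bump_def
  by (auto intro!: prod_nonneg mult_nonneg_nonneg flat_1_bounds prod_le_1 mult_le_one)

lemma bump_pos_iff: "m > 0 \<Longrightarrow> bump m a c x > 0 \<longleftrightarrow> x \<in> box a c"
proof -
  assume m: "m > 0"
  have "bump m a c x > 0 \<longleftrightarrow> bump m a c x \<noteq> 0"
    using bump_bounds(1)[of m a c x] by auto
  also have "\<dots> \<longleftrightarrow> x \<in> box a c"
    using m by (auto simp: bump_def mem_box flat_def zero_less_mult_iff)
  finally show ?thesis .
qed

lemma C_k_bump: "C_k k (bump m a c)"
proof -
  have eq: "bump m a c = (\<lambda>x. \<Prod>b\<in>Basis. flat 1 (x \<bullet> (m *\<^sub>R b) + (- m * (a \<bullet> b))) *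
      flat 1 (x \<bullet> (- m *\<^sub>R b) + m * (c \<bullet> b)))"
    by (auto simp: bump_def fun_eq_iff algebra_simps)
  show ?thesis unfolding eq
    by (intro C_k_prod C_k_mult C_k_compose_affine flat_C_k)
qed

lemma test_function_bump: "m > 0 \<Longrightarrow> test_function (bump m a c)"
proof -
  assume m: "m > 0"
  have "{x. bump m a c x \<noteq> 0} \<subseteq> cbox a c"
    using bump_pos_iff[OF m, of a c] bump_bounds(1)[of m a c] box_subset_cbox[of a c]
    by (auto simp: less_le)
  then have "closure {x. bump m a c x \<noteq> 0} \<subseteq> cbox a c"
    by (rule closure_minimal) (rule closed_cbox)
  then have "compact (closure {x. bump m a c x \<noteq> 0})"
    using bounded_subset[OF bounded_cbox] by (auto simp: compact_eq_bounded_closed)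
  then show ?thesis by (simp add: test_function_def C_k_bump)
qed

text \<open>A factor exp(-1/(m t)) tends to 1 for t > 0, and it is constantly 0 otherwise, so the
  limit holds at every point, with the open box. \<open>Suc k\<close> keeps the scale
  positive.\<close>

lemma bump_tendsto: "(\<lambda>k. bump (real (Suc k)) a c x) \<longlonglongrightarrow> indicator (box a c) x"
proof -
  have f: "(\<lambda>k. flat 1 (real (Suc k) * t)) \<longlonglongrightarrow> indicator {0<..} t" for t
  proof (cases "t > 0")
    case True
    have "(\<lambda>k. exp (- (1 / t * inverse (real (Suc k))))) \<longlonglongrightarrow> exp (- (1 / t * 0))"
      by (intro tendsto_intros LIMSEQ_inverse_real_of_nat)
    moreover have "flat 1 (real (Suc k) * t) = exp (- (1 / t * inverse (real (Suc k))))" for k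
      using True by (simp add: flat_def divide_inverse mult.commute add_pos_nonneg zero_less_mult_iff)
    ultimately show ?thesis using True by simp
  next
    case False
    then have "flat 1 (real (Suc k) * t) = 0" for k
      by (simp add: flat_def zero_less_mult_iff)
    then show ?thesis using False by simp
  qed
  have "(\<lambda>k. bump (real (Suc k)) a c x) \<longlonglongrightarrow>
      (\<Prod>b\<in>Basis. indicator {0<..} (x \<bullet> b - a \<bullet> b) * indicator {0<..} (c \<bullet> b - x \<bullet> b))"
    unfolding bump_def by (intro tendsto_prod tendsto_mult f)
  also have "(\<Prod>b\<in>Basis. indicator {0<..} (x \<bullet> b - a \<bullet> b) * indicator {0<..} (c \<bullet> b - x \<bullet> b)) =
      (indicator (box a c) x :: real)"
  proof (cases "x \<in> box a c")
    case False
    then obtain b where "b \<in> Basis" "\<not> (a \<bullet> b < x \<bullet> b \<and> x \<bullet> b < c \<bullet> b)"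
      by (auto simp: mem_box)
    then have "\<exists>b\<in>Basis. indicator {0<..} (x \<bullet> b - a \<bullet> b) * indicator {0<..} (c \<bullet> b - x \<bullet> b) = (0::real)"
      by (intro bexI[of _ b]) auto
    then show ?thesis using False by (simp add: prod_zero_iff)
  qed (auto simp: mem_box intro!: prod.neutral)
  finally show ?thesis .
qed

text \<open>One radius and one constant for all the dominated convergence arguments below:
  \<open>B\<close> bounds the function and its partial derivatives and is a Lipschitz
  constant.\<close>

definition C1_bound :: "('a::euclidean_space \<Rightarrow> real) \<Rightarrow> real \<Rightarrow> real \<Rightarrow> bool" where
  "C1_bound \<phi> R B \<longleftrightarrow> R > 0 \<and> B > 0 \<and> (\<forall>x. norm x > R \<longrightarrow> \<phi> x = 0) \<and>
     (\<forall>x v. norm x > R \<longrightarrow> frechet_derivative \<phi> (at x) v = 0) \<and> (\<forall>x. \<bar>\<phi> x\<bar> \<le> B) \<and>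
     (\<forall>x. \<forall>b\<in>Basis. \<bar>frechet_derivative \<phi> (at x) b\<bar> \<le> B) \<and> (\<forall>x y. \<bar>\<phi> x - \<phi> y\<bar> \<le> B * norm (x - y))"

lemma C1_boundD:
  assumes "C1_bound \<phi> R B"
  shows "R > 0" "B > 0" "norm x > R \<Longrightarrow> \<phi> x = 0" "norm x > R \<Longrightarrow> frechet_derivative \<phi> (at x) v = 0"
    "\<bar>\<phi> x\<bar> \<le> B" "b \<in> Basis \<Longrightarrow> \<bar>frechet_derivative \<phi> (at x) b\<bar> \<le> B" "\<bar>\<phi> x - \<phi> y\<bar> \<le> B * norm (x - y)"
  using assms unfolding C1_bound_def by blast+

text \<open>The derivative vanishes wherever the function vanishes in a neighbourhood, so continuity
  on a compact ball bounds everything; the Lipschitz bound follows from the mean value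
  inequality.\<close>

lemma test_function_C1_bound:
  fixes \<phi> :: "'a::euclidean_space \<Rightarrow> real"
  assumes "test_function \<phi>"
  shows "\<exists>R B. C1_bound \<phi> R B"
proof -
  define D where "D x v = frechet_derivative \<phi> (at x) v" for x v
  have C1: "C_k (Suc 0) \<phi>" and cpt: "compact (closure {x. \<phi> x \<noteq> 0})"
    using assms unfolding test_function_def by blast+
  have d: "(\<phi> has_derivative D x) (at x)" for x
    using C1 unfolding D_def by (simp add: frechet_derivative_works[symmetric])
  have cD: "continuous_on UNIV (\<lambda>x. D x v)" for v
    using C1 by (simp add: D_def)
  have c\<phi>: "continuous_on UNIV \<phi>" using C1 C_k_continuous by blast
  obtain R where R: "R > 0" "\<And>x. x \<in> closure {x. \<phi> x \<noteq> 0} \<Longrightarrow> norm x \<le> R"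
    using compact_imp_bounded[OF cpt] unfolding bounded_pos by auto
  have z: "\<phi> x = 0" if "norm x > R" for x
    using that R(2)[of x] closure_subset[of "{x. \<phi> x \<noteq> 0}"] by force
  have zD: "D x v = 0" if "norm x > R" for x v
  proof -
    have "(\<phi> has_derivative (\<lambda>v. 0)) (at x)"
      by (rule has_derivative_transform_within_open[of "\<lambda>x. 0" _ _ _ "- cball 0 R"])
        (use that z in auto)
    with d[of x] show ?thesis using has_derivative_unique by metis
  qed
  have bdd: "\<exists>B. \<forall>x. \<bar>f x\<bar> \<le> B" if "continuous_on UNIV f" "\<And>x. norm x > R \<Longrightarrow> f x = 0" for f :: "'a \<Rightarrow> real"
  proof -
    have "compact (f ` cball 0 R)"
      by (intro compact_continuous_image continuous_on_subset[OF that(1)]) auto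
    then obtain B where B: "\<And>x. x \<in> cball 0 R \<Longrightarrow> \<bar>f x\<bar> \<le> B"
      using compact_imp_bounded bounded_iff by (metis (mono_tags, lifting) imageI real_norm_def)
    have "\<bar>f x\<bar> \<le> max B 0" for x
      using B[of x] that(2)[of x] by (cases "norm x \<le> R") auto
    then show ?thesis by blast
  qed
  obtain B0 where B0: "\<And>x. \<bar>\<phi> x\<bar> \<le> B0" using bdd[OF c\<phi> z] by blast
  obtain Bb where Bb: "\<And>b x. \<bar>D x b\<bar> \<le> Bb b" using bdd[OF cD zD] by metis
  \<comment> \<open>The sum of the bounds on the partial derivatives dominates the operator norm;
    the summand 1 makes \<open>B\<close> positive.\<close>
  define B where "B = \<bar>B0\<bar> + 1 + (\<Sum>b\<in>Basis. Bb b)"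
  have Bb0: "0 \<le> Bb b" for b using Bb[of 0 b] by linarith
  have BB: "Bb b \<le> (\<Sum>b\<in>Basis. Bb b)" if "b \<in> Basis" for b
    using that Bb0 by (intro member_le_sum) auto
  have S0: "0 \<le> (\<Sum>b\<in>Basis. Bb b)" by (intro sum_nonneg Bb0)
  have on: "onorm (D x) \<le> B" for x
  proof (rule onorm_bound)
    show "B \<ge> 0" using S0 by (simp add: B_def)
    fix v
    have "D x v = (\<Sum>b\<in>Basis. (v \<bullet> b) *\<^sub>R D x b)"
    proof -
      have l: "linear (D x)" using d has_derivative_linear by blast
      show ?thesis
        by (subst euclidean_representation[of v, symmetric])
          (simp add: linear_sum[OF l] linear_scale[OF l])
    qed
    also have "norm \<dots> \<le> (\<Sum>b\<in>Basis. norm v * Bb b)"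
      by (intro sum_norm_le) (auto simp: abs_mult intro!: mult_mono Bb Basis_le_norm)
    also have "\<dots> \<le> B * norm v"
      by (simp add: B_def sum_distrib_left[symmetric] mult.commute[of _ "norm v"] mult_left_mono)
    finally show "norm (D x v) \<le> B * norm v" .
  qed
  have "\<bar>\<phi> x - \<phi> y\<bar> \<le> B * norm (x - y)" for x y
    using differentiable_bound[of UNIV \<phi> D B x y] d on by (auto simp: has_derivative_at_withinI)
  moreover have "\<bar>\<phi> x\<bar> \<le> B" for x using B0[of x] S0 by (simp add: B_def)
  moreover have "\<bar>D x b\<bar> \<le> B" if "b \<in> Basis" for x b
    using Bb[of x b] BB[OF that] by (simp add: B_def)
  moreover have "B > 0" using S0 by (simp add: B_def)
  ultimately have "C1_bound \<phi> R B" unfolding C1_bound_def using R(1) z zD by (auto simp: D_def)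
  then show ?thesis by blast
qed

lemma test_function_has_derivative:
  assumes "test_function \<phi>"
  shows "(\<phi> has_derivative frechet_derivative \<phi> (at x)) (at x)"
proof -
  have "C_k (Suc 0) \<phi>" using assms unfolding test_function_def by blast
  then show ?thesis by (simp add: frechet_derivative_works[symmetric])
qed

lemma test_function_continuous: "test_function \<phi> \<Longrightarrow> continuous_on UNIV \<phi>"
  unfolding test_function_def using C_k_continuous by blast

lemma test_function_borel: "test_function \<phi> \<Longrightarrow> \<phi> \<in> borel_measurable borel"
  by (intro borel_measurable_continuous_onI test_function_continuous)

lemma test_function_derivative_continuous:
  "test_function \<phi> \<Longrightarrow> continuous_on UNIV (\<lambda>x. frechet_derivative \<phi> (at x) v)"
  unfolding test_function_def using C_k.simps by metis

text \<open>Reduces vector fields in the total variation to scalar test functions, one coordinate at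
  a time.\<close>

lemma test_function_inner:
  fixes \<phi> :: "'a::euclidean_space \<Rightarrow> 'b::euclidean_space"
  assumes "test_function \<phi>"
  shows "test_function (\<lambda>x. \<phi> x \<bullet> b)"
    and "frechet_derivative (\<lambda>x. \<phi> x \<bullet> b) (at x) v = frechet_derivative \<phi> (at x) v \<bullet> b"
proof -
  have "closure {x. \<phi> x \<bullet> b \<noteq> 0} \<subseteq> closure {x. \<phi> x \<noteq> 0}"
    by (intro closure_mono) auto
  then have "compact (closure {x. \<phi> x \<bullet> b \<noteq> 0})"
    using assms unfolding test_function_def
    by (metis closed_closure closed_Int_compact inf.absorb_iff1)
  then show "test_function (\<lambda>x. \<phi> x \<bullet> b)"
    using assms C_k_linear_compose[OF bounded_linear_inner_left[of b]]
    unfolding test_function_def by blast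
  have "((\<lambda>x. \<phi> x \<bullet> b) has_derivative (\<lambda>v. frechet_derivative \<phi> (at x) v \<bullet> b)) (at x)"
    by (intro bounded_linear.has_derivative[OF bounded_linear_inner_left]
        test_function_has_derivative assms)
  from frechet_derivative_at[OF this]
  show "frechet_derivative (\<lambda>x. \<phi> x \<bullet> b) (at x) v = frechet_derivative \<phi> (at x) v \<bullet> b" by metis
qed

section \<open>Rotation invariance\<close>

text \<open>Uniqueness of the translation invariant measure up to a factor, which the ball fixes to be 1.\<close>

lemma lborel_distr_isometry:
  fixes T :: "'a::euclidean_space \<Rightarrow> 'a"
  assumes lin: "linear T" and iso: "\<And>x. norm (T x) = norm x"
  shows "distr lborel borel T = lborel"
proof -
  define \<mu> where "\<mu> = distr lborel borel T"
  have bl: "bounded_linear T" using lin linear_conv_bounded_linear by blast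
  have Tm[measurable]: "T \<in> borel_measurable borel"
    using bl by (simp add: borel_measurable_continuous_onI linear_continuous_on)
  have inj: "inj T"
    using iso lin linear_injective_0 by (metis norm_eq_zero)
  have surj: "surj T" using inj lin linear_injective_imp_surjective by blast
  have s\<mu>[measurable_cong, simp]: "sets \<mu> = sets borel" "space \<mu> = UNIV" by (simp_all add: \<mu>_def)
  have trans: "(\<integral>\<^sup>+y. f (y + x) \<partial>\<mu>) = (\<integral>\<^sup>+y. f y \<partial>\<mu>)" if [measurable]: "f \<in> borel_measurable borel" for f x
  proof -
    obtain z where z: "x = T z" using surj by blast
    have "(\<integral>\<^sup>+y. f (y + x) \<partial>\<mu>) = (\<integral>\<^sup>+y. f (T (y + z)) \<partial>lborel)"
      unfolding \<mu>_def by (subst nn_integral_distr) (auto simp: z linear_add[OF lin])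
    also have "\<dots> = (\<integral>\<^sup>+y. f (T y) \<partial>distr lborel borel ((+) z))"
      by (subst nn_integral_distr) (auto simp: add.commute)
    also have "\<dots> = (\<integral>\<^sup>+y. f y \<partial>\<mu>)"
      unfolding \<mu>_def by (subst nn_integral_distr) (auto simp: lborel_distr_plus)
    finally show ?thesis .
  qed
  \<comment> \<open>An isometry fixing 0 preserves centred balls. This yields sigma-finiteness of
    \<open>\<mu>\<close> and the normalisation.\<close>
  have vim: "T -` ball 0 r = (ball 0 r :: 'a set)" for r by (auto simp: iso)
  have ball: "emeasure \<mu> (ball 0 r) = emeasure lborel (ball 0 r :: 'a set)" for r
    unfolding \<mu>_def by (subst emeasure_distr) (auto simp: vim)
  interpret \<mu>: sigma_finite_measure \<mu>
  proof
    show "\<exists>A. countable A \<and> A \<subseteq> sets \<mu> \<and> \<Union> A = space \<mu> \<and> (\<forall>a\<in>A. emeasure \<mu> a \<noteq> \<infinity>)"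
    proof (intro exI[of _ "range (\<lambda>n. ball 0 (real n))"] conjI ballI)
      show "\<Union> (range (\<lambda>n. ball 0 (real n))) = space \<mu>"
        using reals_Archimedean2 by (auto simp: dist_norm)
    qed (use emeasure_lborel_ball_finite in \<open>auto simp: ball less_top\<close>)
  qed
  interpret P: pair_sigma_finite lborel \<mu> ..
  have eq: "emeasure \<mu> A = emeasure lborel A" if [measurable]: "A \<in> sets borel" for A
  proof -
    let ?B = "ball 0 1 :: 'a set"
    have [measurable]: "?B \<in> sets borel" by simp
    \<comment> \<open>The double integral of \<open>indicator A y * indicator ?B (y - x)\<close> is
      evaluated twice. Integrating in \<open>x\<close> first gives the ball volume times
      \<open>\<mu>\<close> of \<open>A\<close>; shifting \<open>y\<close> by \<open>x\<close> first
      gives the Lebesgue measure of \<open>A\<close> times the same ball volume, which is positive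
      and finite and cancels.\<close>
    have "emeasure \<mu> A * emeasure lborel ?B = (\<integral>\<^sup>+y. indicator A y * emeasure lborel ?B \<partial>\<mu>)"
      by (simp add: nn_integral_multc)
    also have "\<dots> = (\<integral>\<^sup>+y. indicator A y * (\<integral>\<^sup>+x. indicator ?B (y - x) \<partial>lborel) \<partial>\<mu>)"
    proof (intro nn_integral_cong arg_cong2[where f = "(*)"] refl)
      fix y :: 'a
      have "(\<lambda>x. indicator ?B (y - x) :: ennreal) = indicator (ball y 1)"
        by (auto simp: fun_eq_iff indicator_def dist_norm norm_minus_commute)
      then show "emeasure lborel ?B = (\<integral>\<^sup>+x. indicator ?B (y - x) \<partial>lborel)"
        by (simp add: emeasure_ball)
    qed
    also have "\<dots> = (\<integral>\<^sup>+y. (\<integral>\<^sup>+x. indicator A y * indicator ?B (y - x) \<partial>lborel) \<partial>\<mu>)"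
      by (intro nn_integral_cong nn_integral_cmult[symmetric]) measurable
    also have "\<dots> = (\<integral>\<^sup>+x. (\<integral>\<^sup>+y. indicator A y * indicator ?B (y - x) \<partial>\<mu>) \<partial>lborel)"
      by (intro P.Fubini') measurable
    also have "\<dots> = (\<integral>\<^sup>+x. (\<integral>\<^sup>+y. indicator A (y + x) * indicator ?B y \<partial>\<mu>) \<partial>lborel)"
    proof (rule nn_integral_cong)
      fix x
      show "(\<integral>\<^sup>+y. indicator A y * indicator ?B (y - x) \<partial>\<mu>) = (\<integral>\<^sup>+y. indicator A (y + x) * indicator ?B y \<partial>\<mu>)"
        using trans[of "\<lambda>y. indicator A y * indicator ?B (y - x)" x, symmetric] by simp
    qed
    also have "\<dots> = (\<integral>\<^sup>+y. (\<integral>\<^sup>+x. indicator A (y + x) * indicator ?B y \<partial>lborel) \<partial>\<mu>)"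
      by (intro P.Fubini'[symmetric]) measurable
    also have "\<dots> = (\<integral>\<^sup>+y. (\<integral>\<^sup>+x. indicator A (y + x) \<partial>lborel) * indicator ?B y \<partial>\<mu>)"
      by (intro nn_integral_cong nn_integral_multc) measurable
    also have "\<dots> = (\<integral>\<^sup>+y. emeasure lborel A * indicator ?B y \<partial>\<mu>)"
    proof (intro nn_integral_cong arg_cong2[where f = "(*)"] refl)
      fix y :: 'a
      have "(\<integral>\<^sup>+x. indicator A (y + x) \<partial>lborel) = (\<integral>\<^sup>+x. indicator A x \<partial>distr lborel borel ((+) y))"
        by (subst nn_integral_distr) auto
      then show "(\<integral>\<^sup>+x. indicator A (y + x) \<partial>lborel) = emeasure lborel A"
        by (simp add: lborel_distr_plus)
    qed
    also have "\<dots> = emeasure lborel A * emeasure lborel ?B"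
      by (simp add: nn_integral_cmult_indicator ball)
    finally show ?thesis
      using unit_ball_vol_pos[of "real DIM('a)"]
      by (simp add: emeasure_ball mult_right_ennreal_cancel not_le[THEN iffD2])
  qed
  show ?thesis unfolding \<mu>_def[symmetric]
    by (rule measure_eqI) (auto simp: eq)
qed

text \<open>The Householder reflection in the hyperplane orthogonal to \<open>w\<close>. For
  \<open>w = 0\<close> the convention on division makes it the identity.\<close>

definition reflection :: "'a::euclidean_space \<Rightarrow> 'a \<Rightarrow> 'a" where
  "reflection w x = x - (2 * (x \<bullet> w) / (w \<bullet> w)) *\<^sub>R w"

lemma linear_reflection: "linear (reflection w)"
  by (rule linearI) (auto simp: reflection_def inner_add_left algebra_simps add_divide_distrib)

lemma inner_reflection: "reflection w x \<bullet> reflection w y = x \<bullet> y"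
  by (cases "w = 0") (auto simp: reflection_def inner_diff_left inner_diff_right inner_commute field_simps)

lemma norm_reflection: "norm (reflection w x) = norm x"
  by (simp add: norm_eq_sqrt_inner inner_reflection)

text \<open>For equal norms the hyperplane orthogonal to e - e' bisects the pair: |e - e'|^2 = 2 e .
  (e - e'), so the coefficient in \<open>reflection\<close> is 1.\<close>

lemma reflection_swap:
  assumes "norm e = norm e'"
  shows "reflection (e - e') e = e'"
proof (cases "e = e'")
  case False
  have "e \<bullet> e = e' \<bullet> e'" using assms by (simp add: norm_eq)
  then have "(e - e') \<bullet> (e - e') = 2 * (e \<bullet> (e - e'))"
    by (simp add: inner_diff_left inner_diff_right inner_commute)
  moreover have "(e - e') \<bullet> (e - e') \<noteq> 0" using False by simp
  ultimately show ?thesis by (simp add: reflection_def)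
qed (simp add: reflection_def)

lemma nn_integral_reflection:
  assumes "f \<in> borel_measurable borel"
  shows "(\<integral>\<^sup>+x. f (reflection w x) \<partial>lborel) = (\<integral>\<^sup>+x. f x \<partial>lborel)"
proof -
  have "reflection w \<in> borel_measurable borel"
    using linear_reflection[of w] linear_conv_bounded_linear linear_continuous_on borel_measurable_continuous_onI
    by blast
  then have "(\<integral>\<^sup>+x. f (reflection w x) \<partial>lborel) = (\<integral>\<^sup>+x. f x \<partial>distr lborel borel (reflection w))"
    by (subst nn_integral_distr) (use assms in auto)
  then show ?thesis
    by (simp add: lborel_distr_isometry linear_reflection norm_reflection)
qed

section \<open>Polar coordinates and the constant \<open>K_const\<close>\<close>

lemma sets_sphere_measure:
  "sets (sphere_measure :: 'a::euclidean_space measure) = sets (restrict_space borel (sphere 0 1))"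
  by (simp add: sphere_measure_def)

lemma normalize_measurable:
  "(\<lambda>x::'a::euclidean_space. x /\<^sub>R norm x) \<in> restrict_space lborel (cball 0 1 - {0}) \<rightarrow>\<^sub>M restrict_space borel (sphere 0 1)"
  by (rule measurable_restrict_space2)
    (auto simp: space_restrict_space intro!: measurable_restrict_space1 divide_self)

lemma nn_integral_sphere_measure:
  fixes f :: "'a::euclidean_space \<Rightarrow> ennreal"
  assumes [measurable]: "f \<in> borel_measurable borel"
  shows "(\<integral>\<^sup>+s. f s \<partial>sphere_measure) =
    of_nat DIM('a) * (\<integral>\<^sup>+x. f (x /\<^sub>R norm x) * indicator (cball 0 1 - {0}) x \<partial>lborel)"
proof -
  have "(\<integral>\<^sup>+s. f s \<partial>sphere_measure) = of_nat DIM('a) *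
    (\<integral>\<^sup>+x. f (x /\<^sub>R norm x) \<partial>restrict_space lborel (cball 0 1 - {0}))"
    unfolding sphere_measure_def
    by (subst nn_integral_scale_measure, simp add: measurable_restrict_space1)
      (subst nn_integral_distr[OF normalize_measurable], auto simp: measurable_restrict_space1)
  then show ?thesis by (simp add: nn_integral_restrict_space)
qed

text \<open>Cauchy-Schwarz bounds the integrand by 1 on a cone of finite volume, so the Bochner
  integral is not the default value 0 and equals the nonnegative one.\<close>

lemma K_const_eq_nn_integral:
  fixes e :: "'a::euclidean_space"
  assumes e: "norm e = 1" and p: "1 \<le> p"
  shows "ennreal (K_const e p) =
    of_nat DIM('a) * (\<integral>\<^sup>+x. ennreal (\<bar>e \<bullet> (x /\<^sub>R norm x)\<bar> powr p) * indicator (cball 0 1 - {0}) x \<partial>lborel)"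
    and "K_const e p > 0"
proof -
  let ?f = "\<lambda>s. \<bar>e \<bullet> s\<bar> powr p"
  have [measurable]: "cball 0 1 - {0::'a} \<in> sets borel" by simp
  have m: "?f \<in> borel_measurable sphere_measure"
    using measurable_restrict_space1[of ?f borel borel "sphere 0 1"]
    by (simp add: measurable_cong_sets[OF sets_sphere_measure refl])
  have nn: "(\<integral>\<^sup>+s. ennreal (?f s) \<partial>sphere_measure) =
    of_nat DIM('a) * (\<integral>\<^sup>+x. ennreal (\<bar>e \<bullet> (x /\<^sub>R norm x)\<bar> powr p) * indicator (cball 0 1 - {0}) x \<partial>lborel)"
    by (rule nn_integral_sphere_measure) measurable
  have le1: "\<bar>e \<bullet> (x /\<^sub>R norm x)\<bar> powr p \<le> 1" for x
  proof -
    have "\<bar>e \<bullet> (x /\<^sub>R norm x)\<bar> \<le> norm e * norm (x /\<^sub>R norm x)" by (rule Cauchy_Schwarz_ineq2)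
    also have "\<dots> \<le> 1" using e by (cases "x = 0") auto
    finally have "\<bar>e \<bullet> (x /\<^sub>R norm x)\<bar> \<le> 1" .
    then show ?thesis using p by (simp add: powr_le1)
  qed
  have "(\<integral>\<^sup>+x. ennreal (\<bar>e \<bullet> (x /\<^sub>R norm x)\<bar> powr p) * indicator (cball 0 1 - {0}) x \<partial>lborel)
      \<le> (\<integral>\<^sup>+x. indicator (cball 0 1 :: 'a set) x \<partial>lborel)"
  proof (rule nn_integral_mono)
    fix x :: 'a
    have "ennreal (\<bar>e \<bullet> (x /\<^sub>R norm x)\<bar> powr p) \<le> 1" using le1[of x] by (simp add: ennreal_le_1)
    then show "ennreal (\<bar>e \<bullet> (x /\<^sub>R norm x)\<bar> powr p) * indicator (cball 0 1 - {0}) x \<le> indicator (cball 0 1) x"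
      by (auto split: split_indicator)
  qed
  also have "\<dots> < \<infinity>" using emeasure_lborel_cball_finite[of "0::'a" 1] by simp
  finally have fin: "(\<integral>\<^sup>+s. ennreal (?f s) \<partial>sphere_measure) < \<infinity>"
    unfolding nn by (simp add: ennreal_mult_less_top of_nat_less_top)
  have "K_const e p = enn2real (\<integral>\<^sup>+s. ennreal (?f s) \<partial>sphere_measure)"
    unfolding K_const_def by (rule integral_eq_nn_integral[OF m]) auto
  then show eq: "ennreal (K_const e p) =
    of_nat DIM('a) * (\<integral>\<^sup>+x. ennreal (\<bar>e \<bullet> (x /\<^sub>R norm x)\<bar> powr p) * indicator (cball 0 1 - {0}) x \<partial>lborel)"
    using fin nn by simp
  have "(\<integral>\<^sup>+x. ennreal (\<bar>e \<bullet> (x /\<^sub>R norm x)\<bar> powr p) * indicator (cball 0 1 - {0}) x \<partial>lborel) \<noteq> 0"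
  proof
    assume "(\<integral>\<^sup>+x. ennreal (\<bar>e \<bullet> (x /\<^sub>R norm x)\<bar> powr p) * indicator (cball 0 1 - {0}) x \<partial>lborel) = 0"
    then have "AE x in lborel. ennreal (\<bar>e \<bullet> (x /\<^sub>R norm x)\<bar> powr p) * indicator (cball 0 1 - {0}) x = 0"
      by (subst (asm) nn_integral_0_iff_AE) measurable
    \<comment> \<open>This ball lies in the unit ball and in the half space
      \<open>e \<bullet> x > 0\<close>, where the integrand is positive.\<close>
    then have "AE x in lborel. x \<notin> ball (e /\<^sub>R 2) (1/2)"
    proof eventually_elim
      case (elim x)
      show ?case
      proof
        assume x: "x \<in> ball (e /\<^sub>R 2) (1/2)"
        have "e \<bullet> (e /\<^sub>R 2 - x) \<le> norm e * norm (e /\<^sub>R 2 - x)" by (rule norm_cauchy_schwarz)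
        also have "\<dots> < 1/2" using x e by (simp add: dist_norm)
        finally have "e \<bullet> x > 0" using e by (simp add: inner_diff_right dot_square_norm)
        moreover have "norm x \<le> norm (e /\<^sub>R 2) + norm (e /\<^sub>R 2 - x)" by norm
        then have "norm x \<le> 1" using x e by (simp add: dist_norm)
        ultimately show False using elim by (auto simp: indicator_def split: if_splits)
      qed
    qed
    then have "emeasure lborel (ball (e /\<^sub>R 2) (1/2)) = 0"
      using AE_iff_measurable[of "ball (e /\<^sub>R 2) (1/2)" lborel "\<lambda>x. x \<notin> ball (e /\<^sub>R 2) (1/2)"]
      by (auto simp: set_eq_iff)
    then show False
      using unit_ball_vol_pos[of "real DIM('a)"]
      by (auto simp: emeasure_ball ennreal_eq_0_iff mult_le_0_iff power_le_zero_eq not_le[symmetric])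
  qed
  then have "ennreal (K_const e p) \<noteq> 0" unfolding eq by simp
  then show "K_const e p > 0" by (simp add: ennreal_eq_0_iff)
qed

text \<open>A reflection carrying \<open>e\<close> to \<open>v /\<^sub>R norm v\<close> preserves
  Lebesgue measure and the punctured ball, so the integral depends on \<open>v\<close> only through
  its norm. For unit \<open>v\<close> this is the independence of \<open>K_const\<close> from
  \<open>e\<close>.\<close>

lemma K_const_homogeneous:
  fixes e v :: "'a::euclidean_space"
  assumes e: "norm e = 1" and p: "1 \<le> p"
  shows "of_nat DIM('a) * (\<integral>\<^sup>+x. ennreal (\<bar>v \<bullet> (x /\<^sub>R norm x)\<bar> powr p) * indicator (cball 0 1 - {0}) x \<partial>lborel)
     = ennreal (K_const e p) * ennreal (norm v powr p)"
proof (cases "v = 0")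
  case False
  define e' where "e' = v /\<^sub>R norm v"
  define w where "w = e - e'"
  have [measurable]: "cball 0 1 - {0::'a} \<in> sets borel" by simp
  have n: "norm e = norm e'" using e False by (simp add: e'_def)
  have vw: "v \<bullet> reflection w x = norm v * (e \<bullet> x)" for x
  proof -
    have "v = norm v *\<^sub>R reflection w e"
      using reflection_swap[OF n] False by (simp add: w_def e'_def)
    then have "v \<bullet> reflection w x = norm v * (reflection w e \<bullet> reflection w x)"
      by (metis inner_scaleR_left)
    then show ?thesis by (simp add: inner_reflection)
  qed
  have "(\<integral>\<^sup>+x. ennreal (\<bar>v \<bullet> (x /\<^sub>R norm x)\<bar> powr p) * indicator (cball 0 1 - {0}) x \<partial>lborel)
      = (\<integral>\<^sup>+x. ennreal (\<bar>v \<bullet> (reflection w x /\<^sub>R norm (reflection w x))\<bar> powr p) * indicator (cball 0 1 - {0}) (reflection w x) \<partial>lborel)"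
    by (rule nn_integral_reflection[symmetric])
      measurable
  also have "\<dots> = (\<integral>\<^sup>+x. ennreal (norm v powr p) * (ennreal (\<bar>e \<bullet> (x /\<^sub>R norm x)\<bar> powr p) * indicator (cball 0 1 - {0}) x) \<partial>lborel)"
  proof (intro nn_integral_cong)
    fix x :: 'a
    have "reflection w x = 0 \<longleftrightarrow> x = 0" using norm_reflection[of w x] by (metis norm_eq_zero)
    then have i: "indicator (cball 0 1 - {0}) (reflection w x) = (indicator (cball 0 1 - {0}) x :: ennreal)"
      by (auto simp: indicator_def norm_reflection)
    have "\<bar>v \<bullet> (reflection w x /\<^sub>R norm (reflection w x))\<bar> powr p = norm v powr p * \<bar>e \<bullet> (x /\<^sub>R norm x)\<bar> powr p"
      by (simp add: vw norm_reflection abs_mult powr_mult powr_divide)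
    then show "ennreal (\<bar>v \<bullet> (reflection w x /\<^sub>R norm (reflection w x))\<bar> powr p) * indicator (cball 0 1 - {0}) (reflection w x) =
       ennreal (norm v powr p) * (ennreal (\<bar>e \<bullet> (x /\<^sub>R norm x)\<bar> powr p) * indicator (cball 0 1 - {0}) x)"
      unfolding i by (simp add: ennreal_mult mult.assoc)
  qed
  also have "\<dots> = ennreal (norm v powr p) * (\<integral>\<^sup>+x. ennreal (\<bar>e \<bullet> (x /\<^sub>R norm x)\<bar> powr p) * indicator (cball 0 1 - {0}) x \<partial>lborel)"
    by (intro nn_integral_cmult) measurable
  finally show ?thesis
    unfolding K_const_eq_nn_integral(1)[OF e p] by (simp add: ac_simps)
qed (use p in simp)

section \<open>Translations and point reflections of Lebesgue integrals\<close>

lemma nn_integral_lborel_translation: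
  fixes f :: "'a::euclidean_space \<Rightarrow> ennreal"
  assumes [measurable]: "f \<in> borel_measurable borel"
  shows "(\<integral>\<^sup>+x. f (a + x) \<partial>lborel) = (\<integral>\<^sup>+x. f x \<partial>lborel)"
proof -
  have "(\<integral>\<^sup>+x. f (a + x) \<partial>lborel) = (\<integral>\<^sup>+x. f x \<partial>distr lborel borel ((+) a))"
    by (subst nn_integral_distr) auto
  then show ?thesis by (simp add: lborel_distr_plus)
qed

lemma integral_lborel_translation:
  fixes f :: "'a::euclidean_space \<Rightarrow> real"
  assumes [measurable]: "f \<in> borel_measurable borel"
  shows "(LINT x|lborel. f (a + x)) = (LINT x|lborel. f x)"
    and "integrable lborel (\<lambda>x. f (a + x)) \<longleftrightarrow> integrable lborel f"
proof -
  have "(LINT x|lborel. f (a + x)) = (LINT x|distr lborel borel ((+) a). f x)"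
    by (subst integral_distr) auto
  then show "(LINT x|lborel. f (a + x)) = (LINT x|lborel. f x)" by (simp add: lborel_distr_plus)
  have "integrable lborel (\<lambda>x. f (a + x)) \<longleftrightarrow> integrable (distr lborel borel ((+) a)) f"
    by (subst integrable_distr_eq) auto
  then show "integrable lborel (\<lambda>x. f (a + x)) \<longleftrightarrow> integrable lborel f" by (simp add: lborel_distr_plus)
qed

lemma lborel_distr_reflect: "distr lborel borel (\<lambda>x. a - x) = (lborel :: 'a::euclidean_space measure)"
proof -
  have "distr lborel borel (\<lambda>x. a - x) = distr (distr lborel borel uminus) borel ((+) a)"
    by (subst distr_distr) (auto simp: o_def)
  also have "distr lborel borel uminus = (lborel :: 'a measure)"
    by (rule lborel_distr_isometry) (auto intro: linearI)
  finally show ?thesis by (simp add: lborel_distr_plus)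
qed

lemma integral_lborel_reflect:
  fixes f :: "'a::euclidean_space \<Rightarrow> real"
  assumes [measurable]: "f \<in> borel_measurable borel"
  shows "(LINT x|lborel. f (a - x)) = (LINT x|lborel. f x)"
proof -
  have "(LINT x|lborel. f (a - x)) = (LINT x|distr lborel borel (\<lambda>x. a - x). f x)"
    by (subst integral_distr) auto
  then show ?thesis by (simp add: lborel_distr_reflect)
qed

section \<open>Weak gradients\<close>

text \<open>The positive and the negative part of \<open>h\<close> define densities that agree on
  boxes, an intersection-stable generator, hence agree almost everywhere. At most one of the two
  parts is nonzero at a point, so both vanish.\<close>

lemma AE_zero_of_box_integrals:
  fixes h :: "'a::euclidean_space \<Rightarrow> real"
  assumes h: "integrable lebesgue h"
    and z: "\<And>a c. (LINT x|lebesgue. h x * indicator (box a c) x) = 0"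
  shows "AE x in lebesgue. h x = 0"
proof -
  \<comment> \<open>Boxes generate only the Borel sets, so the argument runs on a Borel
    representative.\<close>
  obtain g where g[measurable]: "g \<in> borel_measurable lborel" and hg: "AE x in lborel. h x = g x"
    using completion_ex_borel_measurable_real[of h lborel] borel_measurable_integrable[OF h] by auto
  have hg': "AE x in lebesgue. h x = g x" by (intro AE_completion hg)
  have [measurable]: "h \<in> borel_measurable lebesgue" "g \<in> borel_measurable lebesgue"
    using h measurable_completion[OF g] by auto
  have gi: "integrable lborel g"
    using integrable_cong_AE[THEN iffD1, OF _ _ hg' h] integrable_completion[OF g] by simp
  have gz: "(LINT x|lborel. g x * indicator (box a c) x) = 0" for a c
  proof -
    have "(LINT x|lborel. g x * indicator (box a c) x) = (LINT x|lebesgue. g x * indicator (box a c) x)"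
      by (intro integral_completion[symmetric]) measurable
    also have "\<dots> = (LINT x|lebesgue. h x * indicator (box a c) x)"
    proof (rule integral_cong_AE)
      show "AE x in lebesgue. g x * indicator (box a c) x = h x * indicator (box a c) x"
        using hg' by eventually_elim simp
    qed (auto intro!: borel_measurable_times borel_measurable_indicator)
    finally show ?thesis using z by simp
  qed
  let ?p = "\<lambda>x. ennreal (max 0 (g x))" and ?m = "\<lambda>x. ennreal (max 0 (- g x))"
  have pm: "density lborel ?p = density lborel ?m"
  proof (rule measure_eqI_generator_eq)
    let ?E = "range (\<lambda>(a, b). box a b::'a set)"
    show "Int_stable ?E" by (auto simp: Int_stable_def box_Int_box)
    show "?E \<subseteq> Pow UNIV" "sets (density lborel ?p) = sigma_sets UNIV ?E"
      "sets (density lborel ?m) = sigma_sets UNIV ?E"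
      by (simp_all add: borel_eq_box)
    let ?A = "\<lambda>n::nat. box (- (real n *\<^sub>R One)) (real n *\<^sub>R One) :: 'a set"
    show "range ?A \<subseteq> ?E" "(\<Union>i. ?A i) = UNIV" unfolding UN_box_eq_UNIV by auto
    \<comment> \<open>The sign \<open>s\<close>, which is 1 or -1, treats both parts at
      once.\<close>
    have int: "integrable lborel (\<lambda>x. max 0 (s * g x) * indicator (box a c) x)" if "\<bar>s\<bar> = 1" for s a c
      by (rule Bochner_Integration.integrable_bound[OF gi])
        (use that in \<open>auto simp: indicator_def max_def abs_if split: if_splits\<close>)
    have em: "emeasure (density lborel (\<lambda>x. ennreal (max 0 (s * g x)))) (box a c) =
        ennreal (LINT x|lborel. max 0 (s * g x) * indicator (box a c) x)" if "\<bar>s\<bar> = 1" for s a c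
    proof -
      have "emeasure (density lborel (\<lambda>x. ennreal (max 0 (s * g x)))) (box a c) =
        (\<integral>\<^sup>+x. ennreal (max 0 (s * g x)) * indicator (box a c) x \<partial>lborel)"
        by (intro emeasure_density) auto
      also have "\<dots> = (\<integral>\<^sup>+x. ennreal (max 0 (s * g x) * indicator (box a c) x) \<partial>lborel)"
        by (intro nn_integral_cong) (auto simp: indicator_def)
      also have "\<dots> = ennreal (LINT x|lborel. max 0 (s * g x) * indicator (box a c) x)"
        by (intro nn_integral_eq_integral int that) auto
      finally show ?thesis .
    qed
    show "emeasure (density lborel ?p) (?A i) \<noteq> \<infinity>" for i using em[of 1] by simp
    fix X :: "'a set" assume "X \<in> ?E"
    then obtain a c where X: "X = box a c" by auto
    have "(LINT x|lborel. g x * indicator (box a c) x) = (LINT x|lborel. max 0 (1 * g x) * indicator (box a c) x - max 0 (- 1 * g x) * indicator (box a c) x)"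
      by (intro Bochner_Integration.integral_cong) (auto simp: indicator_def)
    also have "\<dots> = (LINT x|lborel. max 0 (1 * g x) * indicator (box a c) x) -
        (LINT x|lborel. max 0 (- 1 * g x) * indicator (box a c) x)"
      by (intro Bochner_Integration.integral_diff int) auto
    finally show "emeasure (density lborel ?p) X = emeasure (density lborel ?m) X"
      using em[of 1 a c] em[of "-1" a c] by (simp add: X gz)
  qed
  have "AE x in lborel. ?p x = ?m x"
    by (intro sigma_finite_measure.density_unique[OF sigma_finite_lborel] pm) measurable
  then have "AE x in lborel. h x = 0"
    using hg by eventually_elim (auto simp: max_def ennreal_eq_0_iff split: if_splits)
  then show ?thesis by (rule AE_completion)
qed

text \<open>Ties the value of \<open>Phi\<close>, which uses a gradient selected by choice, to
  whatever gradient a proof constructs. The difference of two weak gradients is orthogonal to all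
  bumps, hence to indicators of boxes.\<close>

lemma weak_gradient_unique:
  assumes "is_weak_gradient u g" "is_weak_gradient u g'"
  shows "AE x in lebesgue. g x = g' x"
proof -
  have "AE x in lebesgue. ((g x - g' x) \<bullet> b) * indicator (box (- (real n *\<^sub>R One)) (real n *\<^sub>R One)) x = 0"
    if b: "b \<in> Basis" for b and n :: nat
  proof (rule AE_zero_of_box_integrals)
    \<comment> \<open>Weak gradients are only locally integrable, so the difference is first cut off
      to a large box.\<close>
    define A :: "'a set" where "A = box (- (real n *\<^sub>R One)) (real n *\<^sub>R One)"
    let ?h = "\<lambda>x. (g x - g' x) \<bullet> b"
    have loc: "g absolutely_integrable_on cbox a c" "g' absolutely_integrable_on cbox a c" for a c
      using assms by (auto simp: is_weak_gradient_def)
    have hl: "integrable lebesgue (\<lambda>x. ?h x * indicator (box a c) x)"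
      and gl: "integrable lebesgue (\<lambda>x. (g x \<bullet> b) * indicator (box a c) x)"
      and gl': "integrable lebesgue (\<lambda>x. (g' x \<bullet> b) * indicator (box a c) x)" for a c
    proof -
      have "g absolutely_integrable_on box a c" "g' absolutely_integrable_on box a c"
        using set_integrable_subset[OF loc(1)[of a c], of "box a c"]
          set_integrable_subset[OF loc(2)[of a c], of "box a c"] box_subset_cbox[of a c] by auto
      then have i: "integrable lebesgue (\<lambda>x. indicator (box a c) x *\<^sub>R g x)"
        "integrable lebesgue (\<lambda>x. indicator (box a c) x *\<^sub>R g' x)"
        unfolding set_integrable_def .
      have "integrable lebesgue (\<lambda>x. (indicator (box a c) x *\<^sub>R g x) \<bullet> b)"
        "integrable lebesgue (\<lambda>x. (indicator (box a c) x *\<^sub>R g' x) \<bullet> b)"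
        by (rule integrable_inner_left, rule i)+
      then show 1: "integrable lebesgue (\<lambda>x. (g x \<bullet> b) * indicator (box a c) x)"
        and 2: "integrable lebesgue (\<lambda>x. (g' x \<bullet> b) * indicator (box a c) x)"
        by (simp_all only: inner_scaleR_left mult.commute)
      show "integrable lebesgue (\<lambda>x. ?h x * indicator (box a c) x)"
        using Bochner_Integration.integrable_diff[OF 1 2]
        by (simp add: inner_diff_left algebra_simps)
    qed
    show "integrable lebesgue (\<lambda>x. ?h x * indicator A x)" unfolding A_def by (rule hl)
    have bump0: "(LINT x|lebesgue. ?h x * bump (real (Suc k)) a c x) = 0" for a c k
    proof -
      let ?\<phi> = "bump (real (Suc k)) a c"
      have t: "test_function ?\<phi>" by (rule test_function_bump) simp
      have z: "?\<phi> x = ?\<phi> x * indicator (box a c) x" for x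
        using bump_pos_iff[of "real (Suc k)" a c x] bump_bounds(1)[of "real (Suc k)" a c x]
        by (auto simp: indicator_def less_le)
      have meas: "?\<phi> \<in> borel_measurable lebesgue"
        using test_function_borel[OF t] by (intro measurable_completion) simp
      have i: "integrable lebesgue (\<lambda>x. (f x \<bullet> b) * ?\<phi> x)"
        if "integrable lebesgue (\<lambda>x. (f x \<bullet> b) * indicator (box a c) x)" for f :: "'a \<Rightarrow> 'a"
      proof -
        have "integrable lebesgue (\<lambda>x. ((f x \<bullet> b) * indicator (box a c) x) * ?\<phi> x)"
          by (rule Bochner_Integration.integrable_bound[OF that
                borel_measurable_times[OF borel_measurable_integrable[OF that] meas]])
            (use bump_bounds[of "real (Suc k)" a c] in \<open>auto simp: abs_mult mult_left_le\<close>)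
        then show ?thesis by (subst z) (simp add: ac_simps)
      qed
      have "(LINT x|lebesgue. ?h x * ?\<phi> x) = (LINT x|lebesgue. (g x \<bullet> b) * ?\<phi> x - (g' x \<bullet> b) * ?\<phi> x)"
        by (simp add: inner_diff_left left_diff_distrib)
      also have "\<dots> = (LINT x|lebesgue. (g x \<bullet> b) * ?\<phi> x) - (LINT x|lebesgue. (g' x \<bullet> b) * ?\<phi> x)"
        by (intro Bochner_Integration.integral_diff i gl gl')
      also have "\<dots> = 0" using assms t b unfolding is_weak_gradient_def by force
      finally show ?thesis .
    qed
    fix a c :: 'a
    \<comment> \<open>The cut-off costs nothing, because an intersection of boxes is a box.\<close>
    obtain a' c' where ac: "A \<inter> box a c = box a' c'" unfolding A_def box_Int_box by blast
    have "(\<lambda>k. LINT x|lebesgue. ?h x * bump (real (Suc k)) a' c' x) \<longlonglongrightarrow> (LINT x|lebesgue. ?h x * indicator (box a' c') x)"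
    proof (rule integral_dominated_convergence[where w = "\<lambda>x. \<bar>?h x * indicator (box a' c') x\<bar>"])
      \<comment> \<open>The bump vanishes off its box, so the indicator can be inserted; this gives
        an integrable majorant.\<close>
      have eq: "?h x * bump (real (Suc k)) a' c' x = (?h x * indicator (box a' c') x) * bump (real (Suc k)) a' c' x" for x k
        using bump_pos_iff[of "real (Suc k)" a' c' x] bump_bounds(1)[of "real (Suc k)" a' c' x]
        by (auto simp: indicator_def less_le)
      have "bump (real (Suc k)) a' c' \<in> borel_measurable lebesgue" for k
        using test_function_borel[OF test_function_bump[of "real (Suc k)" a' c']]
        by (intro measurable_completion) simp
      then show "(\<lambda>x. ?h x * bump (real (Suc k)) a' c' x) \<in> borel_measurable lebesgue" for k
        unfolding eq by (intro borel_measurable_times borel_measurable_integrable[OF hl])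
      show "AE x in lebesgue. norm (?h x * bump (real (Suc k)) a' c' x) \<le> \<bar>?h x * indicator (box a' c') x\<bar>" for k
        unfolding eq using bump_bounds[of "real (Suc k)" a' c'] by (auto simp: abs_mult mult_left_le)
      show "AE x in lebesgue. (\<lambda>k. ?h x * bump (real (Suc k)) a' c' x) \<longlonglongrightarrow> ?h x * indicator (box a' c') x"
        by (intro AE_I2 tendsto_intros bump_tendsto)
    qed (use hl in \<open>auto intro!: integrable_abs\<close>)
    then have "(LINT x|lebesgue. ?h x * indicator (box a' c') x) = 0"
      unfolding bump0 using LIMSEQ_unique tendsto_const by blast
    then show "(LINT x|lebesgue. (?h x * indicator A x) * indicator (box a c) x) = 0"
      unfolding ac[symmetric] by (simp add: indicator_inter_arith mult.assoc)
  qed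
  then have "AE x in lebesgue. \<forall>b\<in>Basis. \<forall>n::nat.
      ((g x - g' x) \<bullet> b) * indicator (box (- (real n *\<^sub>R One)) (real n *\<^sub>R One)) x = 0"
    unfolding AE_ball_countable[OF countable_finite[OF finite_Basis]] AE_all_countable by blast
  then show ?thesis
  proof eventually_elim
    case (elim x)
    have "x \<in> (\<Union>n::nat. box (- (real n *\<^sub>R One)) (real n *\<^sub>R One))" unfolding UN_box_eq_UNIV by simp
    then obtain n :: nat where n: "x \<in> box (- (real n *\<^sub>R One)) (real n *\<^sub>R One)" by blast
    have "(g x - g' x) \<bullet> b = 0" if "b \<in> Basis" for b
      using elim[rule_format, OF that, of n] unfolding indicator_simps(1)[OF n] by simp
    then show ?case using euclidean_eqI[of "g x - g' x" 0] by simp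
  qed
qed

section \<open>Difference quotients and integration by parts\<close>

lemma has_derivative_imp_quotient_tendsto:
  fixes f :: "'a::euclidean_space \<Rightarrow> real"
  assumes f: "(f has_derivative D) (at x)" and t: "t \<longlonglongrightarrow> 0" "\<And>k. t k \<noteq> (0::real)"
  shows "(\<lambda>k. (f (x + t k *\<^sub>R b) - f x) / t k) \<longlonglongrightarrow> D b"
proof -
  have l: "linear D" using f has_derivative_linear by blast
  have f': "(f has_derivative D) (at (x + 0 *\<^sub>R b))" using f by simp
  have "((\<lambda>s. x + s *\<^sub>R b) has_derivative (\<lambda>s. s *\<^sub>R b)) (at (0::real))"
    by (auto intro!: derivative_eq_intros)
  from has_derivative_compose[OF this f']
  have "((\<lambda>s. f (x + s *\<^sub>R b)) has_derivative (\<lambda>s. D (s *\<^sub>R b))) (at 0)" .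
  moreover have "(\<lambda>s. D (s *\<^sub>R b)) = (*) (D b)"
    by (simp add: linear_scale[OF l] fun_eq_iff mult.commute)
  ultimately have "((\<lambda>s. f (x + s *\<^sub>R b)) has_field_derivative D b) (at 0)"
    by (simp add: has_field_derivative_def)
  then have "((\<lambda>s. (f (x + s *\<^sub>R b) - f x) / s) \<longlongrightarrow> D b) (at 0)"
    by (simp add: DERIV_def)
  moreover have "filterlim t (at 0) sequentially"
    using t by (simp add: filterlim_at)
  ultimately show ?thesis by (rule filterlim_compose)
qed

text \<open>Translation invariance moves the difference quotient from the test function to
  \<open>f\<close> exactly; dominated convergence then lets the step tend to 0. Continuity of
  \<open>v\<close> does not enter: its components are measurable as limits of difference
  quotients.\<close>

lemma integral_by_parts_test_function:
  fixes f \<phi> :: "'a::euclidean_space \<Rightarrow> real"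
  assumes L: "\<And>x y. \<bar>f x - f y\<bar> \<le> L * norm (x - y)"
    and D: "\<And>x. (f has_derivative (\<lambda>h. v x \<bullet> h)) (at x)"
    and \<phi>: "test_function \<phi>" and b: "b \<in> Basis"
  shows "(LINT x|lborel. f x * frechet_derivative \<phi> (at x) b) = - (LINT x|lborel. (v x \<bullet> b) * \<phi> x)"
    and "(\<lambda>x. v x \<bullet> b) \<in> borel_measurable borel"
proof -
  obtain R B where "C1_bound \<phi> R B" using test_function_C1_bound[OF \<phi>] by blast
  note R = C1_boundD[OF this]
  define t where "t k = 1 / real (Suc k)" for k
  let ?q = "\<lambda>k x. (\<phi> (x + t k *\<^sub>R b) - \<phi> x) / t k"
  \<comment> \<open>The step is \<open>- t k\<close>, because shifting the variable turns a forward
    quotient of the test function into a backward quotient of \<open>f\<close>.\<close>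
  let ?s = "\<lambda>k x. (f (x + (- t k) *\<^sub>R b) - f x) / (- t k)"
  have t: "t \<longlonglongrightarrow> 0" unfolding t_def by (rule LIMSEQ_Suc[OF lim_1_over_n])
  have t': "0 < t k" "t k \<le> 1" for k by (auto simp: t_def)
  have nb: "norm b = 1" using b by simp
  have L0: "L \<ge> 0" using L[of b 0] nb by simp
  have cf: "continuous_on UNIV f"
    using D has_derivative_continuous by (metis continuous_at_imp_continuous_on)
  have [measurable]: "f \<in> borel_measurable borel" "\<phi> \<in> borel_measurable borel"
      "(\<lambda>x. frechet_derivative \<phi> (at x) b) \<in> borel_measurable borel"
    using cf test_function_continuous[OF \<phi>] test_function_derivative_continuous[OF \<phi>]
    by (auto intro: borel_measurable_continuous_onI)
  have q1: "(\<lambda>k. ?q k x) \<longlonglongrightarrow> frechet_derivative \<phi> (at x) b" for x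
    by (rule has_derivative_imp_quotient_tendsto[OF test_function_has_derivative[OF \<phi>] t])
      (use t' in \<open>auto simp: less_le\<close>)
  have q2: "(\<lambda>k. ?s k x) \<longlonglongrightarrow> v x \<bullet> b" for x
    by (rule has_derivative_imp_quotient_tendsto[OF D])
      (use t' t tendsto_minus[OF t] in \<open>auto simp: less_le\<close>)
  have mq: "(\<lambda>x. ?s k x) \<in> borel_measurable borel" for k
    by measurable
  show vm[measurable]: "(\<lambda>x. v x \<bullet> b) \<in> borel_measurable borel"
    by (rule borel_measurable_LIMSEQ_real[OF q2 mq])
  \<comment> \<open>Steps are at most 1, so this ball contains the support of the test function and
    of its translates.\<close>
  let ?C = "cball 0 (R + 1) :: 'a set"
  have [measurable]: "?C \<in> sets borel" by simp
  have vol: "integrable lborel (\<lambda>x. c * indicator ?C x)" for c :: real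
    using emeasure_lborel_cball_finite[of "0::'a" "R+1"] by (intro integrable_mult_right integrable_real_indicator) auto
  have fb: "\<bar>f x\<bar> \<le> \<bar>f 0\<bar> + L * (R + 1)" if "x \<in> ?C" for x
  proof -
    have "L * norm x \<le> L * (R + 1)" using that L0 by (intro mult_left_mono) auto
    then show ?thesis using L[of x 0] by simp
  qed
  have lim1: "(\<lambda>k. LINT x|lborel. f x * ?q k x) \<longlonglongrightarrow>
     (LINT x|lborel. f x * frechet_derivative \<phi> (at x) b)"
  proof (rule integral_dominated_convergence[where w = "\<lambda>x. ((\<bar>f 0\<bar> + L * (R + 1)) * B) * indicator ?C x"])
    show "AE x in lborel. norm (f x * ?q k x) \<le> ((\<bar>f 0\<bar> + L * (R + 1)) * B) * indicator ?C x" for k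
    proof (intro AE_I2)
      fix x
      show "norm (f x * ?q k x) \<le> ((\<bar>f 0\<bar> + L * (R + 1)) * B) * indicator ?C x"
      proof (cases "x \<in> ?C")
        case True
        have "\<bar>\<phi> (x + t k *\<^sub>R b) - \<phi> x\<bar> \<le> B * t k" using R(7)[of "x + t k *\<^sub>R b" x] t'[of k] nb by simp
        then have "\<bar>?q k x\<bar> \<le> B" using t'[of k] by (simp add: field_simps abs_divide)
        then have "\<bar>f x\<bar> * \<bar>?q k x\<bar> \<le> (\<bar>f 0\<bar> + L * (R + 1)) * B"
          using fb[OF True] by (intro mult_mono) (use L0 R(1) in auto)
        then show ?thesis using True by (simp add: abs_mult)
      next
        case False
        then have n: "norm x > R + 1" by simp
        have "norm x \<le> norm (x + t k *\<^sub>R b) + norm (t k *\<^sub>R b)"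
          using norm_triangle_ineq4[of "x + t k *\<^sub>R b" "t k *\<^sub>R b"] by simp
        then have "norm (x + t k *\<^sub>R b) > R" using n t'[of k] nb by simp
        then show ?thesis using n R(3) by simp
      qed
    qed
    show "AE x in lborel. (\<lambda>k. f x * ?q k x) \<longlonglongrightarrow> f x * frechet_derivative \<phi> (at x) b"
      by (intro AE_I2 tendsto_intros q1)
  qed (use vol in measurable)
  have lim2: "(\<lambda>k. LINT x|lborel. ?s k x * \<phi> x) \<longlonglongrightarrow>
     (LINT x|lborel. (v x \<bullet> b) * \<phi> x)"
  proof (rule integral_dominated_convergence[where w = "\<lambda>x. (L * B) * indicator ?C x"])
    show "AE x in lborel. norm (?s k x * \<phi> x) \<le> (L * B) * indicator ?C x" for k
    proof (intro AE_I2)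
      fix x
      show "norm (?s k x * \<phi> x) \<le> (L * B) * indicator ?C x"
      proof (cases "x \<in> ?C")
        case True
        have "\<bar>f (x + (- t k) *\<^sub>R b) - f x\<bar> \<le> L * t k" using L[of "x + (- t k) *\<^sub>R b" x] t'[of k] nb by simp
        then have "\<bar>?s k x\<bar> \<le> L" using t'[of k] by (simp add: field_simps abs_divide)
        then have "\<bar>?s k x\<bar> * \<bar>\<phi> x\<bar> \<le> L * B"
          using R(5)[of x] L0 by (intro mult_mono) auto
        then show ?thesis using True by (simp add: abs_mult)
      next
        case False
        then show ?thesis using R(3)[of x] by simp
      qed
    qed
    show "AE x in lborel. (\<lambda>k. ?s k x * \<phi> x) \<longlonglongrightarrow> (v x \<bullet> b) * \<phi> x"
      by (intro AE_I2 tendsto_mult tendsto_const q2)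
  qed (use vol mq in measurable)
  have eq: "(LINT x|lborel. f x * ?q k x) =
      - (LINT x|lborel. ?s k x * \<phi> x)" for k
  proof -
    have i: "integrable lborel (\<lambda>x. f (x + s *\<^sub>R b) * \<phi> x)" if s: "\<bar>s\<bar> \<le> 1" for s
    proof (rule Bochner_Integration.integrable_bound[OF vol[of "(\<bar>f 0\<bar> + L * (R + 1)) * B"]], measurable, intro AE_I2)
      fix x
      show "norm (f (x + s *\<^sub>R b) * \<phi> x) \<le> norm ((\<bar>f 0\<bar> + L * (R + 1)) * B * indicator ?C x)"
      proof (cases "norm x \<le> R")
        case True
        have "norm (x + s *\<^sub>R b) \<le> norm x + \<bar>s\<bar> * norm b" by (metis norm_scaleR norm_triangle_ineq)
        then have "x + s *\<^sub>R b \<in> ?C" using True s nb by simp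
        then have "\<bar>f (x + s *\<^sub>R b)\<bar> * \<bar>\<phi> x\<bar> \<le> (\<bar>f 0\<bar> + L * (R + 1)) * B"
          using fb R(5)[of x] L0 R(1,2) by (intro mult_mono) auto
        then show ?thesis using True L0 R(1,2) by (simp add: abs_mult)
      qed (use R(3)[of x] in auto)
    qed
    have i': "integrable lborel (\<lambda>x. f x * \<phi> (x + t k *\<^sub>R b))"
      using integral_lborel_translation(2)[of "\<lambda>x. f (x - t k *\<^sub>R b) * \<phi> x" "t k *\<^sub>R b"] i[of "- t k"] t'[of k]
      by (simp add: add.commute)
    have i0: "integrable lborel (\<lambda>x. f x * \<phi> x)" using i[of 0] by simp
    have "(LINT x|lborel. f x * ?q k x) =
       ((LINT x|lborel. f x * \<phi> (x + t k *\<^sub>R b)) - (LINT x|lborel. f x * \<phi> x)) / t k"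
      using Bochner_Integration.integral_diff[OF i' i0]
      by (simp add: right_diff_distrib[symmetric])
    also have "(LINT x|lborel. f x * \<phi> (x + t k *\<^sub>R b)) = (LINT x|lborel. f (x + (- t k) *\<^sub>R b) * \<phi> x)"
      using integral_lborel_translation(1)[of "\<lambda>x. f (x - t k *\<^sub>R b) * \<phi> x" "t k *\<^sub>R b"]
      by (simp add: add.commute)
    also have "((LINT x|lborel. f (x + (- t k) *\<^sub>R b) * \<phi> x) - (LINT x|lborel. f x * \<phi> x)) / t k =
       - (LINT x|lborel. ?s k x * \<phi> x)"
      using Bochner_Integration.integral_diff[OF i[of "- t k"] i0] t'[of k]
      by (simp add: left_diff_distrib[symmetric])
    finally show ?thesis .
  qed
  have "(\<lambda>k. LINT x|lborel. f x * ?q k x) \<longlonglongrightarrow> - (LINT x|lborel. (v x \<bullet> b) * \<phi> x)"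
    unfolding eq by (intro tendsto_minus lim2)
  with lim1 show "(LINT x|lborel. f x * frechet_derivative \<phi> (at x) b) = - (LINT x|lborel. (v x \<bullet> b) * \<phi> x)"
    by (rule LIMSEQ_unique)
qed

section \<open>Mollification\<close>

definition mollifier :: "real \<Rightarrow> ('a::euclidean_space \<Rightarrow> real) \<Rightarrow> bool" where
  "mollifier r \<rho> \<longleftrightarrow> test_function \<rho> \<and> (\<forall>x. 0 \<le> \<rho> x) \<and> (\<forall>x. norm x > r \<longrightarrow> \<rho> x = 0) \<and>
     integrable lborel \<rho> \<and> (LINT x|lborel. \<rho> x) = 1"

lemma mollifier_exists:
  assumes "r > 0"
  shows "\<exists>\<rho> :: 'a::euclidean_space \<Rightarrow> real. mollifier r \<rho>"
proof -
  \<comment> \<open>The cube of half side \<open>d\<close> lies in the ball of radius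
    \<open>r\<close>, since the Euclidean norm is at most the sum of the \<open>DIM('a)\<close>
    absolute coordinates.\<close>
  define d where "d = r / real DIM('a)"
  have d: "d > 0" using assms by (simp add: d_def)
  define c :: 'a where "c = d *\<^sub>R One"
  let ?b = "bump 1 (- c) c :: 'a \<Rightarrow> real"
  have t: "test_function ?b" by (rule test_function_bump) simp
  have [measurable]: "?b \<in> borel_measurable borel"
    by (rule test_function_borel[OF t])
  have z: "?b x = 0" if "x \<notin> box (- c) c" for x
    using bump_pos_iff[of 1 "-c" c x] bump_bounds(1)[of 1 "-c" c x] that by auto
  have supp: "?b x = 0" if "norm x > r" for x
  proof (rule z, rule notI)
    assume x: "x \<in> box (- c) c"
    have "norm x \<le> (\<Sum>b\<in>Basis. \<bar>x \<bullet> b\<bar>)" by (rule norm_le_l1)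
    also have "\<dots> \<le> (\<Sum>b\<in>(Basis::'a set). d)"
      using x by (intro sum_mono) (auto simp: mem_box c_def abs_le_iff less_imp_le minus_le_iff)
    also have "\<dots> = r" by (simp add: d_def)
    finally show False using that by simp
  qed
  have i: "integrable lborel ?b"
  proof (rule Bochner_Integration.integrable_bound[of lborel "indicator (box (- c) c) :: 'a \<Rightarrow> real"])
    show "AE x in lborel. norm (?b x) \<le> norm (indicator (box (- c) c) x :: real)"
      using z bump_bounds[of 1 "-c" c] by (auto simp: indicator_def)
    show "integrable lborel (indicator (box (- c) c) :: 'a \<Rightarrow> real)"
      using emeasure_lborel_box_finite[of "-c" c] by (intro integrable_real_indicator) auto
  qed auto
  have pos: "(LINT x|lborel. ?b x) > 0"
  proof -
    have "(LINT x|lborel. ?b x) \<ge> 0" by (intro integral_nonneg_AE) (simp add: bump_bounds(1))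
    moreover have "(LINT x|lborel. ?b x) \<noteq> 0"
    proof
      assume "(LINT x|lborel. ?b x) = 0"
      then have "AE x in lborel. ?b x = 0"
        by (subst (asm) integral_nonneg_eq_0_iff_AE[OF i]) (simp_all add: bump_bounds(1))
      then have "AE x in lborel. x \<notin> box (- c) c"
      proof eventually_elim
        case (elim x) then show ?case using bump_pos_iff[of 1 "-c" c x] by auto
      qed
      then have "emeasure lborel (box (- c) c) = 0"
        using AE_iff_measurable[of "box (- c) c" lborel "\<lambda>x. x \<notin> box (- c) c"] by auto
      moreover have "emeasure lborel (box (- c) c) = ennreal (\<Prod>b\<in>(Basis::'a set). (c - (- c)) \<bullet> b)"
        using d by (subst emeasure_lborel_box) (auto simp: c_def)
      moreover have "(\<Prod>b\<in>(Basis::'a set). (c - (- c)) \<bullet> b) > 0"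
        using d by (intro prod_pos) (auto simp: c_def inner_diff_left inner_add_left)
      ultimately show False by (metis ennreal_eq_0_iff not_le)
    qed
    ultimately show ?thesis by simp
  qed
  define J where "J = (LINT x|lborel. ?b x)"
  let ?\<rho> = "\<lambda>x. inverse J * ?b x"
  have "{x. ?\<rho> x \<noteq> 0} = {x. ?b x \<noteq> 0}" using pos by (auto simp: J_def)
  then have "test_function ?\<rho>"
    using t unfolding test_function_def by (auto intro: C_k_mult C_k_const)
  then have "mollifier r ?\<rho>"
    using pos bump_bounds(1)[of 1 "-c" c] supp i unfolding mollifier_def J_def by auto
  then show ?thesis by blast
qed

lemma integrable_cball: "integrable lborel (\<lambda>z. c * indicator (cball (a::'a::euclidean_space) s) z)" for c :: real
  using emeasure_lborel_cball_finite[of a s] by (intro integrable_mult_right integrable_real_indicator) auto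

text \<open>The function \<open>w\<close> is bounded because it will be a truncation of
  \<open>u\<close>. This alone makes all convolutions with \<open>\<rho>\<close> exist and supplies
  the dominating constants.\<close>

locale mollified =
  fixes \<rho> w :: "'a::euclidean_space \<Rightarrow> real" and r M :: real
  assumes \<rho>: "mollifier r \<rho>" and w[measurable]: "w \<in> borel_measurable borel"
    and wM: "\<And>x. \<bar>w x\<bar> \<le> M"
begin

definition moll :: "'a \<Rightarrow> real" where
  "moll x = (LINT y|lborel. w (x - y) * \<rho> y)"

definition moll_grad :: "'a \<Rightarrow> 'a" where
  "moll_grad x = (\<Sum>b\<in>Basis. (LINT z|lborel. w z * frechet_derivative \<rho> (at (x - z)) b) *\<^sub>R b)"

lemma \<rho>_test: "test_function \<rho>" and \<rho>_nonneg: "0 \<le> \<rho> x" and \<rho>_supp: "norm x > r \<Longrightarrow> \<rho> x = 0"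
  and \<rho>_int: "integrable lborel \<rho>" and \<rho>_1: "(LINT x|lborel. \<rho> x) = 1"
  using \<rho> by (auto simp: mollifier_def)

lemma M_nonneg: "0 \<le> M" using wM[of 0] by linarith

lemma \<rho>_meas[measurable]: "\<rho> \<in> borel_measurable borel"
  by (rule test_function_borel[OF \<rho>_test])

lemma D\<rho>_meas[measurable]: "(\<lambda>x. frechet_derivative \<rho> (at x) v) \<in> borel_measurable borel"
  using borel_measurable_continuous_onI[OF test_function_derivative_continuous[OF \<rho>_test]] .

text \<open>Here the dependence on \<open>x\<close> sits in the smooth factor, as differentiation
  requires; \<open>moll_def\<close> keeps it in \<open>w\<close>, as Jensen's inequality
  requires.\<close>

lemma moll_eq: "moll x = (LINT z|lborel. w z * \<rho> (x - z))"
  unfolding moll_def using integral_lborel_reflect[of "\<lambda>z. w z * \<rho> (x - z)" x] by simp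

lemma integrable_times_translate:
  assumes [measurable]: "\<psi> \<in> borel_measurable borel"
    and B: "\<And>y. \<bar>\<psi> y\<bar> \<le> B" and R: "\<And>y. norm y > R \<Longrightarrow> \<psi> y = 0"
  shows "integrable lborel (\<lambda>z. w z * \<psi> (x - z))"
proof (rule Bochner_Integration.integrable_bound[OF integrable_cball[of "M * B" x R]])
  have B0: "0 \<le> B" using B[of 0] by linarith
  show "AE z in lborel. norm (w z * \<psi> (x - z)) \<le> norm (M * B * indicator (cball x R) z)"
  proof (rule AE_I2)
    fix z
    show "norm (w z * \<psi> (x - z)) \<le> norm (M * B * indicator (cball x R) z)"
      using R[of "x - z"] mult_mono[OF wM[of z] B[of "x - z"]] M_nonneg B0
      by (auto simp: indicator_def dist_norm abs_mult not_le)
  qed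
qed measurable

lemma integrable_moll: "integrable lborel (\<lambda>z. w z * \<rho> (x - z))"
proof -
  obtain R B where "C1_bound \<rho> R B" using test_function_C1_bound[OF \<rho>_test] by blast
  note R = C1_boundD[OF this]
  show ?thesis by (rule integrable_times_translate[OF \<rho>_meas R(5) R(3)])
qed

text \<open>The difference of the two translated kernels is at most B |x - y| and lives on two balls
  of volume \<open>V\<close>.\<close>

lemma moll_Lipschitz: "\<exists>L. \<forall>x y. \<bar>moll x - moll y\<bar> \<le> L * norm (x - y)"
proof -
  obtain R B where "C1_bound \<rho> R B" using test_function_C1_bound[OF \<rho>_test] by blast
  note R = C1_boundD[OF this]
  define V where "V = measure lborel (cball (0::'a) R)"
  have V: "(LINT z|lborel. indicator (cball (a::'a) R) z) = V" for a
  proof -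
    have "emeasure lborel (cball a R) = emeasure lborel (cball (0::'a) R)"
      using R(1) by (simp add: emeasure_cball)
    then show ?thesis by (simp add: V_def measure_def)
  qed
  have "\<bar>moll x - moll y\<bar> \<le> (M * B * (2 * V)) * norm (x - y)" for x y
  proof -
    let ?g = "\<lambda>z. (M * B * norm (x - y)) * indicator (cball x R) z + (M * B * norm (x - y)) * indicator (cball y R) z"
    have "moll x - moll y = (LINT z|lborel. w z * \<rho> (x - z) - w z * \<rho> (y - z))"
      unfolding moll_eq by (intro Bochner_Integration.integral_diff[symmetric] integrable_moll)
    also have "\<bar>\<dots>\<bar> \<le> (LINT z|lborel. ?g z)"
    proof (rule integral_abs_bound_integral)
      show "integrable lborel (\<lambda>z. w z * \<rho> (x - z) - w z * \<rho> (y - z))"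
        by (intro Bochner_Integration.integrable_diff integrable_moll)
      show "integrable lborel ?g"
        by (intro Bochner_Integration.integrable_add integrable_cball)
      fix z
      have "\<bar>w z * \<rho> (x - z) - w z * \<rho> (y - z)\<bar> = \<bar>w z\<bar> * \<bar>\<rho> (x - z) - \<rho> (y - z)\<bar>"
        by (simp add: abs_mult right_diff_distrib[symmetric])
      also have "\<dots> \<le> M * (B * norm (x - y))"
        using R(7)[of "x - z" "y - z"] by (intro mult_mono wM) (auto simp: M_nonneg)
      finally have le: "\<bar>w z * \<rho> (x - z) - w z * \<rho> (y - z)\<bar> \<le> M * B * norm (x - y)" by (simp add: mult.assoc)
      have p: "0 \<le> M * B * norm (x - y)" using M_nonneg R(2) by simp
      show "\<bar>w z * \<rho> (x - z) - w z * \<rho> (y - z)\<bar> \<le> ?g z"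
      proof (cases "z \<in> cball x R \<or> z \<in> cball y R")
        case True
        then have "M * B * norm (x - y) * 1 \<le> ?g z" using p by (auto simp: indicator_def)
        then show ?thesis using le by linarith
      next
        case False
        then show ?thesis using R(3)[of "x - z"] R(3)[of "y - z"] by (simp add: dist_norm)
      qed
    qed
    also have "\<dots> = (M * B * norm (x - y)) * V + (M * B * norm (x - y)) * V"
      by (subst Bochner_Integration.integral_add[OF integrable_cball integrable_cball]) (simp only: integral_mult_right_zero V)
    finally show ?thesis by (simp add: algebra_simps)
  qed
  then show ?thesis by blast
qed

lemma integrable_moll_grad:
  assumes "b \<in> Basis"
  shows "integrable lborel (\<lambda>z. w z * frechet_derivative \<rho> (at (x - z)) b)"
proof -
  obtain R B where "C1_bound \<rho> R B" using test_function_C1_bound[OF \<rho>_test] by blast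
  note R = C1_boundD[OF this]
  show ?thesis by (rule integrable_times_translate[OF D\<rho>_meas R(6)[OF assms] R(4)])
qed

text \<open>Differentiation under the integral: the limit is tested on sequences so that dominated
  convergence applies to the first order remainder of \<open>\<rho>\<close>.\<close>

lemma moll_has_derivative: "(moll has_derivative (\<lambda>h. moll_grad x \<bullet> h)) (at x)"
proof -
  let ?D = "\<lambda>y. frechet_derivative \<rho> (at y)"
  obtain R B where "C1_bound \<rho> R B" using test_function_C1_bound[OF \<rho>_test] by blast
  note R = C1_boundD[OF this]
  have lin: "?D y h = (\<Sum>b\<in>Basis. (h \<bullet> b) * ?D y b)" for y h
  proof -
    have l: "linear (?D y)" using test_function_has_derivative[OF \<rho>_test] has_derivative_linear by blast
    show ?thesis
      by (subst euclidean_representation[of h, symmetric])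
        (simp add: linear_sum[OF l] linear_scale[OF l])
  qed
  have gi: "integrable lborel (\<lambda>z. w z * ?D (x - z) h)" for h
  proof -
    have "integrable lborel (\<lambda>z. \<Sum>b\<in>Basis. (h \<bullet> b) * (w z * ?D (x - z) b))"
      by (intro Bochner_Integration.integrable_sum integrable_mult_right integrable_moll_grad)
    then show ?thesis by (simp add: lin[of _ h] sum_distrib_left ac_simps)
  qed
  have g: "moll_grad x \<bullet> h = (LINT z|lborel. w z * ?D (x - z) h)" for h
  proof -
    have "(LINT z|lborel. w z * ?D (x - z) h) = (LINT z|lborel. (\<Sum>b\<in>Basis. (h \<bullet> b) * (w z * ?D (x - z) b)))"
      by (simp add: lin[of _ h] sum_distrib_left ac_simps)
    also have "\<dots> = (\<Sum>b\<in>Basis. (h \<bullet> b) * (LINT z|lborel. w z * ?D (x - z) b))"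
      by (subst Bochner_Integration.integral_sum) (auto intro!: integrable_mult_right integrable_moll_grad)
    finally show ?thesis by (simp add: moll_grad_def inner_sum_left inner_commute[of h] mult.commute)
  qed
  have Dn: "\<bar>?D y h\<bar> \<le> B * real DIM('a) * norm h" for y h
  proof -
    have "\<bar>?D y h\<bar> \<le> (\<Sum>b\<in>(Basis::'a set). norm h * B)"
      unfolding lin[of y h] real_norm_def[symmetric]
      by (intro sum_norm_le) (auto simp: abs_mult Basis_le_norm R(6) intro!: mult_mono)
    then show ?thesis by (simp add: ac_simps)
  qed
  have "((\<lambda>h. norm (moll (x + h) - moll x - moll_grad x \<bullet> h) / norm h) \<longlongrightarrow> 0) (at 0)"
    unfolding tendsto_at_iff_sequentially
  proof (intro allI impI)
    fix X :: "nat \<Rightarrow> 'a" assume X0: "\<forall>i. X i \<in> UNIV - {0}" and X: "X \<longlonglongrightarrow> 0"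
    \<comment> \<open>A convergent sequence is bounded, so the remainders for all k vanish outside
      one ball of radius \<open>R + s\<close>.\<close>
    obtain s where s: "\<And>i. norm (X i) \<le> s"
      using convergent_imp_bounded[OF X] by (auto simp: bounded_iff)
    let ?q = "\<lambda>k z. (\<rho> (x - z + X k) - \<rho> (x - z) - ?D (x - z) (X k)) / norm (X k)"
    have "(\<lambda>k. LINT z|lborel. w z * ?q k z) \<longlonglongrightarrow> (LINT z|lborel. w z * 0)"
    proof (rule integral_dominated_convergence[where w = "\<lambda>z. (M * (B + B * real DIM('a))) * indicator (cball x (R + s)) z"])
      show "integrable lborel (\<lambda>z. (M * (B + B * real DIM('a))) * indicator (cball x (R + s)) z)"
        by (rule integrable_cball)
      show "AE z in lborel. (\<lambda>k. w z * ?q k z) \<longlonglongrightarrow> w z * 0"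
      proof (intro AE_I2 tendsto_mult tendsto_const)
        fix z
        have "((\<lambda>h. norm (\<rho> (x - z + h) - \<rho> (x - z) - ?D (x - z) h) / norm h) \<longlongrightarrow> 0) (at 0)"
          using test_function_has_derivative[OF \<rho>_test, of "x - z"] unfolding has_derivative_at by simp
        then have "(\<lambda>k. norm (?q k z)) \<longlonglongrightarrow> 0"
          unfolding tendsto_at_iff_sequentially using X X0 by (auto simp: o_def)
        then show "(\<lambda>k. ?q k z) \<longlonglongrightarrow> 0" by (rule tendsto_norm_zero_cancel)
      qed
      show "AE z in lborel. norm (w z * ?q k z) \<le> (M * (B + B * real DIM('a))) * indicator (cball x (R + s)) z" for k
      proof (intro AE_I2)
        fix z
        have Xk: "norm (X k) > 0" using X0 by simp
        have "\<bar>\<rho> (x - z + X k) - \<rho> (x - z) - ?D (x - z) (X k)\<bar> \<le> B * norm (X k) + B * real DIM('a) * norm (X k)"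
          using R(7)[of "x - z + X k" "x - z"] Dn[of "x - z" "X k"] by simp
        then have "\<bar>?q k z\<bar> \<le> B + B * real DIM('a)"
          using Xk by (simp add: abs_divide divide_le_eq algebra_simps)
        then have le: "\<bar>w z\<bar> * \<bar>?q k z\<bar> \<le> M * (B + B * real DIM('a))"
          by (intro mult_mono wM) (auto simp: M_nonneg)
        show "norm (w z * ?q k z) \<le> (M * (B + B * real DIM('a))) * indicator (cball x (R + s)) z"
        proof (cases "z \<in> cball x (R + s)")
          case True then show ?thesis using le by (simp add: abs_mult)
        next
          case False
          then have n: "norm (x - z) > R + s" by (simp add: dist_norm)
          have "norm (x - z) \<le> norm (x - z + X k) + norm (X k)"
            using norm_triangle_ineq4[of "x - z + X k" "X k"] by simp
          then have "norm (x - z + X k) > R" using n s[of k] by simp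
          moreover have "norm (x - z) > R" using n order_trans[OF norm_ge_zero s[of k]] by simp
          ultimately show ?thesis using False R(3,4) by simp
        qed
      qed
    qed measurable
    moreover have "(LINT z|lborel. w z * ?q k z) = (moll (x + X k) - moll x - moll_grad x \<bullet> X k) / norm (X k)" for k
    proof -
      have "(LINT z|lborel. w z * ?q k z) =
        (LINT z|lborel. (w z * \<rho> (x + X k - z) - w z * \<rho> (x - z) - w z * ?D (x - z) (X k)) / norm (X k))"
        by (simp add: algebra_simps)
      also have "\<dots> = (LINT z|lborel. w z * \<rho> (x + X k - z) - w z * \<rho> (x - z) - w z * ?D (x - z) (X k)) / norm (X k)"
        by simp
      also have "(LINT z|lborel. w z * \<rho> (x + X k - z) - w z * \<rho> (x - z) - w z * ?D (x - z) (X k)) =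
         moll (x + X k) - moll x - moll_grad x \<bullet> X k"
        unfolding moll_eq g
        by (subst Bochner_Integration.integral_diff, intro Bochner_Integration.integrable_diff integrable_moll, rule gi,
          subst Bochner_Integration.integral_diff, rule integrable_moll, rule integrable_moll, rule refl)
      finally show ?thesis .
    qed
    ultimately have "(\<lambda>k. (moll (x + X k) - moll x - moll_grad x \<bullet> X k) / norm (X k)) \<longlonglongrightarrow> 0"
      by (simp only: mult_zero_right Bochner_Integration.integral_zero)
    then have "(\<lambda>k. norm ((moll (x + X k) - moll x - moll_grad x \<bullet> X k) / norm (X k))) \<longlonglongrightarrow> 0"
      by (rule tendsto_norm_zero)
    then show "((\<lambda>h. norm (moll (x + h) - moll x - moll_grad x \<bullet> h) / norm h) \<circ> X) \<longlonglongrightarrow> 0"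
      by (simp add: o_def)
  qed
  then show ?thesis
    unfolding has_derivative_at by (simp add: bounded_linear_inner_right)
qed

text \<open>Comes from the difference quotients in \<open>integral_by_parts_test_function\<close>,
  with \<open>\<rho>\<close> as the test function.\<close>

lemma moll_grad_measurable[measurable]: "moll_grad \<in> borel_measurable borel"
proof -
  obtain L where L: "\<And>x y. \<bar>moll x - moll y\<bar> \<le> L * norm (x - y)" using moll_Lipschitz by blast
  have "(\<lambda>x. moll_grad x \<bullet> b) \<in> borel_measurable borel" if "b \<in> Basis" for b
    by (rule integral_by_parts_test_function(2)[OF L moll_has_derivative \<rho>_test that])
  then show ?thesis by (subst borel_measurable_euclidean_space) auto
qed

lemma moll_measurable[measurable]: "moll \<in> borel_measurable borel"
  by (intro borel_measurable_continuous_onI continuous_at_imp_continuous_on ballI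
      has_derivative_continuous[OF moll_has_derivative])

lemma moll_by_parts:
  assumes "test_function \<phi>" "b \<in> Basis"
  shows "(LINT x|lborel. moll x * frechet_derivative \<phi> (at x) b) = - (LINT x|lborel. (moll_grad x \<bullet> b) * \<phi> x)"
proof -
  obtain L where L: "\<And>x y. \<bar>moll x - moll y\<bar> \<le> L * norm (x - y)" using moll_Lipschitz by blast
  show ?thesis by (rule integral_by_parts_test_function(1)[OF L moll_has_derivative assms])
qed

text \<open>A difference of \<open>moll\<close> is the mean of translated differences of
  \<open>w\<close> under the probability density \<open>\<rho>\<close>. After Jensen and Tonelli,
  translation invariance removes the averaging variable.\<close>

lemma moll_Jensen:
  assumes \<Psi>: "convex_on UNIV \<Psi>" and \<Psi>m[measurable]: "\<Psi> \<in> borel_measurable borel"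
    and \<Psi>0: "\<And>t. 0 \<le> \<Psi> t"
  shows "(\<integral>\<^sup>+x. ennreal (\<Psi> (moll (x + h) - moll x)) \<partial>lborel) \<le> (\<integral>\<^sup>+x. ennreal (\<Psi> (w (x + h) - w x)) \<partial>lborel)"
proof -
  define P where "P = density lborel (\<lambda>x. ennreal (\<rho> x))"
  have [measurable_cong, simp]: "sets P = sets borel" by (simp add: P_def)
  interpret P: prob_space P
  proof
    have "emeasure P (space P) = (\<integral>\<^sup>+x. ennreal (\<rho> x) \<partial>lborel)"
      by (simp add: P_def emeasure_density)
    also have "\<dots> = 1" using \<rho>_int \<rho>_nonneg \<rho>_1 by (subst nn_integral_eq_integral) auto
    finally show "emeasure P (space P) = 1" .
  qed
  interpret PL: pair_sigma_finite lborel P ..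
  have mollP: "moll x = (LINT y|P. w (x - y))" for x
    unfolding moll_def P_def by (subst integral_density) (auto simp: \<rho>_nonneg mult.commute)
  have iw: "integrable P (\<lambda>y. w (x - y))" for x
    by (rule P.integrable_const_bound[of _ M]) (use wM in auto)
  define X where "X x y = w (x + h - y) - w (x - y)" for x y
  have Xi: "integrable P (X x)" for x unfolding X_def by (intro Bochner_Integration.integrable_diff iw)
  have EX: "moll (x + h) - moll x = P.expectation (X x)" for x
    unfolding mollP X_def by (intro Bochner_Integration.integral_diff[symmetric] iw)
  have X2: "\<bar>X x y\<bar> \<le> 2 * M" for x y
    using wM[of "x + h - y"] wM[of "x - y"] unfolding X_def by linarith
  \<comment> \<open>Differences of \<open>w\<close> lie in [-2M, 2M], where a convex function is
    bounded by its endpoint values; Jensen needs this integrability.\<close>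
  have \<Psi>b: "\<Psi> t \<le> max (\<Psi> (- (2 * M))) (\<Psi> (2 * M))" if "\<bar>t\<bar> \<le> 2 * M" for t
  proof (rule convex_on_le_max[of "- (2 * M)" "2 * M"])
    show "convex_on {- (2 * M)..2 * M} \<Psi>" using convex_on_subset[OF \<Psi>] by auto
    show "t \<in> {- (2 * M)..2 * M}" using that by (auto simp: abs_le_iff)
  qed
  have [measurable]: "(\<lambda>y. X x y) \<in> borel_measurable borel" for x unfolding X_def by measurable
  have \<Psi>i: "integrable P (\<lambda>y. \<Psi> (X x y))" for x
    by (rule P.integrable_const_bound[of _ "max (\<Psi> (- (2 * M))) (\<Psi> (2 * M))"])
      (use \<Psi>b X2 \<Psi>0 in auto)
  have J: "ennreal (\<Psi> (moll (x + h) - moll x)) \<le> (\<integral>\<^sup>+y. ennreal (\<Psi> (X x y)) \<partial>P)" for x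
  proof -
    have "\<Psi> (P.expectation (X x)) \<le> P.expectation (\<lambda>y. \<Psi> (X x y))"
      by (rule P.jensens_inequality[OF Xi _ _ \<Psi>i \<Psi>]) auto
    then show ?thesis using \<Psi>i \<Psi>0 unfolding EX by (subst nn_integral_eq_integral) (auto intro: ennreal_leI)
  qed
  have "(\<integral>\<^sup>+x. ennreal (\<Psi> (moll (x + h) - moll x)) \<partial>lborel) \<le> (\<integral>\<^sup>+x. \<integral>\<^sup>+y. ennreal (\<Psi> (X x y)) \<partial>P \<partial>lborel)"
    by (intro nn_integral_mono J)
  also have "\<dots> = (\<integral>\<^sup>+y. \<integral>\<^sup>+x. ennreal (\<Psi> (X x y)) \<partial>lborel \<partial>P)"
    unfolding X_def by (intro PL.Fubini'[symmetric]) measurable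
  also have "\<dots> = (\<integral>\<^sup>+y. \<integral>\<^sup>+x. ennreal (\<Psi> (w (x + h) - w x)) \<partial>lborel \<partial>P)"
  proof (rule nn_integral_cong)
    fix y
    show "(\<integral>\<^sup>+x. ennreal (\<Psi> (X x y)) \<partial>lborel) = (\<integral>\<^sup>+x. ennreal (\<Psi> (w (x + h) - w x)) \<partial>lborel)"
      using nn_integral_lborel_translation[of "\<lambda>x. ennreal (\<Psi> (w (x + h) - w x))" "- y"]
      by (simp add: X_def algebra_simps)
  qed
  also have "\<dots> = (\<integral>\<^sup>+x. ennreal (\<Psi> (w (x + h) - w x)) \<partial>lborel)"
    by (simp add: P.emeasure_space_1)
  finally show ?thesis .
qed

text \<open>Fubini moves the smoothing onto the continuous factor, which is then close to
  \<open>\<psi>\<close> uniformly on small scales.\<close>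

lemma moll_pairing:
  assumes \<psi>: "continuous_on UNIV \<psi>" and S: "\<And>x. norm x > S \<Longrightarrow> \<psi> x = 0" and B: "\<And>x. \<bar>\<psi> x\<bar> \<le> B"
  shows "(LINT x|lborel. moll x * \<psi> x) = (LINT z|lborel. w z * (LINT y|lborel. \<rho> y * \<psi> (y + z)))"
proof -
  have [measurable]: "\<psi> \<in> borel_measurable borel" using borel_measurable_continuous_onI[OF \<psi>] .
  have B0: "0 \<le> B" using B[of 0] by linarith
  let ?f = "\<lambda>(x, z). w z * \<rho> (x - z) * \<psi> x"
  have fm[measurable]: "?f \<in> borel_measurable (lborel \<Otimes>\<^sub>M lborel)" by measurable
  obtain R C where "C1_bound \<rho> R C" using test_function_C1_bound[OF \<rho>_test] by blast
  note R = C1_boundD[OF this]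
  note C = R(5)
  have C0: "0 \<le> C" using C[of 0] by linarith
  have i: "integrable (lborel \<Otimes>\<^sub>M lborel) ?f"
  proof (rule Bochner_Integration.integrable_bound[OF _ fm])
    \<comment> \<open>In the support \<open>x\<close> lies in the ball of radius \<open>S\<close>
      and \<open>z\<close> within distance \<open>r\<close> of \<open>x\<close>.\<close>
    let ?A = "cball (0::'a) S \<times> cball (0::'a) (S + r)"
    have "emeasure (lborel \<Otimes>\<^sub>M lborel) ?A = emeasure lborel (cball (0::'a) S) * emeasure lborel (cball (0::'a) (S + r))"
      by (rule lborel.emeasure_pair_measure_Times) auto
    also have "\<dots> < \<infinity>"
      using emeasure_lborel_cball_finite[of "0::'a"] by (simp add: ennreal_mult_less_top)
    finally show "integrable (lborel \<Otimes>\<^sub>M lborel) (\<lambda>v. (M * C * B) * indicator ?A v)"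
      by (intro integrable_mult_right integrable_real_indicator) auto
    show "AE v in lborel \<Otimes>\<^sub>M lborel. norm (?f v) \<le> norm ((M * C * B) * indicator ?A v)"
    proof (intro AE_I2)
      fix v :: "'a \<times> 'a"
      obtain x z where v: "v = (x, z)" by force
      show "norm (?f v) \<le> norm ((M * C * B) * indicator ?A v)"
      proof (cases "v \<in> ?A")
        case True
        have "\<bar>w z\<bar> * \<bar>\<rho> (x - z)\<bar> * \<bar>\<psi> x\<bar> \<le> M * C * B"
          by (intro mult_mono wM C B mult_nonneg_nonneg M_nonneg C0) auto
        then show ?thesis using True v M_nonneg C0 B0 by (simp add: abs_mult)
      next
        case False
        have "norm z \<le> norm x + norm (x - z)" using norm_triangle_ineq4[of x "x - z"] by simp
        then have "norm x > S \<or> norm (x - z) > r" using False v by auto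
        then show ?thesis using S[of x] \<rho>_supp[of "x - z"] v by auto
      qed
    qed
  qed
  have "(LINT x|lborel. moll x * \<psi> x) = (LINT x|lborel. (LINT z|lborel. w z * \<rho> (x - z) * \<psi> x))"
    unfolding moll_eq by simp
  also have "\<dots> = (LINT z|lborel. (LINT x|lborel. w z * \<rho> (x - z) * \<psi> x))"
    using lborel_pair.Fubini_integral[OF i] by simp
  also have "\<dots> = (LINT z|lborel. w z * (LINT y|lborel. \<rho> y * \<psi> (y + z)))"
  proof (intro Bochner_Integration.integral_cong refl)
    fix z
    have "(LINT x|lborel. \<rho> (x - z) * \<psi> x) = (LINT y|lborel. \<rho> y * \<psi> (y + z))"
      using integral_lborel_translation(1)[of "\<lambda>x. \<rho> (x - z) * \<psi> x" z] by (simp add: add.commute)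
    then show "(LINT x|lborel. w z * \<rho> (x - z) * \<psi> x) = w z * (LINT y|lborel. \<rho> y * \<psi> (y + z))"
      by (simp add: mult.assoc)
  qed
  finally show ?thesis .
qed

text \<open>A probability average of values within \<open>e\<close> of \<open>c\<close>. It is used
  three times: with c = \<open>\<psi> z\<close> for convergence, with c = 0 and e = \<open>B\<close>
  for boundedness, and with c = e = 0 for the support.\<close>

lemma mollifier_average:
  assumes \<psi>: "continuous_on UNIV \<psi>" and B: "\<And>x. \<bar>\<psi> x\<bar> \<le> B"
    and e: "\<And>y. norm y \<le> r \<Longrightarrow> \<bar>\<psi> (y + z) - c\<bar> \<le> e"
  shows "\<bar>(LINT y|lborel. \<rho> y * \<psi> (y + z)) - c\<bar> \<le> e"
proof -
  have [measurable]: "\<psi> \<in> borel_measurable borel" using borel_measurable_continuous_onI[OF \<psi>] .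
  have i: "integrable lborel (\<lambda>y. \<rho> y * \<psi> (y + z))"
  proof (rule Bochner_Integration.integrable_bound[OF integrable_mult_right[OF \<rho>_int, of B]])
    show "AE y in lborel. norm (\<rho> y * \<psi> (y + z)) \<le> norm (B * \<rho> y)"
    proof (intro AE_I2)
      fix y
      have "\<bar>\<psi> (y + z)\<bar> * \<bar>\<rho> y\<bar> \<le> \<bar>B\<bar> * \<bar>\<rho> y\<bar>"
        using B[of "y + z"] by (intro mult_right_mono) auto
      then show "norm (\<rho> y * \<psi> (y + z)) \<le> norm (B * \<rho> y)" by (simp add: abs_mult mult.commute)
    qed
  qed measurable
  have ic: "integrable lborel (\<lambda>y. \<rho> y * c)" using \<rho>_int by simp
  have "(LINT y|lborel. \<rho> y * \<psi> (y + z)) - c = (LINT y|lborel. \<rho> y * \<psi> (y + z) - \<rho> y * c)"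
    using Bochner_Integration.integral_diff[OF i ic] \<rho>_1 by simp
  also have "\<bar>\<dots>\<bar> \<le> (LINT y|lborel. e * \<rho> y)"
  proof (rule integral_abs_bound_integral)
    show "integrable lborel (\<lambda>y. \<rho> y * \<psi> (y + z) - \<rho> y * c)" using i ic by simp
    show "integrable lborel (\<lambda>y. e * \<rho> y)" using \<rho>_int by simp
    fix y
    have "\<bar>\<rho> y * \<psi> (y + z) - \<rho> y * c\<bar> = \<rho> y * \<bar>\<psi> (y + z) - c\<bar>"
      using \<rho>_nonneg[of y] by (simp add: right_diff_distrib[symmetric] abs_mult)
    also have "\<dots> \<le> \<rho> y * e"
      using e[of y] \<rho>_nonneg[of y] \<rho>_supp[of y] by (cases "norm y \<le> r") (auto intro: mult_left_mono)
    finally show "\<bar>\<rho> y * \<psi> (y + z) - \<rho> y * c\<bar> \<le> e * \<rho> y" by (simp add: mult.commute)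
  qed
  also have "\<dots> = e" using \<rho>_1 by simp
  finally show ?thesis .
qed

end

section \<open>From logarithmic bounds to gradients\<close>

lemma nn_integral_lborel_scaling:
  fixes f :: "'a::euclidean_space \<Rightarrow> ennreal"
  assumes c: "c > 0" and [measurable]: "f \<in> borel_measurable borel"
  shows "(\<integral>\<^sup>+x. f x \<partial>lborel) = ennreal (c ^ DIM('a)) * (\<integral>\<^sup>+x. f (c *\<^sub>R x) \<partial>lborel)"
proof -
  have "lborel = density (distr lborel borel (\<lambda>x::'a. 0 + (\<Sum>j\<in>Basis. (c * (x \<bullet> j)) *\<^sub>R j)))
      (\<lambda>_. ennreal (\<Prod>j\<in>(Basis::'a set). \<bar>c\<bar>))"
    using c by (intro lborel_affine_euclidean) auto
  also have "(\<lambda>x::'a. 0 + (\<Sum>j\<in>Basis. (c * (x \<bullet> j)) *\<^sub>R j)) = (*\<^sub>R) c"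
    by (simp add: fun_eq_iff scaleR_scaleR[symmetric] scaleR_sum_right[symmetric] euclidean_representation del: scaleR_scaleR)
  finally have eq: "(lborel :: 'a measure) = density (distr lborel borel ((*\<^sub>R) c)) (\<lambda>_. ennreal (c ^ DIM('a)))"
    using c by simp
  have "(\<integral>\<^sup>+x. f x \<partial>lborel) = (\<integral>\<^sup>+x. ennreal (c ^ DIM('a)) * f x \<partial>distr lborel borel ((*\<^sub>R) c))"
    by (subst eq) (simp add: nn_integral_density)
  also have "\<dots> = (\<integral>\<^sup>+x. ennreal (c ^ DIM('a)) * f (c *\<^sub>R x) \<partial>lborel)"
    by (subst nn_integral_distr) auto
  also have "\<dots> = ennreal (c ^ DIM('a)) * (\<integral>\<^sup>+x. f (c *\<^sub>R x) \<partial>lborel)"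
    by (intro nn_integral_cmult) measurable
  finally show ?thesis .
qed

text \<open>Half open, so that consecutive annuli tile a larger one without overlap.\<close>

definition annulus :: "real \<Rightarrow> real \<Rightarrow> 'a::euclidean_space set" where
  "annulus a b = {x. a \<le> norm x \<and> norm x < b}"

lemma annulus_borel[measurable]: "(annulus a b :: 'a::euclidean_space set) \<in> sets borel"
proof -
  have "annulus a b = (- ball 0 a) \<inter> (ball 0 b :: 'a set)" by (auto simp: annulus_def)
  then show ?thesis by (simp only:) (intro sets.Int borel_comp borel_open open_ball)
qed

text \<open>By scaling, a function homogeneous of degree 0 has integral c r^N over the ball of
  radius r; the annulus is a difference of two finite balls.\<close>

lemma nn_integral_homogeneous_annulus:
  fixes F :: "'a::euclidean_space \<Rightarrow> ennreal"
  assumes Fm[measurable]: "F \<in> borel_measurable borel" and hom: "\<And>c x. c > 0 \<Longrightarrow> F (c *\<^sub>R x) = F x"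
    and a: "0 < a" "a \<le> b"
    and fin: "(\<integral>\<^sup>+x. F x * indicator (ball 0 1) x \<partial>lborel) = ennreal c" and c: "0 \<le> c"
  shows "(\<integral>\<^sup>+x. F x * indicator (annulus a b) x \<partial>lborel) = ennreal (c * (b ^ DIM('a) - a ^ DIM('a)))"
proof -
  have [measurable]: "ball 0 r \<in> sets (borel :: 'a measure)" for r by simp
  have ball: "(\<integral>\<^sup>+x. F x * indicator (ball 0 r) x \<partial>lborel) = ennreal (c * r ^ DIM('a))" if "r > 0" for r
  proof -
    have "(\<integral>\<^sup>+x. F x * indicator (ball 0 r) x \<partial>lborel) =
        ennreal (r ^ DIM('a)) * (\<integral>\<^sup>+x. F (r *\<^sub>R x) * indicator (ball 0 r) (r *\<^sub>R x) \<partial>lborel)"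
      by (rule nn_integral_lborel_scaling[OF that]) measurable
    also have "(\<integral>\<^sup>+x. F (r *\<^sub>R x) * indicator (ball 0 r) (r *\<^sub>R x) \<partial>lborel) = (\<integral>\<^sup>+x. F x * indicator (ball 0 1) x \<partial>lborel)"
      using that by (intro nn_integral_cong) (simp add: hom indicator_def)
    finally show ?thesis using that c by (simp add: fin ennreal_mult[symmetric] mult.commute)
  qed
  have "(\<integral>\<^sup>+x. F x * indicator (ball 0 b) x \<partial>lborel) =
     (\<integral>\<^sup>+x. F x * indicator (ball 0 a) x + F x * indicator (annulus a b) x \<partial>lborel)"
    using a by (intro nn_integral_cong) (auto simp: indicator_def annulus_def)
  also have "\<dots> = (\<integral>\<^sup>+x. F x * indicator (ball 0 a) x \<partial>lborel) + (\<integral>\<^sup>+x. F x * indicator (annulus a b) x \<partial>lborel)"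
    by (intro nn_integral_add) measurable
  finally have eq: "ennreal (c * b ^ DIM('a)) = ennreal (c * a ^ DIM('a)) + (\<integral>\<^sup>+x. F x * indicator (annulus a b) x \<partial>lborel)"
    using a ball by simp
  then have "(\<integral>\<^sup>+x. F x * indicator (annulus a b) x \<partial>lborel) = ennreal (c * b ^ DIM('a)) - ennreal (c * a ^ DIM('a))"
    by simp
  then show ?thesis using a c by (simp add: ennreal_minus right_diff_distrib)
qed

text \<open>The annulus is cut into \<open>n\<close> pieces of equal ratio, on which the weight is almost constant, and \<open>n\<close> tends
  to infinity.\<close>

lemma nn_integral_homogeneous_log:
  fixes F :: "'a::euclidean_space \<Rightarrow> ennreal"
  assumes Fm[measurable]: "F \<in> borel_measurable borel" and hom: "\<And>c x. c > 0 \<Longrightarrow> F (c *\<^sub>R x) = F x"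
    and a: "0 < a" "a \<le> b"
    and fin: "(\<integral>\<^sup>+x. F x * indicator (ball 0 1) x \<partial>lborel) = ennreal c" and c: "0 \<le> c"
  shows "ennreal (c * (real DIM('a) * ln (b / a))) \<le>
     (\<integral>\<^sup>+x. F x * ennreal (norm x powr - real DIM('a)) * indicator (annulus a b) x \<partial>lborel)"
    (is "_ \<le> ?I a b")
proof -
  let ?K = "\<lambda>s t x. F x * ennreal (norm x powr - real DIM('a)) * indicator (annulus s t) x"
  define N where "N = real DIM('a)"
  have N: "N > 0" by (simp add: N_def)
  \<comment> \<open>On one piece the weight is at least its value t^(-N) at the outer
    radius.\<close>
  have step: "ennreal (c * (1 - (s / t) powr N)) \<le> ?I s t" if "0 < s" "s \<le> t" for s t
  proof -
    have t: "t > 0" using that by simp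
    have "ennreal (c * (1 - (s / t) powr N)) = ennreal (t powr - N) * ennreal (c * (t ^ DIM('a) - s ^ DIM('a)))"
    proof -
      have "t powr - N * (t ^ DIM('a) - s ^ DIM('a)) = 1 - (s / t) powr N"
        using that t by (simp add: N_def powr_divide powr_minus powr_realpow field_simps)
      then show ?thesis by (simp add: ennreal_mult'[symmetric] mult.left_commute)
    qed
    also have "\<dots> = ennreal (t powr - N) * (\<integral>\<^sup>+x. F x * indicator (annulus s t) x \<partial>lborel)"
      using nn_integral_homogeneous_annulus[OF Fm hom that fin c] by simp
    also have "\<dots> = (\<integral>\<^sup>+x. ennreal (t powr - N) * (F x * indicator (annulus s t) x) \<partial>lborel)"
      by (intro nn_integral_cmult[symmetric]) measurable
    also have "\<dots> \<le> ?I s t"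
    proof (rule nn_integral_mono)
      fix x :: 'a
      show "ennreal (t powr - N) * (F x * indicator (annulus s t) x) \<le> ?K s t x"
      proof (cases "x \<in> annulus s t")
        case True
        then have "t powr - N \<le> norm x powr - N"
          using that N by (intro powr_mono2') (auto simp: annulus_def)
        then show ?thesis using True by (simp add: N_def mult.commute mult_left_mono ennreal_leI)
      qed simp
    qed
    finally show ?thesis .
  qed
  \<comment> \<open>The pieces between s q^i and s q^(i+1) all have the same ratio of radii, hence
    the same lower bound.\<close>
  have pieces: "ennreal (real n * (c * (1 - q powr - N))) \<le> ?I s (s * q ^ n)" if "0 < s" "1 \<le> q" for s q :: real and n :: nat
    using that(1)
  proof (induction n)
    case (Suc n)
    have q: "s * q ^ n \<le> s * q ^ Suc n" "s \<le> s * q ^ n" "0 < s * q ^ n"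
      using that by (auto simp: mult_le_cancel_left1 intro: one_le_power)
    have "ennreal (real (Suc n) * (c * (1 - q powr - N))) =
        ennreal (real n * (c * (1 - q powr - N))) + ennreal (c * (1 - q powr - N))"
    proof -
      have "q powr - N \<le> 1" using that N powr_mono[of "-N" 0 q] by simp
      then have "0 \<le> c * (1 - q powr - N)" using c by simp
      moreover have "real (Suc n) * X = real n * X + X" for X :: real by (simp add: algebra_simps)
      ultimately show ?thesis by (simp only:) (rule ennreal_plus, auto)
    qed
    also have "\<dots> \<le> ?I s (s * q ^ n) + ?I (s * q ^ n) (s * q ^ Suc n)"
    proof (intro add_mono Suc.IH that)
      have "1 - q powr - N = 1 - ((s * q ^ n) / (s * q ^ Suc n)) powr N"
        using that by (simp add: powr_divide powr_minus inverse_eq_divide)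
      then show "ennreal (c * (1 - q powr - N)) \<le> ?I (s * q ^ n) (s * q ^ Suc n)"
        using step[OF q(3,1)] by simp
    qed
    also have "\<dots> = (\<integral>\<^sup>+x. ?K s (s * q ^ n) x
      + ?K (s * q ^ n) (s * q ^ Suc n) x \<partial>lborel)"
      by (intro nn_integral_add[symmetric]) measurable
    also have "\<dots> = ?I s (s * q ^ Suc n)"
    proof (intro nn_integral_cong)
      fix x :: 'a
      show "?K s (s * q ^ n) x
      + ?K (s * q ^ n) (s * q ^ Suc n) x =
       ?K s (s * q ^ Suc n) x"
        using q by (auto simp: annulus_def indicator_def)
    qed
    finally show ?case .
  qed simp
  \<comment> \<open>With q = (b/a)^(1/n) the limit of n (1 - q^(-N)) is minus the derivative at 0 of
    exp(- N ln(b/a) h), with h = 1/n.\<close>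
  have lim: "(\<lambda>n. real (Suc n) * (c * (1 - ((b / a) powr (1 / real (Suc n))) powr - N))) \<longlonglongrightarrow> c * (N * ln (b / a))"
  proof -
    have p: "b / a > 0" using a by simp
    have "((\<lambda>h. (exp (- N * ln (b / a) * h) - 1) / h) \<longlongrightarrow> - N * ln (b / a)) (at 0)"
    proof -
      have "((\<lambda>h. exp (- N * ln (b / a) * h)) has_real_derivative - N * ln (b / a)) (at 0)"
        by (auto intro!: derivative_eq_intros)
      then show ?thesis by (simp add: DERIV_def)
    qed
    moreover have "filterlim (\<lambda>n. 1 / real (Suc n)) (at 0) sequentially"
      unfolding filterlim_at using LIMSEQ_Suc[OF lim_1_over_n] by auto
    ultimately have "(\<lambda>n. (exp (- N * ln (b / a) * (1 / real (Suc n))) - 1) / (1 / real (Suc n))) \<longlonglongrightarrow> - N * ln (b / a)"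
      by (rule filterlim_compose)
    then have "(\<lambda>n. - c * ((exp (- N * ln (b / a) * (1 / real (Suc n))) - 1) / (1 / real (Suc n)))) \<longlonglongrightarrow> - c * (- N * ln (b / a))"
      by (intro tendsto_intros)
    moreover have "((b / a) powr (1 / real (Suc n))) powr - N = exp (- N * ln (b / a) * (1 / real (Suc n)))" for n
    proof -
      have "((b / a) powr (1 / real (Suc n))) powr - N = (b / a) powr ((1 / real (Suc n)) * - N)" by (rule powr_powr)
      also have "\<dots> = exp (((1 / real (Suc n)) * - N) * ln (b / a))" using p by (auto simp: powr_def)
      finally show ?thesis by (simp only: mult.commute mult.left_commute)
    qed
    ultimately show ?thesis by (simp add: algebra_simps)
  qed
  have le: "ennreal (real (Suc n) * (c * (1 - ((b / a) powr (1 / real (Suc n))) powr - N))) \<le> ?I a b" for n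
  proof -
    have "((b / a) powr (1 / real (Suc n))) ^ Suc n = b / a"
      using a by (subst powr_realpow[symmetric]) (auto simp: powr_powr)
    then have "a * ((b / a) powr (1 / real (Suc n))) ^ Suc n = b" using a by simp
    moreover have "1 \<le> (b / a) powr (1 / real (Suc n))" using a by (intro ge_one_powr_ge_zero) auto
    ultimately show ?thesis using pieces[OF a(1), of "(b / a) powr (1 / real (Suc n))" "Suc n"] by metis
  qed
  show ?thesis
    using LIMSEQ_le_const2[OF tendsto_ennrealI[OF lim]] le unfolding N_def by blast
qed

text \<open>The sphere and the origin are null sets. Passes from the cone in
  \<open>sphere_measure\<close> to the open ball, which suits scaling.\<close>

lemma nn_integral_ball_cball:
  fixes F :: "'a::euclidean_space \<Rightarrow> ennreal"
  shows "(\<integral>\<^sup>+x. F x * indicator (cball 0 1 - {0}) x \<partial>lborel) = (\<integral>\<^sup>+x. F x * indicator (ball 0 1) x \<partial>lborel)"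
proof (rule nn_integral_cong_AE)
  have "sphere (0::'a) 1 \<in> null_sets lborel"
    using negligible_sphere[of "0::'a" 1] null_sets_completion_iff[of "sphere (0::'a) 1" lborel]
    by (simp add: negligible_iff_null_sets)
  then have "AE x in lborel. x \<notin> sphere (0::'a) 1" by (rule AE_not_in)
  moreover have "AE x in lborel. x \<noteq> (0::'a)" by (rule AE_lborel_singleton)
  ultimately show "AE x in lborel. F x * indicator (cball 0 1 - {0}) x = F x * indicator (ball 0 1) x"
    by eventually_elim (auto simp: indicator_def)
qed

text \<open>Subtracting the threshold inside a positive part keeps the integrand convex, as Jensen's
  inequality requires, and makes it integrable in \<open>x\<close>.\<close>

definition trunc_pow :: "real \<Rightarrow> real \<Rightarrow> real \<Rightarrow> real" where
  "trunc_pow p \<kappa> t = max 0 (\<bar>t\<bar> powr p - \<kappa>)"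

lemma trunc_pow_nonneg: "0 \<le> trunc_pow p \<kappa> t" by (simp add: trunc_pow_def)

lemma trunc_pow_mono: "0 \<le> p \<Longrightarrow> \<bar>s\<bar> \<le> \<bar>t\<bar> \<Longrightarrow> trunc_pow p \<kappa> s \<le> trunc_pow p \<kappa> t"
  using powr_mono2[of p "\<bar>s\<bar>" "\<bar>t\<bar>"] by (auto simp: trunc_pow_def)

lemma trunc_pow_measurable[measurable]: "trunc_pow p \<kappa> \<in> borel_measurable borel"
  unfolding trunc_pow_def by measurable

text \<open>The weight |h|^(-N) is scale invariant: an annulus counts by the logarithm of its ratio
  of radii.\<close>

abbreviation quot_energy :: "real \<Rightarrow> real \<Rightarrow> 'a set \<Rightarrow> ('a::euclidean_space \<Rightarrow> real) \<Rightarrow> ennreal" where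
  "quot_energy p \<kappa> S f \<equiv> \<integral>\<^sup>+x. (\<integral>\<^sup>+h. ennreal (trunc_pow p \<kappa> ((f (x + h) - f x) / norm h)) *
     ennreal (norm h powr - real DIM('a)) * indicator S h \<partial>lborel) \<partial>lborel"

text \<open>The coefficient of k left by \<open>quot_energy\<close> when the quotient is replaced by
  the directional derivative. The inner \<kappa> pays for the differentiability error, the outer one
  is the threshold. The dimension factor turns the ball integral into an integral over the
  sphere.\<close>

abbreviation slope_energy :: "real \<Rightarrow> real \<Rightarrow> ('a::euclidean_space \<Rightarrow> 'a) \<Rightarrow> ennreal" where
  "slope_energy p \<kappa> v \<equiv> \<integral>\<^sup>+x. of_nat DIM('a) *
     (\<integral>\<^sup>+h. ennreal (trunc_pow p \<kappa> (max 0 (\<bar>v x \<bullet> (h /\<^sub>R norm h)\<bar> - \<kappa>))) * indicator (ball 0 1) h \<partial>lborel) \<partial>lborel"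

text \<open>\<open>Phi_lam\<close> as an iterated Borel integral in the variables x and h = y -
  x.\<close>

abbreviation level_energy :: "real \<Rightarrow> real \<Rightarrow> real \<Rightarrow> ('a::euclidean_space \<Rightarrow> real) \<Rightarrow> ennreal" where
  "level_energy p \<gamma> l w \<equiv> ennreal (l powr p) * (\<integral>\<^sup>+x. \<integral>\<^sup>+h. ennreal (norm h powr (- real DIM('a) + \<gamma>)) *
     indicator {h. l < \<bar>w (x + h) - w x\<bar> / norm h powr (1 + \<gamma> / p)} h \<partial>lborel \<partial>lborel)"

text \<open>Where \<open>f\<close> is differentiable, the inner integrand has radial density of order \<open>1 / \<bar>h\<bar>\<close>, so the
  integral over \<open>\<bar>h\<bar> \<ge> exp (-k)\<close> grows linearly in \<open>k\<close>.\<close>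

lemma gradient_integral_bound_truncated:
  fixes f :: "'a::euclidean_space \<Rightarrow> real" and v :: "'a \<Rightarrow> 'a"
  assumes p: "1 \<le> p" and f[measurable]: "f \<in> borel_measurable borel" and v[measurable]: "v \<in> borel_measurable borel"
    and D: "\<And>x. (f has_derivative (\<lambda>h. v x \<bullet> h)) (at x)"
    and \<kappa>: "0 < \<kappa>" and \<delta>: "0 < \<delta>"
    and bd: "\<And>k::nat. k > k0 \<Longrightarrow> quot_energy p \<kappa> (annulus (exp (- real k)) \<delta>) f \<le> ennreal (A * real k + C)"
  shows "slope_energy p \<kappa> v \<le> ennreal A"
proof -
  have [measurable]: "ball 0 r \<in> sets (borel :: 'a measure)" for r by simp
  define J where "J k x = (\<integral>\<^sup>+h. ennreal (trunc_pow p \<kappa> ((f (x + h) - f x) / norm h)) *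
        ennreal (norm h powr - real DIM('a)) * indicator (annulus (exp (- real k)) \<delta>) h \<partial>lborel)" for k x
  have [measurable]: "J k \<in> borel_measurable borel" for k unfolding J_def by measurable
  define F where "F x h = ennreal (trunc_pow p \<kappa> (max 0 (\<bar>v x \<bullet> (h /\<^sub>R norm h)\<bar> - \<kappa>)))" for x h
  have Fm[measurable]: "F x \<in> borel_measurable borel" for x unfolding F_def by measurable
  have Fh: "F x (c *\<^sub>R h) = F x h" if "c > 0" for c x h
  proof -
    have "(c *\<^sub>R h) /\<^sub>R norm (c *\<^sub>R h) = h /\<^sub>R norm h" using that by simp
    then show ?thesis unfolding F_def by (simp only:)
  qed
  define c where "c x = (\<integral>\<^sup>+h. F x h * indicator (ball 0 1) h \<partial>lborel)" for x
  have key: "of_nat DIM('a) * c x \<le> liminf (\<lambda>k. ennreal (1 / real k) * J k x)" for x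
  proof -
    \<comment> \<open>The angular integral must be a finite real before
      \<open>nn_integral_homogeneous_log\<close> applies; it is at most |v|^p times the ball
      volume.\<close>
    have "c x \<le> (\<integral>\<^sup>+h. ennreal (norm (v x) powr p) * indicator (ball (0::'a) 1) h \<partial>lborel)"
      unfolding c_def
    proof (intro nn_integral_mono mult_right_mono)
      fix h :: 'a
      have "\<bar>v x \<bullet> (h /\<^sub>R norm h)\<bar> \<le> norm (v x) * norm (h /\<^sub>R norm h)" by (rule Cauchy_Schwarz_ineq2)
      also have "\<dots> \<le> norm (v x) * 1" by (intro mult_left_mono) (cases "h = 0", auto)
      finally have "max 0 (\<bar>v x \<bullet> (h /\<^sub>R norm h)\<bar> - \<kappa>) \<le> norm (v x)" using \<kappa> by simp
      then have "\<bar>max 0 (\<bar>v x \<bullet> (h /\<^sub>R norm h)\<bar> - \<kappa>)\<bar> powr p \<le> norm (v x) powr p"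
        using p by (intro powr_mono2) auto
      then show "F x h \<le> ennreal (norm (v x) powr p)"
        unfolding F_def trunc_pow_def using \<kappa> by (intro ennreal_leI) auto
    qed auto
    also have "\<dots> = ennreal (norm (v x) powr p) * emeasure lborel (ball (0::'a) 1)"
      by (rule nn_integral_cmult_indicator) simp
    also have "\<dots> < \<infinity>" using emeasure_lborel_ball_finite[of "0::'a" 1] by (simp add: ennreal_mult_less_top)
    finally obtain d where d: "c x = ennreal d" "0 \<le> d"
      by (cases "c x") auto
    \<comment> \<open>Within this radius the first order error is below \<kappa> |h|, exactly what
      the inner maximum in \<open>F\<close> subtracts.\<close>
    obtain \<epsilon> where \<epsilon>: "\<epsilon> > 0" "\<And>h. h \<noteq> 0 \<Longrightarrow> norm h < \<epsilon> \<Longrightarrow> norm (f (x + h) - f x - v x \<bullet> h) / norm h < \<kappa>"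
    proof -
      have "((\<lambda>h. norm (f (x + h) - f x - v x \<bullet> h) / norm h) \<longlongrightarrow> 0) (at 0)"
        using D[of x] unfolding has_derivative_at by simp
      from order_tendstoD(2)[OF this \<kappa>] show ?thesis
        using that unfolding eventually_at by (auto simp: dist_norm)
    qed
    \<comment> \<open>Small enough for differentiability at \<open>x\<close> and for the given outer
      radius. It depends on \<open>x\<close>.\<close>
    define \<delta>' where "\<delta>' = min \<epsilon> \<delta>"
    have \<delta>': "\<delta>' > 0" using \<epsilon> \<delta> by (simp add: \<delta>'_def)
    have low: "ennreal (d * (real DIM('a) * ln (\<delta>' / exp (- real k)))) \<le> J k x" if k: "exp (- real k) \<le> \<delta>'" for k
    proof -
      have "ennreal (d * (real DIM('a) * ln (\<delta>' / exp (- real k)))) \<le>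
        (\<integral>\<^sup>+h. F x h * ennreal (norm h powr - real DIM('a)) * indicator (annulus (exp (- real k)) \<delta>') h \<partial>lborel)"
        by (rule nn_integral_homogeneous_log[OF Fm Fh]) (use k d in \<open>auto simp: c_def\<close>)
      also have "\<dots> \<le> J k x"
        unfolding J_def
      proof (rule nn_integral_mono)
        fix h :: 'a
        show "F x h * ennreal (norm h powr - real DIM('a)) * indicator (annulus (exp (- real k)) \<delta>') h \<le>
          ennreal (trunc_pow p \<kappa> ((f (x + h) - f x) / norm h)) *
          ennreal (norm h powr - real DIM('a)) * indicator (annulus (exp (- real k)) \<delta>) h"
        proof (cases "h \<in> annulus (exp (- real k)) \<delta>'")
          case True
          then have h: "h \<in> annulus (exp (- real k)) \<delta>" "norm h < \<epsilon>" "h \<noteq> 0"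
            using order.strict_trans2[OF exp_gt_zero[of "- real k"], of "norm h"]
            by (auto simp: annulus_def \<delta>'_def)
          have nh: "norm h > 0" using h by simp
          have "\<bar>v x \<bullet> h\<bar> \<le> \<bar>f (x + h) - f x\<bar> + norm (f (x + h) - f x - v x \<bullet> h)" by simp
          then have "\<bar>v x \<bullet> h\<bar> / norm h \<le> \<bar>f (x + h) - f x\<bar> / norm h + norm (f (x + h) - f x - v x \<bullet> h) / norm h"
            using nh by (simp add: add_divide_distrib[symmetric] divide_right_mono)
          also have "\<dots> \<le> \<bar>f (x + h) - f x\<bar> / norm h + \<kappa>" using \<epsilon>(2)[OF h(3,2)] by simp
          finally have "max 0 (\<bar>v x \<bullet> (h /\<^sub>R norm h)\<bar> - \<kappa>) \<le> \<bar>f (x + h) - f x\<bar> / norm h"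
            using nh by (simp add: abs_mult divide_inverse mult.commute)
          then have "F x h \<le> ennreal (trunc_pow p \<kappa> ((f (x + h) - f x) / norm h))"
            unfolding F_def using p by (intro ennreal_leI trunc_pow_mono) auto
          then show ?thesis using True h by (simp add: mult_right_mono)
        qed simp
      qed
      finally show ?thesis .
    qed
    \<comment> \<open>The lower bound divided by \<open>k\<close>: the logarithm is ln \<delta>' +
      k, so \<delta>' disappears in the limit.\<close>
    let ?s = "\<lambda>k. d * (real DIM('a) * (ln \<delta>' * (1 / real k) + 1))"
    have ev: "\<forall>\<^sub>F k in sequentially. ennreal (?s k) \<le> ennreal (1 / real k) * J k x"
    proof -
      have "(\<lambda>k. exp (- real k)) \<longlonglongrightarrow> 0" by real_asymp
      then have "\<forall>\<^sub>F k in sequentially. exp (- real k) < \<delta>'" by (rule order_tendstoD) (rule \<delta>')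
      then show ?thesis using eventually_gt_at_top[of 0]
      proof eventually_elim
        case (elim k)
        have "ln (\<delta>' / exp (- real k)) = ln \<delta>' + real k" using \<delta>' by (simp add: ln_div)
        then have eq: "?s k = 1 / real k * (d * (real DIM('a) * ln (\<delta>' / exp (- real k))))"
          using elim by (simp add: field_simps)
        have "ennreal (?s k) = ennreal (1 / real k) * ennreal (d * (real DIM('a) * ln (\<delta>' / exp (- real k))))"
          unfolding eq by (rule ennreal_mult') simp
        also have "\<dots> \<le> ennreal (1 / real k) * J k x" using low elim by (intro mult_left_mono) auto
        finally show ?case .
      qed
    qed
    have "?s \<longlonglongrightarrow> d * (real DIM('a) * (ln \<delta>' * 0 + 1))"
      by (intro tendsto_intros lim_1_over_n)
    then have "(\<lambda>k. ennreal (?s k)) \<longlonglongrightarrow> ennreal (d * (real DIM('a) * (ln \<delta>' * 0 + 1)))" by (rule tendsto_ennrealI)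
    then have "liminf (\<lambda>k. ennreal (?s k)) = ennreal (d * (real DIM('a) * (ln \<delta>' * 0 + 1)))"
      by (rule lim_imp_Liminf[OF trivial_limit_sequentially])
    also have "\<dots> = of_nat DIM('a) * c x"
      using d by (simp add: ennreal_mult ennreal_of_nat_eq_real_of_nat mult.commute)
    finally show ?thesis using Liminf_mono[OF ev] by simp
  qed
  \<comment> \<open>The pointwise lower bound is not uniform in \<open>x\<close>; Fatou's lemma
    makes it usable. On the other side the constant \<open>C\<close> is divided by \<open>k\<close>
    and vanishes.\<close>
  have "(\<integral>\<^sup>+x. of_nat DIM('a) * c x \<partial>lborel) \<le> (\<integral>\<^sup>+x. liminf (\<lambda>k. ennreal (1 / real k) * J k x) \<partial>lborel)"
    by (intro nn_integral_mono key)
  also have "\<dots> \<le> liminf (\<lambda>k. \<integral>\<^sup>+x. ennreal (1 / real k) * J k x \<partial>lborel)"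
    by (intro nn_integral_liminf) measurable
  also have "\<dots> \<le> liminf (\<lambda>k. ennreal (A + C * (1 / real k)))"
  proof (rule Liminf_mono)
    show "\<forall>\<^sub>F k in sequentially. (\<integral>\<^sup>+x. ennreal (1 / real k) * J k x \<partial>lborel) \<le> ennreal (A + C * (1 / real k))"
      using eventually_gt_at_top[of k0]
    proof eventually_elim
      case (elim k)
      have "(\<integral>\<^sup>+x. ennreal (1 / real k) * J k x \<partial>lborel) = ennreal (1 / real k) * (\<integral>\<^sup>+x. J k x \<partial>lborel)"
        by (intro nn_integral_cmult) measurable
      also have "\<dots> \<le> ennreal (1 / real k) * ennreal (A * real k + C)"
        using bd[OF elim] unfolding J_def by (intro mult_left_mono) auto
      also have "\<dots> = ennreal (A + C * (1 / real k))"
        using elim by (subst ennreal_mult'[symmetric]) (auto simp: field_simps)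
      finally show ?case .
    qed
  qed
  also have "\<dots> = ennreal A"
  proof (rule lim_imp_Liminf[OF trivial_limit_sequentially])
    have "(\<lambda>k. A + C * (1 / real k)) \<longlonglongrightarrow> A + C * 0" by (intro tendsto_intros lim_1_over_n)
    then show "(\<lambda>k. ennreal (A + C * (1 / real k))) \<longlonglongrightarrow> ennreal A" using tendsto_ennrealI by force
  qed
  finally show ?thesis unfolding c_def F_def .
qed

text \<open>Lets \<kappa> tend to 0 along 1/(n+1), with Fatou in \<open>h\<close> and then in
  \<open>x\<close>; \<open>K_const_homogeneous\<close> identifies the angular limit as K
  |v|^p.\<close>

lemma gradient_integral_bound:
  fixes v :: "'a::euclidean_space \<Rightarrow> 'a" and e :: 'a
  assumes p: "1 \<le> p" and v[measurable]: "v \<in> borel_measurable borel" and e: "norm e = 1"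
    and bd: "\<And>\<kappa>. 0 < \<kappa> \<Longrightarrow> slope_energy p \<kappa> v \<le> A"
  shows "ennreal (K_const e p) * Lp_energy p lborel v \<le> A"
proof -
  have [measurable]: "ball 0 r \<in> sets (borel :: 'a measure)" for r by simp
  let ?\<kappa> = "\<lambda>n. 1 / real (Suc n)"
  let ?G = "\<lambda>n x h. ennreal (trunc_pow p (?\<kappa> n) (max 0 (\<bar>v x \<bullet> (h /\<^sub>R norm h)\<bar> - ?\<kappa> n))) * indicator (ball 0 1) h"
  have \<kappa>0: "?\<kappa> \<longlonglongrightarrow> 0" by (rule LIMSEQ_Suc[OF lim_1_over_n])
  have lim: "liminf (\<lambda>n. of_nat DIM('a) * ?G n x h) =
      of_nat DIM('a) * (ennreal (\<bar>v x \<bullet> (h /\<^sub>R norm h)\<bar> powr p) * indicator (ball 0 1) h)" for x h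
  proof (rule lim_imp_Liminf[OF trivial_limit_sequentially])
    have "(\<lambda>n. trunc_pow p (?\<kappa> n) (max 0 (\<bar>v x \<bullet> (h /\<^sub>R norm h)\<bar> - ?\<kappa> n))) \<longlonglongrightarrow>
       max 0 (\<bar>max 0 (\<bar>v x \<bullet> (h /\<^sub>R norm h)\<bar> - 0)\<bar> powr p - 0)"
      unfolding trunc_pow_def using p by (intro tendsto_intros tendsto_powr' \<kappa>0) auto
    then have "(\<lambda>n. ennreal (trunc_pow p (?\<kappa> n) (max 0 (\<bar>v x \<bullet> (h /\<^sub>R norm h)\<bar> - ?\<kappa> n)))) \<longlonglongrightarrow> ennreal (\<bar>v x \<bullet> (h /\<^sub>R norm h)\<bar> powr p)"
      using tendsto_ennrealI by force
    then have "(\<lambda>n. ?G n x h) \<longlonglongrightarrow> ennreal (\<bar>v x \<bullet> (h /\<^sub>R norm h)\<bar> powr p) * indicator (ball 0 1) h"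
      by (cases "h \<in> ball 0 1") (auto simp: indicator_def)
    then show "(\<lambda>n. of_nat DIM('a) * ?G n x h) \<longlonglongrightarrow>
      of_nat DIM('a) * (ennreal (\<bar>v x \<bullet> (h /\<^sub>R norm h)\<bar> powr p) * indicator (ball 0 1) h)"
      by (intro ennreal_tendsto_cmult) (auto simp: of_nat_less_top)
  qed
  have "ennreal (K_const e p) * Lp_energy p lborel v =
     (\<integral>\<^sup>+x. ennreal (K_const e p) * ennreal (norm (v x) powr p) \<partial>lborel)"
    by (intro nn_integral_cmult[symmetric]) measurable
  also have "\<dots> = (\<integral>\<^sup>+x. \<integral>\<^sup>+h. liminf (\<lambda>n. of_nat DIM('a) * ?G n x h) \<partial>lborel \<partial>lborel)"
  proof (rule nn_integral_cong)
    fix x :: 'a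
    have "ennreal (K_const e p) * ennreal (norm (v x) powr p) =
      of_nat DIM('a) * (\<integral>\<^sup>+h. ennreal (\<bar>v x \<bullet> (h /\<^sub>R norm h)\<bar> powr p) * indicator (ball 0 1) h \<partial>lborel)"
      by (subst K_const_homogeneous[OF e p, symmetric]) (simp only: nn_integral_ball_cball)
    also have "\<dots> = (\<integral>\<^sup>+h. liminf (\<lambda>n. of_nat DIM('a) * ?G n x h) \<partial>lborel)"
      unfolding lim by (intro nn_integral_cmult[symmetric]) measurable
    finally show "ennreal (K_const e p) * ennreal (norm (v x) powr p) =
      (\<integral>\<^sup>+h. liminf (\<lambda>n. of_nat DIM('a) * ?G n x h) \<partial>lborel)" .
  qed
  also have "\<dots> \<le> (\<integral>\<^sup>+x. liminf (\<lambda>n. \<integral>\<^sup>+h. of_nat DIM('a) * ?G n x h \<partial>lborel) \<partial>lborel)"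
    by (intro nn_integral_mono nn_integral_liminf) measurable
  also have "\<dots> = (\<integral>\<^sup>+x. liminf (\<lambda>n. of_nat DIM('a) * (\<integral>\<^sup>+h. ?G n x h \<partial>lborel)) \<partial>lborel)"
  proof -
    have "(\<integral>\<^sup>+h. of_nat DIM('a) * ?G n x h \<partial>lborel) = of_nat DIM('a) * (\<integral>\<^sup>+h. ?G n x h \<partial>lborel)" for n x
      by (intro nn_integral_cmult) measurable
    then show ?thesis by simp
  qed
  also have "\<dots> \<le> liminf (\<lambda>n. \<integral>\<^sup>+x. of_nat DIM('a) * (\<integral>\<^sup>+h. ?G n x h \<partial>lborel) \<partial>lborel)"
    by (intro nn_integral_liminf) measurable
  also have "\<dots> \<le> A"
    by (intro Liminf_le always_eventually allI bd) auto
  finally show ?thesis .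
qed

section \<open>Convexity of the integrand\<close>

lemma convex_on_abs_powr:
  assumes p: "1 \<le> p"
  shows "convex_on UNIV (\<lambda>t::real. \<bar>t\<bar> powr p)"
proof (rule convex_onI)
  fix s x y :: real assume s: "0 < s" "s < 1"
  have nn: "((1 - s) * a + s * b) powr p \<le> (1 - s) * a powr p + s * b powr p" if ab: "0 \<le> a" "0 \<le> b" for a b
  proof -
    \<comment> \<open>Covers an endpoint equal to 0, where convexity reduces to s^p <= s.\<close>
    have pw: "r powr p \<le> r" if "0 < r" "r < 1" for r :: real
      using that p powr_mono'[of 1 p r] by simp
    consider "a = 0" | "b = 0" | "0 < a" "0 < b" using ab by fastforce
    then show ?thesis
    proof cases
      case 1
      then show ?thesis using p s pw[of s] ab by (simp add: powr_mult mult_right_mono)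
    next
      case 2
      then show ?thesis using p s pw[of "1 - s"] ab by (simp add: powr_mult mult_right_mono)
    next
      case 3
      then show ?thesis using convex_onD[OF powr_convex[OF p], of s a b] s by simp
    qed
  qed
  have "\<bar>(1 - s) *\<^sub>R x + s *\<^sub>R y\<bar> powr p \<le> ((1 - s) * \<bar>x\<bar> + s * \<bar>y\<bar>) powr p"
    using s p by (intro powr_mono2 order_trans[OF abs_triangle_ineq]) (auto simp: abs_mult)
  also have "\<dots> \<le> (1 - s) * \<bar>x\<bar> powr p + s * \<bar>y\<bar> powr p" by (rule nn) auto
  finally show "\<bar>(1 - s) *\<^sub>R x + s *\<^sub>R y\<bar> powr p \<le> (1 - s) * \<bar>x\<bar> powr p + s * \<bar>y\<bar> powr p" .
qed simp

lemma convex_on_trunc_pow: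
  assumes p: "1 \<le> p"
  shows "convex_on UNIV (\<lambda>t. trunc_pow p \<kappa> (t / c))"
proof (rule convex_onI)
  fix s x y :: real assume s: "0 < s" "s < 1"
  have "((1 - s) *\<^sub>R x + s *\<^sub>R y) / c = (1 - s) *\<^sub>R (x / c) + s *\<^sub>R (y / c)"
    by (simp add: add_divide_distrib)
  then have "\<bar>((1 - s) *\<^sub>R x + s *\<^sub>R y) / c\<bar> powr p \<le> (1 - s) * \<bar>x / c\<bar> powr p + s * \<bar>y / c\<bar> powr p"
    using convex_onD[OF convex_on_abs_powr[OF p], of s "x / c" "y / c"] s by simp
  then have "\<bar>((1 - s) *\<^sub>R x + s *\<^sub>R y) / c\<bar> powr p - \<kappa> \<le> (1 - s) * (\<bar>x / c\<bar> powr p - \<kappa>) + s * (\<bar>y / c\<bar> powr p - \<kappa>)"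
    by (simp add: algebra_simps)
  also have "\<dots> \<le> (1 - s) * trunc_pow p \<kappa> (x / c) + s * trunc_pow p \<kappa> (y / c)"
    using s by (intro add_mono mult_left_mono) (auto simp: trunc_pow_def)
  finally show "trunc_pow p \<kappa> (((1 - s) *\<^sub>R x + s *\<^sub>R y) / c) \<le> (1 - s) * trunc_pow p \<kappa> (x / c) + s * trunc_pow p \<kappa> (y / c)"
    unfolding trunc_pow_def[of _ _ "((1 - s) *\<^sub>R x + s *\<^sub>R y) / c"]
    using s by (auto intro!: add_nonneg_nonneg mult_nonneg_nonneg trunc_pow_nonneg)
qed simp

text \<open>Fubini and the shift to h = y - x are carried out for the Borel function
  \<open>w\<close>; the comparison with \<open>u\<close> is made on the product space, where outside
  a null set the level set of \<open>w\<close> is contained in that of \<open>u\<close>.\<close>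

lemma Phi_lam_ge_iterated:
  fixes u w :: "'a::euclidean_space \<Rightarrow> real"
  assumes w[measurable]: "w \<in> borel_measurable borel"
    and N: "N \<in> null_sets lborel" and uw: "\<And>x y. x \<notin> N \<Longrightarrow> y \<notin> N \<Longrightarrow> \<bar>w x - w y\<bar> \<le> \<bar>u x - u y\<bar>"
  shows "level_energy p \<gamma> l w \<le> Phi_lam p \<gamma> l u"
proof -
  let ?q = "\<lambda>w x y. \<bar>w x - w y\<bar> / norm (x - y) powr (1 + \<gamma> / p)"
  let ?k = "\<lambda>x y. ennreal (norm (x - y) powr (- real DIM('a) + \<gamma>))"
  have NN: "N \<times> UNIV \<in> null_sets (lborel \<Otimes>\<^sub>M lborel)" "UNIV \<times> N \<in> null_sets (lborel \<Otimes>\<^sub>M lborel)"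
    using N by (auto simp: null_sets_def lborel.emeasure_pair_measure_Times)
  have AE: "AE z in lborel \<Otimes>\<^sub>M lborel. fst z \<notin> N \<and> snd z \<notin> N"
    using AE_not_in[OF NN(1)] AE_not_in[OF NN(2)] by eventually_elim (auto simp: mem_Times_iff)
  have gm: "(\<lambda>(x, y). ?k x y * indicator {y. l < ?q w x y} y) \<in> borel_measurable (lborel \<Otimes>\<^sub>M lborel)"
    by measurable
  have "(\<integral>\<^sup>+x. \<integral>\<^sup>+h. ennreal (norm h powr (- real DIM('a) + \<gamma>)) *
     indicator {h. l < \<bar>w (x + h) - w x\<bar> / norm h powr (1 + \<gamma> / p)} h \<partial>lborel \<partial>lborel) =
     (\<integral>\<^sup>+x. \<integral>\<^sup>+y. ?k x y * indicator {y. l < ?q w x y} y \<partial>lborel \<partial>lborel)"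
  proof (rule nn_integral_cong)
    fix x
    have "(\<integral>\<^sup>+y. ?k x y * indicator {y. l < ?q w x y} y \<partial>lborel) =
        (\<integral>\<^sup>+h. ?k x (x + h) * indicator {y. l < ?q w x y} (x + h) \<partial>lborel)"
      by (rule nn_integral_lborel_translation[symmetric]) measurable
    then show "(\<integral>\<^sup>+h. ennreal (norm h powr (- real DIM('a) + \<gamma>)) *
     indicator {h. l < \<bar>w (x + h) - w x\<bar> / norm h powr (1 + \<gamma> / p)} h \<partial>lborel) =
     (\<integral>\<^sup>+y. ?k x y * indicator {y. l < ?q w x y} y \<partial>lborel)"
      by (simp add: indicator_def abs_minus_commute)
  qed
  also have "\<dots> = (\<integral>\<^sup>+(x, y). ?k x y * indicator {y. l < ?q w x y} y \<partial>(lborel \<Otimes>\<^sub>M lborel))"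
    using lborel.nn_integral_fst[OF gm] by simp
  also have "\<dots> \<le> (\<integral>\<^sup>+z\<in>{(x, y). ?q u x y > l}. (case z of (x, y) \<Rightarrow> ?k x y) \<partial>(lborel \<Otimes>\<^sub>M lborel))"
  proof (rule nn_integral_mono_AE, use AE in eventually_elim)
    case (elim z)
    obtain x y where z: "z = (x, y)" by force
    have "?q w x y \<le> ?q u x y" using uw elim by (intro divide_right_mono) (auto simp: z)
    then show ?case by (auto simp: z indicator_def)
  qed
  also have "\<dots> = (\<integral>\<^sup>+z\<in>{(x, y). ?q u x y > l}. (case z of (x, y) \<Rightarrow> ?k x y) \<partial>lebesgue)"
    by (simp add: lborel_prod nn_integral_completion)
  finally show ?thesis unfolding Phi_lam_def by (rule mult_left_mono) simp
qed

text \<open>The level \<open>\<tau>\<close> at which the integration over \<open>\<lambda>\<close> starts is tied to the inner radius \<open>exp (-k)\<close> by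
  \<open>\<tau>\<^sup>p exp (-k)\<^sup>\<gamma> = \<kappa>\<close>; the outer radius is so small that \<open>Q\<close> stays below \<open>l0\<close> there.\<close>

lemma layer_cake_bound:
  fixes w :: "'a::euclidean_space \<Rightarrow> real"
  assumes p: "1 \<le> p" and \<gamma>: "\<gamma> < - p" and w[measurable]: "w \<in> borel_measurable borel"
    and wM: "\<And>x. \<bar>w x\<bar> \<le> M" and A: "0 \<le> A" and l0: "0 < l0"
    and bd: "\<And>l. 0 < l \<Longrightarrow> l < l0 \<Longrightarrow> level_energy p \<gamma> l w \<le> ennreal A"
    and \<kappa>: "0 < \<kappa>"
  shows "\<exists>\<delta>>0. \<exists>k0 C. \<forall>k::nat. k > k0 \<longrightarrow>
    quot_energy p \<kappa> (annulus (exp (- real k)) \<delta>) w \<le> ennreal ((A * \<bar>\<gamma>\<bar>) * real k + C)"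
proof -
  \<comment> \<open>Positive because \<gamma> < - p, so that \<open>Q\<close>, a difference times
    |h|^\<beta>, is small for small \<open>h\<close> when \<open>w\<close> is bounded.\<close>
  define \<beta> where "\<beta> = - (1 + \<gamma> / p)"
  define G where "G = \<bar>\<gamma>\<bar>"
  have G: "G > 0" "\<gamma> = - G" using \<gamma> p by (auto simp: G_def)
  have \<beta>: "\<beta> > 0" using \<gamma> p by (simp add: \<beta>_def field_simps)
  have M: "M \<ge> 0" using wM[of 0] by linarith
  \<comment> \<open>Solves \<delta>^\<beta> = l0 / (2M + 1), which keeps \<open>Q\<close> below 2 M
    \<delta>^\<beta> < l0; the summand 1 allows M = 0.\<close>
  define \<delta> where "\<delta> = (l0 / (2 * M + 1)) powr (1 / \<beta>)"
  have \<delta>: "\<delta> > 0" using l0 M by (simp add: \<delta>_def)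
  have \<delta>\<beta>: "2 * M * \<delta> powr \<beta> < l0"
  proof -
    have "\<delta> powr \<beta> = l0 / (2 * M + 1)" using \<beta> l0 M by (simp add: \<delta>_def powr_powr)
    moreover have "2 * M * (l0 / (2 * M + 1)) < l0" using l0 M by (simp add: divide_less_eq field_simps)
    ultimately show ?thesis by simp
  qed
  define Q where "Q x h = \<bar>w (x + h) - w x\<bar> / norm h powr (1 + \<gamma> / p)" for x h
  have [measurable]: "(\<lambda>(x, h). Q x h) \<in> borel_measurable (borel \<Otimes>\<^sub>M borel)" unfolding Q_def by measurable
  have [measurable]: "Q x \<in> borel_measurable borel" for x unfolding Q_def by measurable
  let ?W = "\<lambda>l x h. ennreal (norm h powr (- real DIM('a) + \<gamma>)) * indicator {h. l < Q x h} h"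
  define \<tau> where "\<tau> k = (\<kappa> * exp (- real k) powr G) powr (1 / p)" for k
  have \<tau>: "\<tau> k > 0" for k using \<kappa> by (simp add: \<tau>_def)
  have \<tau>p: "\<tau> k powr p = \<kappa> * exp (- real k) powr G" for k
    using \<kappa> p by (simp add: \<tau>_def powr_powr)
  let ?J = "\<lambda>k. quot_energy p \<kappa> (annulus (exp (- real k)) \<delta>) w"
  let ?L = "\<lambda>k l. ennreal (p * l powr (p - 1)) * indicator {\<tau> k..<l0} l"
  have main: "?J k \<le> ennreal (A * p * (ln l0 - ln (\<tau> k)))" if k: "\<tau> k \<le> l0" for k
  proof -
    \<comment> \<open>The layer cake formula: p l^(p-1) integrated from \<tau> to Q gives Q^p -
      \<tau>^p, and multiplication by |h|^\<gamma> turns this into at least the truncated difference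
      quotient.\<close>
    have pt: "ennreal (trunc_pow p \<kappa> ((w (x + h) - w x) / norm h)) *
        ennreal (norm h powr - real DIM('a)) * indicator (annulus (exp (- real k)) \<delta>) h \<le>
        (\<integral>\<^sup>+l. ?L k l * ?W l x h \<partial>lborel)" for x h
    proof (cases "h \<in> annulus (exp (- real k)) \<delta> \<and> \<bar>(w (x + h) - w x) / norm h\<bar> powr p > \<kappa>")
      case False
      then have "indicator (annulus (exp (- real k)) \<delta>) h = (0::ennreal) \<or> trunc_pow p \<kappa> ((w (x + h) - w x) / norm h) = 0"
        unfolding trunc_pow_def indicator_def by (auto simp del: abs_divide)
      then show ?thesis by (elim disjE) simp_all
    next
      case True
      then have h: "exp (- real k) \<le> norm h" "norm h < \<delta>" and big: "\<bar>(w (x + h) - w x) / norm h\<bar> powr p > \<kappa>"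
        by (auto simp: annulus_def)
      have nh: "norm h > 0" using h(1) less_le_trans[OF exp_gt_zero] by blast
      have Qe: "Q x h = \<bar>w (x + h) - w x\<bar> * norm h powr \<beta>"
        by (simp add: Q_def \<beta>_def powr_minus divide_inverse powr_add powr_diff)
      have Q0: "Q x h \<ge> 0" by (simp add: Qe)
      have eq: "\<bar>(w (x + h) - w x) / norm h\<bar> powr p = Q x h powr p * norm h powr \<gamma>"
      proof -
        have "\<beta> * p + \<gamma> = - p" using p by (simp add: \<beta>_def field_simps)
        then have "norm h powr (\<beta> * p) * norm h powr \<gamma> = norm h powr - p"
          by (simp only: powr_add[symmetric])
        then have "Q x h powr p * norm h powr \<gamma> = \<bar>w (x + h) - w x\<bar> powr p * norm h powr - p"
          using nh by (simp add: Qe powr_mult powr_powr)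
        then show ?thesis using nh by (simp add: abs_divide powr_divide powr_minus_divide)
      qed
      \<comment> \<open>Here |h| >= exp(-k) and the choice of \<tau> meet. Wherever the truncated
        power is positive, it follows that Q > \<tau>.\<close>
      have e1: "\<tau> k powr p * norm h powr \<gamma> \<le> \<kappa>"
      proof -
        have "exp (- real k) powr G * norm h powr \<gamma> \<le> norm h powr G * norm h powr \<gamma>"
          using h G by (intro mult_right_mono powr_mono2) auto
        also have "\<dots> = 1" using nh G by (simp add: powr_add[symmetric])
        finally show ?thesis using \<kappa> by (simp add: \<tau>p mult.assoc mult_left_le)
      qed
      have "Q x h powr p > \<tau> k powr p"
      proof -
        have "\<tau> k powr p * norm h powr \<gamma> < Q x h powr p * norm h powr \<gamma>" using e1 big eq by linarith
        then show ?thesis using nh by (simp add: mult_less_cancel_right)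
      qed
      then have Q\<tau>: "\<tau> k \<le> Q x h" using Q0 p powr_mono2[of p "Q x h" "\<tau> k"] by force
      have Ql0: "Q x h < l0"
      proof -
        have "\<bar>w (x + h) - w x\<bar> \<le> 2 * M" using wM[of "x + h"] wM[of x] by linarith
        then have "Q x h \<le> 2 * M * \<delta> powr \<beta>"
          unfolding Qe using h \<beta> M by (intro mult_mono powr_mono2) auto
        then show ?thesis using \<delta>\<beta> by simp
      qed
      have "(\<integral>\<^sup>+l. ?L k l * ?W l x h \<partial>lborel) =
         (\<integral>\<^sup>+l. ennreal (norm h powr (- real DIM('a) + \<gamma>)) * (ennreal (p * l powr (p - 1)) * indicator {\<tau> k..Q x h} l) \<partial>lborel)"
      proof (rule nn_integral_cong_AE)
        \<comment> \<open>The level set is strict while the interval is closed; they differ in the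
          null set consisting of \<open>Q x h\<close>.\<close>
        show "AE l in lborel. ?L k l * ?W l x h =
          ennreal (norm h powr (- real DIM('a) + \<gamma>)) * (ennreal (p * l powr (p - 1)) * indicator {\<tau> k..Q x h} l)"
          using AE_lborel_singleton[of "Q x h"]
          by eventually_elim (use Ql0 in \<open>auto simp: indicator_def mult.commute\<close>)
      qed
      also have "\<dots> = ennreal (norm h powr (- real DIM('a) + \<gamma>)) * (\<integral>\<^sup>+l. ennreal (p * l powr (p - 1)) * indicator {\<tau> k..Q x h} l \<partial>lborel)"
        by (intro nn_integral_cmult) measurable
      also have "(\<integral>\<^sup>+l. ennreal (p * l powr (p - 1)) * indicator {\<tau> k..Q x h} l \<partial>lborel) = ennreal (Q x h powr p - \<tau> k powr p)"
      proof (rule nn_integral_FTC_Icc)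
        fix l assume "l \<in> {\<tau> k..Q x h}"
        then have l: "\<tau> k \<le> l" "l \<le> Q x h" by auto
        show "((\<lambda>l. l powr p) has_real_derivative p * l powr (p - 1)) (at l)"
          using l \<tau>[of k] by (intro has_real_derivative_powr) auto
        show "0 \<le> p * l powr (p - 1)" using p by simp
      qed (use Q\<tau> in auto)
      also have "ennreal (norm h powr (- real DIM('a) + \<gamma>)) * ennreal (Q x h powr p - \<tau> k powr p) =
        ennreal ((Q x h powr p * norm h powr \<gamma> - \<tau> k powr p * norm h powr \<gamma>) * norm h powr - real DIM('a))"
      proof -
        have "norm h powr (- real DIM('a) + \<gamma>) = norm h powr - real DIM('a) * norm h powr \<gamma>" by (rule powr_add)
        then show ?thesis by (subst ennreal_mult'[symmetric]) (simp_all add: algebra_simps)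
      qed
      also have "\<dots> \<ge> ennreal ((\<bar>(w (x + h) - w x) / norm h\<bar> powr p - \<kappa>) * norm h powr - real DIM('a))"
        unfolding eq using e1 by (intro ennreal_leI mult_right_mono) auto
      moreover have "ennreal (trunc_pow p \<kappa> ((w (x + h) - w x) / norm h)) *
        ennreal (norm h powr - real DIM('a)) * indicator (annulus (exp (- real k)) \<delta>) h =
        ennreal ((\<bar>(w (x + h) - w x) / norm h\<bar> powr p - \<kappa>) * norm h powr - real DIM('a))"
      proof -
        have "trunc_pow p \<kappa> ((w (x + h) - w x) / norm h) = \<bar>(w (x + h) - w x) / norm h\<bar> powr p - \<kappa>"
          using big unfolding trunc_pow_def by simp
        then show ?thesis using True big by (simp add: ennreal_mult')
      qed
      ultimately show ?thesis by simp
    qed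
    have "?J k \<le> (\<integral>\<^sup>+x. \<integral>\<^sup>+h. (\<integral>\<^sup>+l. ?L k l * ?W l x h \<partial>lborel) \<partial>lborel \<partial>lborel)"
      by (intro nn_integral_mono pt)
    also have "\<dots> = (\<integral>\<^sup>+x. \<integral>\<^sup>+l. (\<integral>\<^sup>+h. ?L k l * ?W l x h \<partial>lborel) \<partial>lborel \<partial>lborel)"
      by (intro nn_integral_cong pair_sigma_finite.Fubini' pair_sigma_finite.intro sigma_finite_lborel) measurable
    also have "\<dots> = (\<integral>\<^sup>+l. \<integral>\<^sup>+x. (\<integral>\<^sup>+h. ?L k l * ?W l x h \<partial>lborel) \<partial>lborel \<partial>lborel)"
      by (intro pair_sigma_finite.Fubini' pair_sigma_finite.intro sigma_finite_lborel) measurable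
    also have "\<dots> \<le> (\<integral>\<^sup>+l. ennreal (A * p * (1 / l)) * indicator {\<tau> k..l0} l \<partial>lborel)"
    proof (rule nn_integral_mono)
      fix l :: real
      let ?I = "\<integral>\<^sup>+x. \<integral>\<^sup>+h. ?W l x h \<partial>lborel \<partial>lborel"
      have "(\<integral>\<^sup>+x. (\<integral>\<^sup>+h. ?L k l * ?W l x h \<partial>lborel) \<partial>lborel)
        = (\<integral>\<^sup>+x. ?L k l * (\<integral>\<^sup>+h. ?W l x h \<partial>lborel) \<partial>lborel)"
        by (intro nn_integral_cong nn_integral_cmult) measurable
      also have "\<dots> = ?L k l * ?I"
        by (intro nn_integral_cmult) measurable
      also have "\<dots> \<le> ennreal (A * p * (1 / l)) * indicator {\<tau> k..l0} l"
      proof (cases "l \<in> {\<tau> k..<l0}")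
        case True
        then have l: "0 < l" "l < l0" using \<tau>[of k] by auto
        \<comment> \<open>The factor l^p completes \<open>level_energy\<close>, so the hypothesis
          leaves A p / l, whose integral is the logarithm.\<close>
        have "p * l powr (p - 1) = (p / l) * l powr p" using l by (simp add: powr_diff)
        then have "ennreal (p * l powr (p - 1)) = ennreal (p / l) * ennreal (l powr p)"
          using p l by (simp only:) (rule ennreal_mult, auto)
        then have "?L k l * ?I = ennreal (p / l) * (ennreal (l powr p) * ?I)"
          using True by (simp add: mult.assoc)
        also have "\<dots> \<le> ennreal (p / l) * ennreal A"
          using bd[OF l] unfolding Q_def by (rule mult_left_mono) simp
        also have "\<dots> = ennreal (A * p * (1 / l))"
          using p l A by (subst ennreal_mult[symmetric]) (auto simp: mult.commute)
        finally show ?thesis using True by simp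
      qed simp
      finally show "(\<integral>\<^sup>+x. (\<integral>\<^sup>+h. ?L k l * ?W l x h \<partial>lborel) \<partial>lborel)
        \<le> ennreal (A * p * (1 / l)) * indicator {\<tau> k..l0} l" .
    qed
    also have "\<dots> = ennreal (A * p * ln l0 - A * p * ln (\<tau> k))"
    proof (rule nn_integral_FTC_Icc)
      fix l assume "l \<in> {\<tau> k..l0}"
      then have l: "\<tau> k \<le> l" "l \<le> l0" by auto
      show "((\<lambda>l. A * p * ln l) has_real_derivative A * p * (1 / l)) (at l)"
        using l \<tau>[of k] by (auto intro!: derivative_eq_intros)
      show "0 \<le> A * p * (1 / l)" using l \<tau>[of k] p A by simp
    qed (use k in auto)
    finally show ?thesis by (simp add: right_diff_distrib)
  qed
  \<comment> \<open>The source of the slope: \<tau>^p = \<kappa> exp(-k)^G with G =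
    |\<gamma>|.\<close>
  have ln\<tau>: "p * ln (\<tau> k) = ln \<kappa> - G * real k" for k
    using \<kappa> p by (simp add: \<tau>_def ln_powr ln_mult)
  obtain k0 :: nat where k0: "real k0 > (ln \<kappa> - p * ln l0) / G" using reals_Archimedean2 by blast
  have small: "\<tau> k \<le> l0" if "k > k0" for k
  proof -
    have "real k > (ln \<kappa> - p * ln l0) / G" using k0 that by simp
    then have "p * ln (\<tau> k) < p * ln l0" using G by (simp add: ln\<tau> field_simps)
    then have "ln (\<tau> k) < ln l0" using p by simp
    then show ?thesis using \<tau>[of k] l0 by simp
  qed
  have "?J k \<le> ennreal ((A * \<bar>\<gamma>\<bar>) * real k + A * (p * ln l0 - ln \<kappa>))" if "k > k0" for k
  proof -
    have "A * p * (ln l0 - ln (\<tau> k)) = A * (p * ln l0 - p * ln (\<tau> k))" by (simp add: algebra_simps)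
    also have "\<dots> = (A * \<bar>\<gamma>\<bar>) * real k + A * (p * ln l0 - ln \<kappa>)" by (simp add: ln\<tau> G_def algebra_simps)
    finally show ?thesis using main[OF small[OF that]] by simp
  qed
  then show ?thesis using \<delta> by blast
qed

section \<open>Nested convex sets in \<open>L\<^sup>p\<close>\<close>

text \<open>The mean value theorem on both halves of the interval, with a strictly increasing
  derivative.\<close>

lemma powr_midpoint_strict:
  fixes s t p :: real
  assumes p: "1 < p" and st: "0 \<le> s" "s < t"
  shows "((s + t) / 2) powr p < (s powr p + t powr p) / 2"
proof -
  let ?f = "\<lambda>x::real. x powr p"
  have mvt: "\<exists>z>a. z < b \<and> ?f b - ?f a = (b - a) * (p * z powr (p - 1))" if "0 \<le> a" "a < b" for a b :: real
  proof -
    have "\<exists>l z. a < z \<and> z < b \<and> (?f has_real_derivative l) (at z) \<and> ?f b - ?f a = (b - a) * l"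
    proof (rule MVT[OF that(2)])
      show "continuous_on {a..b} ?f"
        using that p by (intro continuous_on_powr' continuous_intros) auto
      show "?f differentiable at x" if "a < x" "x < b" for x
        using that \<open>0 \<le> a\<close> by (intro differentiableI derivative_eq_intros) auto
    qed
    then obtain l z where z: "a < z" "z < b" "(?f has_real_derivative l) (at z)" "?f b - ?f a = (b - a) * l" by blast
    have "(?f has_real_derivative p * z powr (p - 1)) (at z)"
      using z that by (intro has_real_derivative_powr) auto
    then have "l = p * z powr (p - 1)" using z(3) DERIV_unique by blast
    then show ?thesis using z by blast
  qed
  define m where "m = (s + t) / 2"
  have m: "s < m" "m < t" "m - s = t - m" using st by (auto simp: m_def field_simps)
  obtain y where y: "s < y" "y < m" "?f m - ?f s = (m - s) * (p * y powr (p - 1))"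
    using mvt[OF st(1) m(1)] by blast
  obtain z where z: "m < z" "z < t" "?f t - ?f m = (t - m) * (p * z powr (p - 1))"
    using mvt[of m t] m st by force
  have "y powr (p - 1) < z powr (p - 1)" using y z st p by (intro powr_less_mono2) auto
  then have "(t - m) * (p * y powr (p - 1)) < (t - m) * (p * z powr (p - 1))"
    using m p by simp
  then have "?f m - ?f s < ?f t - ?f m" using y(3) z(3) m(3) by simp
  then show ?thesis by (simp add: m_def)
qed

text \<open>Strictness has two sources: for different norms the strict convexity of the power, for
  equal norms the parallelogram law.\<close>

lemma norm_powr_midpoint_strict:
  fixes a b :: "'b::euclidean_space"
  assumes p: "1 < p" and ab: "a \<noteq> b"
  shows "norm ((1/2) *\<^sub>R (a + b)) powr p < (norm a powr p + norm b powr p) / 2"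
proof (cases "norm a = norm b")
  case False
  have "norm ((1/2) *\<^sub>R (a + b)) powr p \<le> ((norm a + norm b) / 2) powr p"
    using norm_triangle_ineq[of a b] p by (intro powr_mono2) auto
  also have "\<dots> < (norm a powr p + norm b powr p) / 2"
  proof (cases "norm a < norm b")
    case True then show ?thesis using powr_midpoint_strict[OF p _ True] by simp
  next
    case F: False
    then have "norm b < norm a" using False by simp
    from powr_midpoint_strict[OF p _ this] show ?thesis by (simp add: add.commute)
  qed
  finally show ?thesis .
next
  case True
  have "(norm (a + b))\<^sup>2 + (norm (a - b))\<^sup>2 = 2 * (norm a)\<^sup>2 + 2 * (norm b)\<^sup>2"
    by (simp add: power2_norm_eq_inner inner_add_left inner_add_right inner_diff_left inner_diff_right)
  moreover have "(norm (a - b))\<^sup>2 > 0" using ab by simp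
  ultimately have "(norm (a + b))\<^sup>2 < 4 * (norm a)\<^sup>2" unfolding True by linarith
  then have "(norm (a + b))\<^sup>2 < (2 * norm a)\<^sup>2" by (simp add: power_mult_distrib)
  then have "norm (a + b) < 2 * norm a"
    using power_less_imp_less_base by (metis mult_nonneg_nonneg norm_ge_zero zero_le_numeral)
  then have "norm ((1/2) *\<^sub>R (a + b)) powr p < norm a powr p"
    using p by (intro powr_less_mono2) auto
  then show ?thesis using True by simp
qed

definition convex_gap :: "real \<Rightarrow> 'b::euclidean_space \<Rightarrow> 'b \<Rightarrow> real" where
  "convex_gap p a b = (norm a powr p + norm b powr p) / 2 - norm ((1/2) *\<^sub>R (a + b)) powr p"

lemma convex_gap_pos: "1 < p \<Longrightarrow> a \<noteq> b \<Longrightarrow> 0 < convex_gap p a b"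
  using norm_powr_midpoint_strict[of p a b] by (simp add: convex_gap_def)

lemma convex_gap_nonneg: "1 < p \<Longrightarrow> 0 \<le> convex_gap p a b"
proof (cases "a = b")
  case True
  have "(1/2) *\<^sub>R (b + b) = b" by (simp add: scaleR_2[symmetric])
  then show ?thesis using True by (simp add: convex_gap_def)
qed (use convex_gap_pos[of p a b] in auto)

text \<open>A quantitative uniform convexity of \<open>L\<^sup>p\<close>, valid for all \<open>p > 1\<close> at once: by
  homogeneity and strict convexity it is a compactness statement on the unit sphere.\<close>

lemma norm_powr_uniformly_convex:
  assumes p: "1 < p" and e: "0 < e"
  shows "\<exists>C>0. \<forall>a b :: 'b::euclidean_space.
    norm (a - b) powr p \<le> e * (norm a powr p + norm b powr p) + C * convex_gap p a b"
proof -
  let ?N = "\<lambda>z::'b\<times>'b. norm (fst z - snd z) powr p"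
  let ?S = "\<lambda>z::'b\<times>'b. e * (norm (fst z) powr p + norm (snd z) powr p)"
  let ?F = "\<lambda>z::'b\<times>'b. convex_gap p (fst z) (snd z)"
  have cont: "continuous_on UNIV ?N" "continuous_on UNIV ?S" "continuous_on UNIV ?F"
    unfolding convex_gap_def using p by (auto intro!: continuous_intros continuous_on_powr')
  \<comment> \<open>The unit pairs for which the term with \<open>e\<close> alone need not suffice.
    No pair in \<open>K\<close> has equal entries, so the gap has a positive minimum
    \<open>m\<close> on this compact set.\<close>
  define K where "K = sphere 0 1 \<inter> {z. ?S z \<le> ?N z}"
  have "closed {z. ?S z \<le> ?N z}" using cont by (intro closed_Collect_le) auto
  then have K: "compact K" unfolding K_def by (intro compact_Int_closed) auto
  have pos: "?F z > 0" if "z \<in> K" for z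
  proof (rule convex_gap_pos[OF p], rule notI)
    assume eq: "fst z = snd z"
    then have "2 * e * norm (snd z) powr p \<le> 0" using that p by (simp add: K_def)
    then have "snd z = 0" using e p by (simp add: mult_le_0_iff)
    then have "z = 0" using eq by (simp add: prod_eq_iff)
    then show False using that by (simp add: K_def)
  qed
  obtain m where m: "m > 0" "\<And>z. z \<in> K \<Longrightarrow> m \<le> ?F z"
  proof (cases "K = {}")
    case True
    then show ?thesis using that[of 1] by simp
  next
    case False
    obtain z where "z \<in> K" "\<And>y. y \<in> K \<Longrightarrow> ?F z \<le> ?F y"
      using continuous_attains_inf[OF K False continuous_on_subset[OF cont(3)]] by auto
    then show ?thesis using that[of "?F z"] pos by blast
  qed
  \<comment> \<open>On the unit sphere the left side is at most 2^p, so this multiple of the gap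
    covers it on \<open>K\<close>.\<close>
  define C where "C = 2 powr p / m"
  have C: "C > 0" using m by (simp add: C_def)
  have unit: "?N z \<le> ?S z + C * ?F z" if "norm z = 1" for z
  proof (cases "z \<in> K")
    case True
    have "norm (fst z - snd z) \<le> norm (fst z) + norm (snd z)" by (rule norm_triangle_ineq4)
    also have "\<dots> \<le> 2" using norm_fst_le[of "fst z" "snd z"] norm_snd_le[of "snd z" "fst z"] that by simp
    finally have "?N z \<le> 2 powr p" using p by (intro powr_mono2) auto
    also have "\<dots> = C * m" using m by (simp add: C_def)
    also have "\<dots> \<le> C * ?F z" using m(2)[OF True] C by simp
    also have "\<dots> \<le> ?S z + C * ?F z" using e by simp
    finally show ?thesis .
  next
    case False
    then have "?N z \<le> ?S z" using that by (simp add: K_def)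
    moreover have "0 \<le> C * ?F z" using C convex_gap_nonneg[OF p, of "fst z" "snd z"] by simp
    ultimately show ?thesis by linarith
  qed
  have all: "norm (a - b) powr p \<le> e * (norm a powr p + norm b powr p) + C * convex_gap p a b" for a b :: 'b
  proof (cases "(a, b) = 0")
    case False
    \<comment> \<open>Every term is homogeneous of degree \<open>p\<close>, so the estimate extends
      from the unit sphere.\<close>
    define s where "s = norm (a, b)"
    have s: "s > 0" using False by (simp add: s_def)
    define z where "z = (a, b) /\<^sub>R s"
    have "norm z = 1" using s unfolding z_def norm_scaleR by (simp add: s_def[symmetric])
    from unit[OF this] have "s powr p * ?N z \<le> s powr p * (?S z + C * ?F z)"
      by (intro mult_left_mono) auto
    moreover have h: "s powr p * norm (x /\<^sub>R s) powr p = norm x powr p" for x :: 'b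
      using s by (simp add: powr_mult[symmetric] mult.assoc[symmetric])
    have "s powr p * ?N z = norm (a - b) powr p"
      using h[of "a - b"] by (simp add: z_def scaleR_diff_right)
    moreover have "s powr p * (?S z + C * ?F z) = e * (norm a powr p + norm b powr p) + C * convex_gap p a b"
    proof -
      have "s powr p * norm ((1/2) *\<^sub>R (a /\<^sub>R s + b /\<^sub>R s)) powr p = norm ((1/2) *\<^sub>R (a + b)) powr p"
        using h[of "(1/2) *\<^sub>R (a + b)"] by (simp only: scaleR_add_right scaleR_left_commute)
      moreover have "s powr p * (?S z + C * ?F z) =
        e * (s powr p * norm (a /\<^sub>R s) powr p + s powr p * norm (b /\<^sub>R s) powr p) +
        C * ((s powr p * norm (a /\<^sub>R s) powr p + s powr p * norm (b /\<^sub>R s) powr p) / 2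
          - s powr p * norm ((1/2) *\<^sub>R (a /\<^sub>R s + b /\<^sub>R s)) powr p)"
        by (simp add: convex_gap_def z_def field_simps)
      ultimately show ?thesis unfolding h convex_gap_def by simp
    qed
    ultimately show ?thesis by simp
  qed (use p in \<open>simp add: convex_gap_def zero_prod_def\<close>)
  show ?thesis using C all by blast
qed

text \<open>The Riesz-Fischer argument: a rapidly converging subsequence has a limit almost
  everywhere, and Fatou's lemma turns this into convergence of the energies of the
  differences.\<close>

lemma Lp_cauchy_subseq:
  fixes h :: "nat \<Rightarrow> 'x \<Rightarrow> 'b::euclidean_space"
  assumes p: "1 < p" and hm[measurable]: "\<And>n. h n \<in> borel_measurable M"
    and cau: "\<And>e. e > 0 \<Longrightarrow> \<exists>N. \<forall>n\<ge>N. \<forall>m\<ge>N. (Lp_energy p M (\<lambda>x. h n x - h m x)) \<le> ennreal e"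
  shows "\<exists>s g. (\<forall>k. k \<le> s k) \<and> g \<in> borel_measurable M \<and> (AE x in M. (\<lambda>k. h (s k) x) \<longlonglongrightarrow> g x) \<and>
     (\<lambda>k. Lp_energy p M (\<lambda>x. h (s k) x - g x)) \<longlonglongrightarrow> 0"
proof -
  \<comment> \<open>The first factor cancels the weight 2^(kp) used for pointwise convergence; the
    second leaves a geometric series.\<close>
  define \<delta> where "\<delta> k = (1/2) powr (real k * p) * (1/2) ^ k" for k
  have \<delta>: "\<delta> k > 0" for k by (simp add: \<delta>_def)
  obtain N where N: "\<And>k n m. n \<ge> N k \<Longrightarrow> m \<ge> N k \<Longrightarrow>
      (Lp_energy p M (\<lambda>x. h n x - h m x)) \<le> ennreal (\<delta> k)"
    using cau[OF \<delta>] by metis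
  \<comment> \<open>Dominates \<open>k\<close> and all \<open>N j\<close> with j <= k at once, so no
    recursive selection is required.\<close>
  define s where "s k = k + (\<Sum>j\<le>k. N j)" for k
  have sk: "k \<le> s k" for k by (simp add: s_def)
  have sN: "N k \<le> s j" if "k \<le> j" for k j
  proof -
    have "N k \<le> (\<Sum>j\<le>j. N j)" using that by (intro member_le_sum) auto
    then show ?thesis by (simp add: s_def)
  qed
  define f where "f k = h (s k)" for k
  have fm[measurable]: "f k \<in> borel_measurable M" for k by (simp add: f_def)
  have fd: "Lp_energy p M (\<lambda>x. f k x - f j x) \<le> ennreal (\<delta> k)" if "k \<le> j" for k j
    unfolding f_def using that by (intro N sN) auto
  have AE: "AE x in M. convergent (\<lambda>k. f k x)"
  proof -
    \<comment> \<open>A finite sum \<open>S\<close> of these terms at a point forces successive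
      differences to be at most S^(1/p) 2^(-k).\<close>
    let ?t = "\<lambda>k x. ennreal (2 powr (real k * p)) * ennreal (norm (f k x - f (Suc k) x) powr p)"
    have "(\<integral>\<^sup>+x. (\<Sum>k. ?t k x) \<partial>M) = (\<Sum>k. \<integral>\<^sup>+x. ?t k x \<partial>M)"
      by (intro nn_integral_suminf) measurable
    also have "\<dots> \<le> (\<Sum>k. ennreal ((1/2) ^ k))"
    proof (intro suminf_le)
      fix k
      have "(\<integral>\<^sup>+x. ?t k x \<partial>M) = ennreal (2 powr (real k * p)) * (Lp_energy p M (\<lambda>x. f k x - f (Suc k) x))"
        by (intro nn_integral_cmult) measurable
      also have "\<dots> \<le> ennreal (2 powr (real k * p)) * ennreal (\<delta> k)"
        using fd[of k "Suc k"] by (intro mult_left_mono) auto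
      also have "\<dots> = ennreal (2 powr (real k * p) * \<delta> k)" by (simp add: ennreal_mult less_imp_le[OF \<delta>])
      also have "2 powr (real k * p) * \<delta> k = (1/2) ^ k"
        by (simp add: \<delta>_def mult.assoc[symmetric] powr_mult[symmetric])
      finally show "(\<integral>\<^sup>+x. ?t k x \<partial>M) \<le> ennreal ((1/2) ^ k)" .
    qed auto
    also have "\<dots> < \<infinity>"
      by (subst suminf_ennreal2) (auto intro: summable_geometric)
    finally have "AE x in M. (\<Sum>k. ?t k x) \<noteq> \<infinity>"
      by (intro nn_integral_noteq_infinite) auto
    then show ?thesis
    proof eventually_elim
      case (elim x)
      define S where "S = enn2real (\<Sum>k. ?t k x)"
      have S: "(\<Sum>k. ?t k x) = ennreal S" using elim by (simp add: S_def less_top)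
      have S0: "S \<ge> 0" by (simp add: S_def)
      have bd: "norm (f (Suc k) x - f k x) \<le> S powr (1/p) * (1/2) ^ k" for k
      proof -
        have "?t k x \<le> (\<Sum>k. ?t k x)"
          using sum_le_suminf[of "\<lambda>k. ?t k x" "{k}"] by simp
        then have "2 powr (real k * p) * norm (f k x - f (Suc k) x) powr p \<le> S"
          unfolding S using S0 by (simp add: ennreal_mult[symmetric])
        then have "((2 powr real k) * norm (f k x - f (Suc k) x)) powr p \<le> S"
          by (simp add: powr_mult powr_powr)
        then have "(((2 powr real k) * norm (f k x - f (Suc k) x)) powr p) powr (1/p) \<le> S powr (1/p)"
          using p by (intro powr_mono2) auto
        then have "2 ^ k * norm (f k x - f (Suc k) x) \<le> S powr (1/p)"
          using p by (simp add: powr_powr powr_realpow)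
        then show ?thesis by (simp add: power_divide field_simps norm_minus_commute)
      qed
      have "summable (\<lambda>k. S powr (1/p) * (1/2) ^ k)" by (intro summable_mult summable_geometric) auto
      then have "summable (\<lambda>k. f (Suc k) x - f k x)"
        by (rule summable_comparison_test'[where N = 0]) (use bd in auto)
      then have "convergent (\<lambda>n. \<Sum>k<n. f (Suc k) x - f k x)" by (simp add: summable_iff_convergent)
      then have "convergent (\<lambda>n. f n x - f 0 x)" by (simp add: sum_lessThan_telescope[of "\<lambda>k. f k x"])
      then have "convergent (\<lambda>n. (f n x - f 0 x) + f 0 x)" by (intro convergent_add convergent_const)
      then show ?case by simp
    qed
  qed
  define g where "g x = lim (\<lambda>k. f k x)" for x
  have gm[measurable]: "g \<in> borel_measurable M"
    unfolding g_def by (rule borel_measurable_lim_metric) measurable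
  have conv: "AE x in M. (\<lambda>k. f k x) \<longlonglongrightarrow> g x"
    using AE by eventually_elim (simp add: g_def convergent_LIMSEQ_iff)
  have lim0: "Lp_energy p M (\<lambda>x. f k x - g x) \<le> ennreal (\<delta> k)" for k
  proof -
    have "Lp_energy p M (\<lambda>x. f k x - g x) =
        (\<integral>\<^sup>+x. liminf (\<lambda>j. ennreal (norm (f k x - f j x) powr p)) \<partial>M)"
    proof (rule nn_integral_cong_AE, use conv in eventually_elim)
      case (elim x)
      have "(\<lambda>j. ennreal (norm (f k x - f j x) powr p)) \<longlonglongrightarrow> ennreal (norm (f k x - g x) powr p)"
        using p by (intro tendsto_ennrealI tendsto_powr' tendsto_intros elim) auto
      then show ?case using lim_imp_Liminf[OF trivial_limit_sequentially] by metis
    qed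
    also have "\<dots> \<le> liminf (\<lambda>j. Lp_energy p M (\<lambda>x. f k x - f j x))"
      by (intro nn_integral_liminf) measurable
    also have "\<dots> \<le> ennreal (\<delta> k)"
      by (intro Liminf_le eventually_sequentiallyI[of k] fd)
        (simp add: trivial_limit_sequentially)
    finally show ?thesis .
  qed
  have "\<delta> \<longlonglongrightarrow> 0"
  proof (rule tendsto_sandwich[of "\<lambda>_. 0" _ _ "\<lambda>k. (1/2) ^ k"])
    have "\<delta> k \<le> (1/2) ^ k" for k
      using powr_le1[of "real k * p" "1/2"] p by (simp add: \<delta>_def mult_left_le_one_le)
    then show "\<forall>\<^sub>F k in sequentially. \<delta> k \<le> (1/2) ^ k" by simp
    show "\<forall>\<^sub>F k in sequentially. 0 \<le> \<delta> k" using less_imp_le[OF \<delta>] by simp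
  qed (auto intro: LIMSEQ_realpow_zero)
  then have "(\<lambda>k. ennreal (\<delta> k)) \<longlonglongrightarrow> 0" by (metis ennreal_0 tendsto_ennrealI)
  then have "(\<lambda>k. Lp_energy p M (\<lambda>x. f k x - g x)) \<longlonglongrightarrow> 0"
    by (rule tendsto_sandwich[rotated 3, OF _ ])
       (use lim0 in \<open>auto intro: tendsto_const\<close>)
  then show ?thesis
    using sk gm conv unfolding f_def by blast
qed

text \<open>A substitute for weak compactness: elements of almost minimal norm in a decreasing sequence of
  midpoint convex sets form a Cauchy sequence.\<close>

lemma Lp_nested_midpoint_convex:
  fixes C :: "nat \<Rightarrow> ('x \<Rightarrow> 'b::euclidean_space) set"
  assumes p: "1 < p" and Cm: "\<And>n g. g \<in> C n \<Longrightarrow> g \<in> borel_measurable M"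
    and CB: "\<And>n g. g \<in> C n \<Longrightarrow> (Lp_energy p M g) \<le> ennreal B"
    and dec: "\<And>n m. n \<le> m \<Longrightarrow> C m \<subseteq> C n" and ne: "\<And>n. C n \<noteq> {}"
    and mid: "\<And>n g h. g \<in> C n \<Longrightarrow> h \<in> C n \<Longrightarrow> (\<lambda>x. (1/2) *\<^sub>R (g x + h x)) \<in> C n"
  shows "\<exists>f g. (\<forall>n. f n \<in> C n) \<and> g \<in> borel_measurable M \<and>
     (Lp_energy p M g) \<le> ennreal B \<and>
     (\<lambda>k. Lp_energy p M (\<lambda>x. f k x - g x)) \<longlonglongrightarrow> 0"
proof -
  define I where "I g = (LINT x|M. norm (g x) powr p)" for g :: "'x \<Rightarrow> 'b"
  \<comment> \<open>A negative \<open>B\<close> has \<open>ennreal B = 0\<close>; \<open>B'\<close>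
    makes the same bound usable for real integrals.\<close>
  define B' where "B' = max B 0"
  have B': "B' \<ge> 0" "ennreal B = ennreal B'" by (auto simp: B'_def max_def ennreal_neg)
  have int: "integrable M (\<lambda>x. norm (g x) powr p)" if "g \<in> C n" for g n
  proof (rule integrableI_bounded)
    show "(\<lambda>x. norm (g x) powr p) \<in> borel_measurable M" using Cm[OF that] by measurable
    show "(\<integral>\<^sup>+x. ennreal (norm (norm (g x) powr p)) \<partial>M) < \<infinity>"
      using CB[OF that] by (auto simp: le_less_trans)
  qed
  have I0: "0 \<le> I g" for g by (simp add: I_def)
  have IB: "I g \<le> B'" if "g \<in> C n" for g n
  proof -
    have "ennreal (I g) \<le> ennreal B'"
      unfolding I_def using CB[OF that] int[OF that] B' by (subst nn_integral_eq_integral[symmetric]) auto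
    then show ?thesis using B' by simp
  qed
  \<comment> \<open>The least energy in \<open>C n\<close>. It increases as the sets shrink and is
    bounded, so it converges.\<close>
  define d where "d n = Inf (I ` C n)" for n
  have bb: "bdd_below (I ` C n)" for n using I0 by (intro bdd_belowI[of _ 0]) auto
  have dle: "d n \<le> I g" if "g \<in> C n" for g n
    unfolding d_def using that bb by (intro cINF_lower) auto
  have dmono: "d n \<le> d m" if "n \<le> m" for n m
    unfolding d_def using dec[OF that] ne[of m] bb by (intro cINF_superset_mono) auto
  have dB: "d n \<le> B'" for n using dle IB ne[of n] by (meson all_not_in_conv order_trans)
  obtain D where D: "d \<longlonglongrightarrow> D"
    by (rule incseq_convergent[of d B']) (use dmono dB in \<open>auto simp: incseq_def\<close>)
  have dD: "d n \<le> D" for n using incseq_le[OF _ D] dmono by (auto simp: incseq_def)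
  have "\<exists>g\<in>C n. I g < d n + 1 / real (Suc n)" for n
    using cInf_lessD[of "I ` C n" "d n + 1 / real (Suc n)"] ne[of n] unfolding d_def by auto
  then obtain h where h: "\<And>n. h n \<in> C n" "\<And>n. I (h n) < d n + 1 / real (Suc n)" by metis
  have hm[measurable]: "h n \<in> borel_measurable M" for n using h Cm by blast
  \<comment> \<open>Bounds the integrated gap of \<open>h n\<close> and \<open>h m\<close> for n <=
    m: their midpoint lies in \<open>C n\<close>, so has energy at least \<open>d n\<close>, while
    both energies are below D + 1/(n+1).\<close>
  define r where "r n = D - d n + 1 / real (Suc n)" for n
  have r0: "r \<longlonglongrightarrow> 0"
  proof -
    have "r \<longlonglongrightarrow> D - D + 0"
      unfolding r_def by (intro tendsto_intros D) (rule LIMSEQ_Suc[OF lim_1_over_n])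
    then show ?thesis by simp
  qed
  have est: "(LINT x|M. norm (h n x - h m x) powr p) \<le> e * (2 * B') + K * r n"
    and esti: "integrable M (\<lambda>x. norm (h n x - h m x) powr p)"
    if "n \<le> m" "0 < e" "0 < K"
      "\<forall>a b :: 'b. norm (a - b) powr p \<le> e * (norm a powr p + norm b powr p) + K * convex_gap p a b"
    for n m e K
  proof -
    have hmn: "h m \<in> C n" using dec[OF that(1)] h by blast
    note i = int[OF h(1)[of n]] int[OF hmn] int[OF mid[OF h(1)[of n] hmn]]
    have ic: "integrable M (\<lambda>x. e * (norm (h n x) powr p + norm (h m x) powr p) + K * convex_gap p (h n x) (h m x))"
      unfolding convex_gap_def using i by (intro Bochner_Integration.integrable_add integrable_mult_right
        Bochner_Integration.integrable_diff integrable_divide)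
    show ii: "integrable M (\<lambda>x. norm (h n x - h m x) powr p)"
      by (rule Bochner_Integration.integrable_bound[OF ic]) (use that in \<open>auto intro: order_trans[OF _ abs_ge_self]\<close>)
    have "(LINT x|M. norm (h n x - h m x) powr p)
       \<le> (LINT x|M. e * (norm (h n x) powr p + norm (h m x) powr p) + K * convex_gap p (h n x) (h m x))"
      using that by (intro integral_mono ii ic) auto
    also have "\<dots> = e * (I (h n) + I (h m)) + K * ((I (h n) + I (h m)) / 2 - I (\<lambda>x. (1/2) *\<^sub>R (h n x + h m x)))"
      unfolding convex_gap_def I_def using i by simp
    also have "\<dots> \<le> e * (2 * B') + K * r n"
    proof (intro add_mono mult_left_mono)
      show "I (h n) + I (h m) \<le> 2 * B'" using IB[OF h(1)[of n]] IB[OF h(1)[of m]] by simp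
      have "1 / real (Suc m) \<le> 1 / real (Suc n)" using that(1) by (simp add: frac_le)
      then show "(I (h n) + I (h m)) / 2 - I (\<lambda>x. (1/2) *\<^sub>R (h n x + h m x)) \<le> r n"
        using h(2)[of n] h(2)[of m] dle[OF mid[OF h(1)[of n] hmn]] dD[of m] dD[of n]
        unfolding r_def by argo
    qed (use that in auto)
    finally show "(LINT x|M. norm (h n x - h m x) powr p) \<le> e * (2 * B') + K * r n" .
  qed
  have cau: "\<exists>N. \<forall>n\<ge>N. \<forall>m\<ge>N. (Lp_energy p M (\<lambda>x. h n x - h m x)) \<le> ennreal e" if e: "e > 0" for e
  proof -
    \<comment> \<open>Gives half of \<open>e\<close> to the energy term; the other half goes to
      \<open>K * r n\<close>.\<close>
    define e' where "e' = e / (2 * (2 * B' + 1))"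
    have e': "e' > 0" using e B' by (simp add: e'_def)
    obtain K where K: "K > 0"
      "\<forall>a b :: 'b. norm (a - b) powr p \<le> e' * (norm a powr p + norm b powr p) + K * convex_gap p a b"
      using norm_powr_uniformly_convex[OF p e'] by blast
    have "(\<lambda>n. K * r n) \<longlonglongrightarrow> K * 0" by (intro tendsto_intros r0)
    then have "\<forall>\<^sub>F n in sequentially. K * r n < e / 2"
      by (rule order_tendstoD) (use e in auto)
    then obtain N where N: "\<And>n. n \<ge> N \<Longrightarrow> K * r n < e / 2" by (auto simp: eventually_sequentially)
    have e2: "e' * (2 * B') \<le> e / 2"
      using e B' by (simp add: e'_def divide_simps)
    have *: "Lp_energy p M (\<lambda>x. h n x - h m x) \<le> ennreal e" if "n \<ge> N" "n \<le> m" for n m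
    proof -
      have "(LINT x|M. norm (h n x - h m x) powr p) \<le> e"
        using est[OF that(2) e' K] N[OF that(1)] e2 by linarith
      then show ?thesis using esti[OF that(2) e' K]
        by (subst nn_integral_eq_integral) (auto intro: ennreal_leI)
    qed
    show ?thesis
    proof (intro exI[of _ N] allI impI)
      fix n m assume "N \<le> n" "N \<le> m"
      then show "Lp_energy p M (\<lambda>x. h n x - h m x) \<le> ennreal e"
        using *[of n m] *[of m n] by (cases "n \<le> m") (auto simp: norm_minus_commute)
    qed
  qed
  obtain s g where sg: "\<And>k. k \<le> s k" "g \<in> borel_measurable M" "AE x in M. (\<lambda>k. h (s k) x) \<longlonglongrightarrow> g x"
     "(\<lambda>k. Lp_energy p M (\<lambda>x. h (s k) x - g x)) \<longlonglongrightarrow> 0"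
    using Lp_cauchy_subseq[OF p hm cau] by blast
  have "Lp_energy p M g = (\<integral>\<^sup>+x. liminf (\<lambda>j. ennreal (norm (h (s j) x) powr p)) \<partial>M)"
  proof (rule nn_integral_cong_AE, use sg(3) in eventually_elim)
    case (elim x)
    have "(\<lambda>j. ennreal (norm (h (s j) x) powr p)) \<longlonglongrightarrow> ennreal (norm (g x) powr p)"
      using p by (intro tendsto_ennrealI tendsto_powr' tendsto_intros elim) auto
    then show ?case using lim_imp_Liminf[OF trivial_limit_sequentially] by metis
  qed
  also have "\<dots> \<le> liminf (\<lambda>j. Lp_energy p M (\<lambda>x. h (s j) x))"
    by (intro nn_integral_liminf) measurable
  also have "\<dots> \<le> ennreal B"
    by (intro Liminf_le always_eventually allI CB[OF h(1)]) (simp add: trivial_limit_sequentially)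
  finally have gB: "Lp_energy p M g \<le> ennreal B" .
  have "h (s n) \<in> C n" for n using dec[OF sg(1)[of n]] h(1) by blast
  then show ?thesis using sg gB by (intro exI[of _ "\<lambda>k. h (s k)"] exI[of _ g]) auto
qed

section \<open>Passage to the limit\<close>

context mollified
begin

text \<open>With the integration over \<open>h\<close> outside, Jensen applies for each fixed
  \<open>h\<close>.\<close>

lemma moll_energy_le:
  assumes p: "1 \<le> p" and S[measurable]: "S \<in> sets borel"
  shows "quot_energy p \<kappa> S moll \<le> quot_energy p \<kappa> S w"
proof -
  have swap: "quot_energy p \<kappa> S g =
     (\<integral>\<^sup>+h. (\<integral>\<^sup>+x. ennreal (trunc_pow p \<kappa> ((g (x + h) - g x) / norm h)) \<partial>lborel) *
        (ennreal (norm h powr - real DIM('a)) * indicator S h) \<partial>lborel)"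
    if [measurable]: "g \<in> borel_measurable borel" for g :: "'a \<Rightarrow> real"
  proof -
    have "quot_energy p \<kappa> S g =
      (\<integral>\<^sup>+h. (\<integral>\<^sup>+x. ennreal (trunc_pow p \<kappa> ((g (x + h) - g x) / norm h)) *
        (ennreal (norm h powr - real DIM('a)) * indicator S h) \<partial>lborel) \<partial>lborel)"
      unfolding mult.assoc by (intro lborel_pair.Fubini') measurable
    also have "\<dots> = (\<integral>\<^sup>+h. (\<integral>\<^sup>+x. ennreal (trunc_pow p \<kappa> ((g (x + h) - g x) / norm h)) \<partial>lborel) *
        (ennreal (norm h powr - real DIM('a)) * indicator S h) \<partial>lborel)"
      by (intro nn_integral_cong nn_integral_multc) measurable
    finally show ?thesis .
  qed
  show ?thesis
    unfolding swap[OF moll_measurable] swap[OF w]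
    by (intro nn_integral_mono mult_right_mono moll_Jensen[OF convex_on_trunc_pow[OF p]])
      (auto simp: trunc_pow_nonneg)
qed

text \<open>The data \<delta>, k0 and \<open>C\<close> of the layer cake bound vary with M and
  \<kappa>, but only the slope A |\<gamma>| survives; hence a bound independent of truncation and
  mollifier.\<close>

lemma moll_grad_energy:
  assumes p: "1 \<le> p" and \<gamma>: "\<gamma> < - p" and e: "norm (e::'a) = 1" and A: "0 \<le> A" and l0: "0 < l0"
    and bd: "\<And>l. 0 < l \<Longrightarrow> l < l0 \<Longrightarrow> level_energy p \<gamma> l w \<le> ennreal A"
  shows "ennreal (K_const e p) * Lp_energy p lborel moll_grad \<le> ennreal (A * \<bar>\<gamma>\<bar>)"
proof (rule gradient_integral_bound[OF p moll_grad_measurable e])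
  fix \<kappa> :: real assume \<kappa>: "0 < \<kappa>"
  obtain \<delta> k0 C where \<delta>: "\<delta> > 0" and le: "\<And>k::nat. k > k0 \<Longrightarrow>
    quot_energy p \<kappa> (annulus (exp (- real k)) \<delta>) w \<le> ennreal ((A * \<bar>\<gamma>\<bar>) * real k + C)"
    using layer_cake_bound[OF p \<gamma> w wM A l0 bd \<kappa>] by blast
  show "slope_energy p \<kappa> moll_grad \<le> ennreal (A * \<bar>\<gamma>\<bar>)"
  proof (rule gradient_integral_bound_truncated[OF p moll_measurable moll_grad_measurable moll_has_derivative \<kappa> \<delta>])
    show "quot_energy p \<kappa> (annulus (exp (- real k)) \<delta>) moll
       \<le> ennreal ((A * \<bar>\<gamma>\<bar>) * real k + C)" if "k > k0" for k
      by (rule order_trans[OF moll_energy_le[OF p annulus_borel] le[OF that]])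
  qed
qed

end

text \<open>Takes the place of Hoelder's inequality on sets of finite measure: \<eta> = 1 gives
  integrability, small \<eta> gives convergence.\<close>

lemma powr_young:
  fixes t \<eta> p :: real
  assumes "0 \<le> t" "0 < \<eta>" "1 \<le> p"
  shows "t \<le> \<eta> + \<eta> powr (1 - p) * t powr p"
proof (cases "t \<le> \<eta>")
  case True
  then show ?thesis using assms by (simp add: add_increasing2)
next
  case False
  then have t: "t > \<eta>" "t > 0" using assms by auto
  have "t = t powr (1 - p) * t powr p" using t by (simp add: powr_add[symmetric])
  also have "\<dots> \<le> \<eta> powr (1 - p) * t powr p"
    using t assms by (intro mult_right_mono powr_mono2') auto
  finally show ?thesis using assms by simp
qed

lemma integrable_Lp_times_compact_support:
  fixes g \<psi> :: "'a::euclidean_space \<Rightarrow> real"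
  assumes p: "1 \<le> p" and [measurable]: "g \<in> borel_measurable borel" "\<psi> \<in> borel_measurable borel"
    and g: "integrable lborel (\<lambda>x. \<bar>g x\<bar> powr p)"
    and B: "\<And>x. \<bar>\<psi> x\<bar> \<le> B" and R: "\<And>x. norm x > R \<Longrightarrow> \<psi> x = 0"
  shows "integrable lborel (\<lambda>x. g x * \<psi> x)"
proof -
  have B0: "0 \<le> B" using B[of 0] by linarith
  have i: "integrable lborel (\<lambda>x. B * (indicator (cball 0 R) x + \<bar>g x\<bar> powr p))"
    using emeasure_lborel_cball_finite[of "0::'a" R] g
    by (intro integrable_mult_right Bochner_Integration.integrable_add integrable_real_indicator) auto
  show ?thesis
  proof (rule Bochner_Integration.integrable_bound[OF i])
    show "AE x in lborel. norm (g x * \<psi> x) \<le> norm (B * (indicator (cball 0 R) x + \<bar>g x\<bar> powr p))"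
    proof (rule AE_I2)
      fix x
      show "norm (g x * \<psi> x) \<le> norm (B * (indicator (cball 0 R) x + \<bar>g x\<bar> powr p))"
      proof (cases "norm x \<le> R")
        case True
        have "\<bar>g x\<bar> * \<bar>\<psi> x\<bar> \<le> (1 + \<bar>g x\<bar> powr p) * B"
          using powr_young[of "\<bar>g x\<bar>" 1 p] p B[of x] by (intro mult_mono) auto
        then show ?thesis using True B0 by (simp add: abs_mult mult.commute)
      qed (use R[of x] in simp)
    qed
  qed measurable
qed

lemma Lp_representative:
  fixes u :: "'a::euclidean_space \<Rightarrow> real"
  assumes "in_Lp p u"
  obtains u' where "u' \<in> borel_measurable borel" "AE x in lborel. u x = u' x"
    "integrable lborel (\<lambda>x. \<bar>u' x\<bar> powr p)"
proof -
  have um: "u \<in> borel_measurable lebesgue" and ui: "integrable lebesgue (\<lambda>x. \<bar>u x\<bar> powr p)"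
    using assms by (auto simp: in_Lp_def)
  obtain u' where u'[measurable]: "u' \<in> borel_measurable lborel" and uu: "AE x in lborel. u x = u' x"
    using completion_ex_borel_measurable_real[OF um] by auto
  have "AE x in lebesgue. u x = u' x" by (rule AE_completion[OF uu])
  then have "AE x in lebesgue. \<bar>u x\<bar> powr p = \<bar>u' x\<bar> powr p" by eventually_elim simp
  moreover have "(\<lambda>x. \<bar>u' x\<bar> powr p) \<in> borel_measurable lebesgue"
    by (intro measurable_completion) measurable
  ultimately have "integrable lebesgue (\<lambda>x. \<bar>u' x\<bar> powr p)"
    using integrable_cong_AE[THEN iffD1, OF borel_measurable_integrable[OF ui] _ _ ui] by blast
  then have "integrable lborel (\<lambda>x. \<bar>u' x\<bar> powr p)" by (subst (asm) integrable_completion) auto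
  moreover have "u' \<in> borel_measurable borel" using u' by simp
  ultimately show ?thesis using that uu by blast
qed

abbreviation partial_pairing :: "('a::euclidean_space \<Rightarrow> 'a) \<Rightarrow> 'a \<Rightarrow> ('a \<Rightarrow> real) \<Rightarrow> real" where
  "partial_pairing g b \<phi> \<equiv> LINT x|lborel. (g x \<bullet> b) * \<phi> x"

abbreviation derivative_pairing :: "('a::euclidean_space \<Rightarrow> real) \<Rightarrow> 'a \<Rightarrow> ('a \<Rightarrow> real) \<Rightarrow> real" where
  "derivative_pairing u b \<phi> \<equiv> LINT x|lebesgue. u x * frechet_derivative \<phi> (at x) b"

text \<open>One index drives both the truncation height n and the mollification radius 1/(n+1); the
  energy bound does not depend on it.\<close>

lemma smooth_approximation:
  fixes u :: "'a::euclidean_space \<Rightarrow> real" and e :: 'a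
  assumes p: "1 \<le> p" and \<gamma>: "\<gamma> < - p" and u: "in_Lp p u" and e: "norm e = 1" and A: "0 \<le> A" and l0: "0 < l0"
    and bd: "\<And>l. 0 < l \<Longrightarrow> l < l0 \<Longrightarrow> Phi_lam p \<gamma> l u \<le> ennreal A"
  obtains v :: "nat \<Rightarrow> 'a \<Rightarrow> 'a" where "\<And>n. v n \<in> borel_measurable borel"
    "\<And>n. ennreal (K_const e p) * Lp_energy p lborel (v n) \<le> ennreal (A * \<bar>\<gamma>\<bar>)"
    "\<And>\<phi> b. test_function \<phi> \<Longrightarrow> b \<in> Basis \<Longrightarrow>
       (\<lambda>n. partial_pairing (v n) b \<phi>) \<longlonglongrightarrow> - derivative_pairing u b \<phi>"
    "\<And>\<phi> b. test_function \<phi> \<Longrightarrow> b \<in> Basis \<Longrightarrow> integrable lebesgue (\<lambda>x. u x * frechet_derivative \<phi> (at x) b)"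
proof -
  obtain u' where u'[measurable]: "u' \<in> borel_measurable borel" and uu: "AE x in lborel. u x = u' x"
    and u'i: "integrable lborel (\<lambda>x. \<bar>u' x\<bar> powr p)"
    using Lp_representative[OF u] .
  obtain N where N: "N \<in> null_sets lborel" and Nu: "\<And>x. x \<notin> N \<Longrightarrow> u x = u' x"
  proof -
    obtain N where "{x\<in>space lborel. \<not> u x = u' x} \<subseteq> N" "emeasure lborel N = 0" "N \<in> sets lborel"
      using AE_E[OF uu] by blast
    then show ?thesis using that[of N] by (auto simp: null_sets_def)
  qed
  define r where "r n = 1 / real (Suc n)" for n
  have r: "0 < r n" "r n \<le> 1" for n by (auto simp: r_def)
  have r0: "r \<longlonglongrightarrow> 0" unfolding r_def by (rule LIMSEQ_Suc[OF lim_1_over_n])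
  obtain \<rho> :: "nat \<Rightarrow> 'a \<Rightarrow> real" where \<rho>: "\<And>n. mollifier (r n) (\<rho> n)"
  proof -
    have "\<forall>n. \<exists>\<rho> :: 'a \<Rightarrow> real. mollifier (r n) \<rho>" using mollifier_exists[OF r(1)] by blast
    from choice[OF this] show ?thesis using that by blast
  qed
  \<comment> \<open>Clipping is a contraction, so it does not increase differences and the level
    sets only shrink.\<close>
  define w where "w n x = max (- real n) (min (real n) (u' x))" for n x
  have w[measurable]: "w n \<in> borel_measurable borel" for n unfolding w_def by measurable
  have wM: "\<bar>w n x\<bar> \<le> real n" for n x by (auto simp: w_def)
  have wL: "\<bar>w n x - w n y\<bar> \<le> \<bar>u' x - u' y\<bar>" for n x y by (auto simp: w_def max_def min_def)
  have wu: "\<bar>w n x\<bar> \<le> \<bar>u' x\<bar>" for n x by (auto simp: w_def max_def min_def)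
  have wlim: "(\<lambda>n. w n x) \<longlonglongrightarrow> u' x" for x
  proof (rule tendsto_eventually)
    obtain m :: nat where "\<bar>u' x\<bar> \<le> real m" using real_arch_simple by blast
    then show "\<forall>\<^sub>F n in sequentially. w n x = u' x"
      unfolding eventually_sequentially by (intro exI[of _ m]) (auto simp: w_def abs_le_iff max_def min_def)
  qed
  have ml: "mollified (\<rho> n) (w n) (r n) (real n)" for n
    by unfold_locales (use \<rho> w wM in auto)
  define v where "v n = mollified.moll_grad (\<rho> n) (w n)" for n
  define f where "f n = mollified.moll (\<rho> n) (w n)" for n
  show ?thesis
  proof
    show "v n \<in> borel_measurable borel" for n
      unfolding v_def by (rule mollified.moll_grad_measurable[OF ml])
    show "ennreal (K_const e p) * Lp_energy p lborel (v n) \<le> ennreal (A * \<bar>\<gamma>\<bar>)" for n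
      unfolding v_def
    proof (rule mollified.moll_grad_energy[OF ml p \<gamma> e A l0])
      fix l :: real assume l: "0 < l" "l < l0"
      have "level_energy p \<gamma> l (w n) \<le> Phi_lam p \<gamma> l u"
        by (rule Phi_lam_ge_iterated[OF w N]) (use wL Nu in auto)
      also have "\<dots> \<le> ennreal A" by (rule bd[OF l])
      finally show "level_energy p \<gamma> l (w n) \<le> ennreal A" .
    qed
    fix \<phi> :: "'a \<Rightarrow> real" and b :: 'a assume \<phi>: "test_function \<phi>" and b: "b \<in> Basis"
    define \<psi> where "\<psi> x = frechet_derivative \<phi> (at x) b" for x
    have c\<psi>: "continuous_on UNIV \<psi>"
      unfolding \<psi>_def by (rule test_function_derivative_continuous[OF \<phi>])
    have [measurable]: "\<psi> \<in> borel_measurable borel" using borel_measurable_continuous_onI[OF c\<psi>] .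
    obtain R B where R: "C1_bound \<phi> R B" using test_function_C1_bound[OF \<phi>] by blast
    have RB: "R > 0" "\<And>x. norm x > R \<Longrightarrow> \<psi> x = 0" "\<And>x. \<bar>\<psi> x\<bar> \<le> B"
      unfolding \<psi>_def using C1_boundD(1,4,6)[OF R] b by blast+
    have B0: "0 \<le> B" using RB(3)[of 0] by linarith
    have iu': "integrable lborel (\<lambda>x. u' x * \<psi> x)"
      by (rule integrable_Lp_times_compact_support[OF p _ _ u'i RB(3) RB(2)]) measurable
    have uul: "AE x in lebesgue. u' x * \<psi> x = u x * \<psi> x"
      using AE_completion[OF uu] by eventually_elim simp
    have [measurable]: "u \<in> borel_measurable lebesgue" "\<psi> \<in> borel_measurable lebesgue" "u' \<in> borel_measurable lebesgue"
      using u by (auto simp: in_Lp_def intro!: measurable_completion)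
    have iu'l: "integrable lebesgue (\<lambda>x. u' x * \<psi> x)" using iu' by (subst integrable_completion) auto
    show "integrable lebesgue (\<lambda>x. u x * frechet_derivative \<phi> (at x) b)"
      unfolding \<psi>_def[symmetric] by (rule integrable_cong_AE[THEN iffD1, OF _ _ uul iu'l]) measurable
    have eq: "(LINT x|lebesgue. u x * \<psi> x) = (LINT x|lborel. u' x * \<psi> x)"
    proof -
      have "(LINT x|lebesgue. u x * \<psi> x) = (LINT x|lebesgue. u' x * \<psi> x)"
        by (rule integral_cong_AE[symmetric, OF _ _ uul]) measurable
      also have "\<dots> = (LINT x|lborel. u' x * \<psi> x)" by (rule integral_completion) measurable
      finally show ?thesis .
    qed
    \<comment> \<open>With the smoothing on the test side, both factors converge pointwise,
      dominated by |u'| times \<open>B\<close> on the ball of radius R + 1.\<close>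
    define \<psi>' where "\<psi>' n z = (LINT y|lborel. \<rho> n y * \<psi> (y + z))" for n z
    have pair: "partial_pairing (v n) b \<phi> = - (LINT z|lborel. w n z * \<psi>' n z)" for n
      using mollified.moll_by_parts[OF ml \<phi> b, of n] mollified.moll_pairing[OF ml[of n] c\<psi> RB(2) RB(3)]
      unfolding v_def \<psi>'_def \<psi>_def by simp
    have [measurable]: "\<rho> n \<in> borel_measurable borel" for n by (rule mollified.\<rho>_meas[OF ml])
    have \<psi>'m[measurable]: "\<psi>' n \<in> borel_measurable borel" for n unfolding \<psi>'_def by measurable
    have \<psi>'lim: "(\<lambda>n. \<psi>' n z) \<longlonglongrightarrow> \<psi> z" for z
    proof (rule LIMSEQ_I)
      fix \<epsilon> :: real assume \<epsilon>: "\<epsilon> > 0"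
      have "continuous (at z) \<psi>" using c\<psi> continuous_on_eq_continuous_at[of UNIV \<psi>] by simp
      then obtain d where d: "d > 0" "\<And>x. norm (x - z) < d \<Longrightarrow> \<bar>\<psi> x - \<psi> z\<bar> < \<epsilon> / 2"
        unfolding continuous_at_eps_delta dist_norm real_norm_def using half_gt_zero[OF \<epsilon>] by blast
      have "\<forall>\<^sub>F n in sequentially. r n < d" using order_tendstoD(2)[OF r0 d(1)] .
      then obtain n0 where n0: "\<And>n. n \<ge> n0 \<Longrightarrow> r n < d" unfolding eventually_sequentially by blast
      have "norm (\<psi>' n z - \<psi> z) < \<epsilon>" if n: "n \<ge> n0" for n
      proof -
        have "\<bar>\<psi>' n z - \<psi> z\<bar> \<le> \<epsilon> / 2"
          unfolding \<psi>'_def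
        proof (rule mollified.mollifier_average[OF ml c\<psi> RB(3)])
          fix y :: 'a assume "norm y \<le> r n"
          then have "norm (y + z - z) < d" using n0[OF n] by simp
          then show "\<bar>\<psi> (y + z) - \<psi> z\<bar> \<le> \<epsilon> / 2" using d(2) by (simp add: less_imp_le)
        qed
        then show ?thesis using \<epsilon> by simp
      qed
      then show "\<exists>no. \<forall>n\<ge>no. norm (\<psi>' n z - \<psi> z) < \<epsilon>" by blast
    qed
    have \<psi>'B: "\<bar>\<psi>' n z\<bar> \<le> B" for n z
      using mollified.mollifier_average[OF ml c\<psi> RB(3), of n z 0 B] RB(3) by (simp add: \<psi>'_def)
    have \<psi>'R: "\<psi>' n z = 0" if "norm z > R + 1" for n z
    proof -
      have "\<bar>\<psi>' n z - 0\<bar> \<le> 0"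
        unfolding \<psi>'_def
      proof (rule mollified.mollifier_average[OF ml c\<psi> RB(3)])
        fix y :: 'a assume y: "norm y \<le> r n"
        have "norm z \<le> norm (y + z) + norm y" using norm_triangle_ineq4[of "y + z" y] by simp
        then have "norm (y + z) > R" using y r(2)[of n] that by simp
        then show "\<bar>\<psi> (y + z) - 0\<bar> \<le> 0" using RB(2) by simp
      qed
      then show ?thesis by simp
    qed
    have "(\<lambda>n. LINT z|lborel. w n z * \<psi>' n z) \<longlonglongrightarrow> (LINT z|lborel. u' z * \<psi> z)"
    proof (rule integral_dominated_convergence[where w = "\<lambda>z. \<bar>u' z * (B * indicator (cball 0 (R + 1)) z)\<bar>"])
      show "integrable lborel (\<lambda>z. \<bar>u' z * (B * indicator (cball 0 (R + 1)) z)\<bar>)"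
      proof (rule integrable_abs, rule integrable_Lp_times_compact_support[OF p u' _ u'i])
        show "(\<lambda>z. B * indicator (cball 0 (R + 1)) z) \<in> borel_measurable borel"
          by (intro borel_measurable_times borel_measurable_const borel_measurable_indicator) simp
        show "\<bar>B * indicator (cball 0 (R + 1)) z\<bar> \<le> B" for z :: 'a
          using B0 by (simp add: indicator_def)
        show "B * indicator (cball 0 (R + 1)) z = 0" if "R + 1 < norm z" for z :: 'a
          using that by simp
      qed
      show "AE z in lborel. (\<lambda>n. w n z * \<psi>' n z) \<longlonglongrightarrow> u' z * \<psi> z"
        by (intro AE_I2 tendsto_mult wlim \<psi>'lim)
      show "AE z in lborel. norm (w n z * \<psi>' n z) \<le> \<bar>u' z * (B * indicator (cball 0 (R + 1)) z)\<bar>" for n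
      proof (intro AE_I2)
        fix z
        show "norm (w n z * \<psi>' n z) \<le> \<bar>u' z * (B * indicator (cball 0 (R + 1)) z)\<bar>"
        proof (cases "norm z \<le> R + 1")
          case True
          then show ?thesis using mult_mono[OF wu[of n z] \<psi>'B[of n z]] B0 by (simp add: abs_mult)
        next
          case False
          then show ?thesis using \<psi>'R[of z n] by simp
        qed
      qed
    qed measurable
    then show "(\<lambda>n. partial_pairing (v n) b \<phi>) \<longlonglongrightarrow> - derivative_pairing u b \<phi>"
      unfolding pair \<psi>_def[symmetric] eq by (rule tendsto_minus)
  qed
qed

section \<open>Limits of the approximate gradients for p > 1 and p = 1\<close>

lemma ennreal_mult_le_imp_le_divide:
  assumes "0 < K" "ennreal K * I \<le> ennreal B"
  shows "I \<le> ennreal (B / K)"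
proof -
  have "ennreal (1 / K) * (ennreal K * I) \<le> ennreal (1 / K) * ennreal B"
    by (rule mult_left_mono[OF assms(2)]) simp
  moreover have "ennreal (1 / K) * (ennreal K * I) = I"
    using assms(1) by (simp add: mult.assoc[symmetric] ennreal_mult[symmetric])
  moreover have "ennreal (1 / K) * ennreal B = ennreal (B / K)"
    using assms(1) by (subst ennreal_mult'[symmetric]) auto
  ultimately show ?thesis by simp
qed

lemma Lp_pairing_tendsto:
  fixes g \<psi> :: "'a::euclidean_space \<Rightarrow> real"
  assumes p: "1 \<le> p" and fm[measurable]: "\<And>n. f n \<in> borel_measurable borel" and gm[measurable]: "g \<in> borel_measurable borel"
    and \<psi>m[measurable]: "\<psi> \<in> borel_measurable borel"
    and fi: "\<And>n::nat. integrable lborel (\<lambda>x. \<bar>f n x\<bar> powr p)" and gi: "integrable lborel (\<lambda>x. \<bar>g x\<bar> powr p)"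
    and lim: "(\<lambda>n. \<integral>\<^sup>+x. ennreal (\<bar>f n x - g x\<bar> powr p) \<partial>lborel) \<longlonglongrightarrow> 0"
    and B: "\<And>x. \<bar>\<psi> x\<bar> \<le> B" and R: "\<And>x. norm x > R \<Longrightarrow> \<psi> x = 0"
  shows "(\<lambda>n. LINT x|lborel. f n x * \<psi> x) \<longlonglongrightarrow> (LINT x|lborel. g x * \<psi> x)"
proof (rule LIMSEQ_I)
  fix \<epsilon> :: real assume \<epsilon>: "\<epsilon> > 0"
  have B0: "0 \<le> B" using B[of 0] by linarith
  have [measurable]: "cball 0 R \<in> sets (borel :: 'a measure)" by simp
  define V where "V = measure lborel (cball (0::'a) R)"
  have V: "emeasure lborel (cball (0::'a) R) = ennreal V" "0 \<le> V"
    using emeasure_lborel_cball_finite[of "0::'a" R] by (auto simp: V_def measure_def)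
  \<comment> \<open>Makes the constant part of Young's inequality, integrated over the ball of
    volume \<open>V\<close>, less than half of \<epsilon>; the summand 1 avoids division by
    0.\<close>
  define \<eta> where "\<eta> = \<epsilon> / (2 * (B * V + 1))"
  have \<eta>: "\<eta> > 0" using \<epsilon> B0 V by (simp add: \<eta>_def add_nonneg_pos)
  have \<eta>B: "B * \<eta> * V < \<epsilon> / 2"
  proof -
    have "B * \<eta> * V = (\<epsilon> / 2) * ((B * V) / (B * V + 1))" by (simp add: \<eta>_def)
    also have "\<dots> < (\<epsilon> / 2) * 1"
      using \<epsilon> B0 V by (intro mult_strict_left_mono) (auto simp: divide_less_eq add_nonneg_pos)
    finally show ?thesis by simp
  qed
  define c where "c = B * \<eta> powr (1 - p)"
  have c: "0 \<le> c" using B0 by (simp add: c_def)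
  let ?I = "\<lambda>n. \<integral>\<^sup>+x. ennreal (\<bar>f n x - g x\<bar> powr p) \<partial>lborel"
  have "(\<lambda>n. ennreal c * ?I n) \<longlonglongrightarrow> ennreal c * 0"
    by (intro ennreal_tendsto_cmult lim) simp
  then have "\<forall>\<^sub>F n in sequentially. ennreal c * ?I n < ennreal (\<epsilon> / 2)"
    by (rule order_tendstoD(2)) (use \<epsilon> in simp)
  then obtain n0 where n0: "\<And>n. n \<ge> n0 \<Longrightarrow> ennreal c * ?I n < ennreal (\<epsilon> / 2)"
    unfolding eventually_sequentially by blast
  have "norm ((LINT x|lborel. f n x * \<psi> x) - (LINT x|lborel. g x * \<psi> x)) < \<epsilon>" if n: "n \<ge> n0" for n
  proof -
    note i1 = integrable_Lp_times_compact_support[OF p fm \<psi>m fi[of n] B R]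
    note i2 = integrable_Lp_times_compact_support[OF p gm \<psi>m gi B R]
    have "ennreal \<bar>(LINT x|lborel. f n x * \<psi> x) - (LINT x|lborel. g x * \<psi> x)\<bar>
       = ennreal \<bar>LINT x|lborel. (f n x - g x) * \<psi> x\<bar>"
      using Bochner_Integration.integral_diff[OF i1 i2] by (simp add: left_diff_distrib)
    also have "\<dots> \<le> (\<integral>\<^sup>+x. ennreal \<bar>(f n x - g x) * \<psi> x\<bar> \<partial>lborel)"
    proof -
      have "integrable lborel (\<lambda>x. (f n x - g x) * \<psi> x)"
        using Bochner_Integration.integrable_diff[OF i1 i2] by (simp add: left_diff_distrib)
      from integral_norm_bound_ennreal[OF this] show ?thesis by simp
    qed
    also have "\<dots> \<le> (\<integral>\<^sup>+x. ennreal (B * \<eta>) * indicator (cball 0 R) x + ennreal c * ennreal (\<bar>f n x - g x\<bar> powr p) \<partial>lborel)"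
    proof (rule nn_integral_mono)
      fix x
      show "ennreal \<bar>(f n x - g x) * \<psi> x\<bar> \<le> ennreal (B * \<eta>) * indicator (cball 0 R) x + ennreal c * ennreal (\<bar>f n x - g x\<bar> powr p)"
      proof (cases "norm x \<le> R")
        case True
        have "\<bar>f n x - g x\<bar> * \<bar>\<psi> x\<bar> \<le> (\<eta> + \<eta> powr (1 - p) * \<bar>f n x - g x\<bar> powr p) * B"
          using \<eta> by (intro mult_mono powr_young p B) auto
        also have "\<dots> = B * \<eta> + c * \<bar>f n x - g x\<bar> powr p" by (simp add: c_def algebra_simps)
        finally have "ennreal \<bar>(f n x - g x) * \<psi> x\<bar> \<le> ennreal (B * \<eta> + c * \<bar>f n x - g x\<bar> powr p)"
          by (intro ennreal_leI) (simp add: abs_mult)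
        then show ?thesis using True B0 \<eta> c by (simp add: ennreal_mult)
      qed (use R[of x] in simp)
    qed
    also have "\<dots> = ennreal (B * \<eta>) * emeasure lborel (cball (0::'a) R) + ennreal c * ?I n"
      by (subst nn_integral_add) (auto simp: nn_integral_cmult)
    also have "\<dots> = ennreal (B * \<eta> * V) + ennreal c * ?I n"
      using B0 \<eta> V by (simp add: ennreal_mult)
    also have "\<dots> < ennreal (\<epsilon> / 2) + ennreal (\<epsilon> / 2)"
      using \<eta>B B0 \<eta> V n0[OF n] by (intro add_strict_mono ennreal_lessI) (use \<epsilon> in auto)
    also have "\<dots> = ennreal \<epsilon>" using \<epsilon> by (simp add: ennreal_plus[symmetric] del: ennreal_plus)
    finally show ?thesis by (simp add: ennreal_less_iff)
  qed
  then show "\<exists>no. \<forall>n\<ge>no. norm ((LINT x|lborel. f n x * \<psi> x) - (LINT x|lborel. g x * \<psi> x)) < \<epsilon>" by blast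
qed

lemma integrable_component_powr:
  fixes g :: "'a::euclidean_space \<Rightarrow> 'a"
  assumes p: "1 \<le> p" and [measurable]: "g \<in> borel_measurable borel" and b: "b \<in> Basis"
    and B: "Lp_energy p lborel g \<le> ennreal B"
  shows "integrable lborel (\<lambda>x. norm (g x) powr p)" "integrable lborel (\<lambda>x. \<bar>g x \<bullet> b\<bar> powr p)"
proof -
  show i: "integrable lborel (\<lambda>x. norm (g x) powr p)"
    by (rule integrableI_bounded) (use le_less_trans[OF B ennreal_less_top] in simp_all)
  have "\<bar>g x \<bullet> b\<bar> powr p \<le> norm (g x) powr p" for x
    using Basis_le_norm[OF b] p by (intro powr_mono2) auto
  then show "integrable lborel (\<lambda>x. \<bar>g x \<bullet> b\<bar> powr p)"
    by (intro Bochner_Integration.integrable_bound[OF i]) auto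
qed

text \<open>The sequence \<open>v\<close> need not converge in the p-norm. The weak equation with a
  tolerance, together with the energy bound, defines nested midpoint convex sets, which contain a
  strongly convergent sequence whose limit satisfies the equation exactly.\<close>

lemma weak_gradient_of_limit:
  fixes u :: "'a::euclidean_space \<Rightarrow> real" and v :: "nat \<Rightarrow> 'a \<Rightarrow> 'a"
  assumes p: "1 < p" and vm: "\<And>n. v n \<in> borel_measurable borel"
    and vB: "\<And>n. (Lp_energy p lborel (v n)) \<le> ennreal B"
    and lim: "\<And>\<phi> b. test_function \<phi> \<Longrightarrow> b \<in> Basis \<Longrightarrow>
       (\<lambda>n. partial_pairing (v n) b \<phi>) \<longlonglongrightarrow> - derivative_pairing u b \<phi>"
  obtains g where "g \<in> borel_measurable borel" "Lp_energy p lborel g \<le> ennreal B"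
    "is_weak_gradient u g"
proof -
  have p1: "1 \<le> p" using p by simp
  define l where "l g \<phi> b = partial_pairing g b \<phi> + derivative_pairing u b \<phi>"
    for g :: "'a \<Rightarrow> 'a" and \<phi> :: "'a \<Rightarrow> real" and b
  \<comment> \<open>The worst error over the tail: it decreases in \<open>n\<close>, which nests the
    sets, and it tends to 0.\<close>
  define E where "E n \<phi> b = (SUP k\<in>{n..}. \<bar>l (v k) \<phi> b\<bar>)" for n :: nat and \<phi> b
  have l0: "(\<lambda>n. l (v n) \<phi> b) \<longlonglongrightarrow> 0" if "test_function \<phi>" "b \<in> Basis" for \<phi> b
    using tendsto_add[OF lim[OF that] tendsto_const[of "derivative_pairing u b \<phi>"]]
    unfolding l_def by simp
  have bdd: "bdd_above ((\<lambda>k. \<bar>l (v k) \<phi> b\<bar>) ` {n..})" if t: "test_function \<phi>" "b \<in> Basis" for n \<phi> b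
  proof -
    obtain M where "\<And>k. norm (l (v k) \<phi> b) \<le> M"
      using convergent_imp_bounded[OF l0[OF t]] unfolding bounded_iff by auto
    then show ?thesis by (intro bdd_aboveI[of _ M]) auto
  qed
  have E0: "(\<lambda>n. E n \<phi> b) \<longlonglongrightarrow> 0" if t: "test_function \<phi>" "b \<in> Basis" for \<phi> b
  proof (rule LIMSEQ_I)
    fix \<epsilon> :: real assume \<epsilon>: "\<epsilon> > 0"
    obtain n0 where n0: "\<And>n. n \<ge> n0 \<Longrightarrow> norm (l (v n) \<phi> b - 0) < \<epsilon> / 2"
      using LIMSEQ_D[OF l0[OF t], of "\<epsilon> / 2"] \<epsilon> by auto
    have "norm (E n \<phi> b - 0) < \<epsilon>" if n: "n \<ge> n0" for n
    proof -
      have "E n \<phi> b \<le> \<epsilon> / 2"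
        unfolding E_def using n0 n by (intro cSUP_least) (auto intro: less_imp_le)
      moreover have "0 \<le> E n \<phi> b"
        unfolding E_def using cSUP_upper[OF _ bdd[OF t], of n n] by (auto intro: order_trans[OF abs_ge_zero])
      ultimately show ?thesis using \<epsilon> by simp
    qed
    then show "\<exists>no. \<forall>n\<ge>no. norm (E n \<phi> b - 0) < \<epsilon>" by blast
  qed
  have int: "integrable lborel (\<lambda>x. (g x \<bullet> b) * \<phi> x)"
    if h: "test_function \<phi>" "b \<in> Basis" "g \<in> borel_measurable borel"
      "Lp_energy p lborel g \<le> ennreal B" for g :: "'a \<Rightarrow> 'a" and \<phi> b
  proof -
    obtain R C where RC: "C1_bound \<phi> R C" using test_function_C1_bound[OF h(1)] by blast
    have "(\<lambda>x. g x \<bullet> b) \<in> borel_measurable borel" using h(3) by measurable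
    from integrable_Lp_times_compact_support[OF p1 this test_function_borel[OF h(1)]
        integrable_component_powr(2)[OF p1 h(3,2,4)] C1_boundD(5)[OF RC] C1_boundD(3)[OF RC]]
    show ?thesis .
  qed
  \<comment> \<open>\<open>C n\<close> contains the tail of \<open>v\<close>, and all its members satisfy the weak equation up to an error tending to 0\<close>
  define C where "C n = {g. g \<in> borel_measurable borel \<and> (Lp_energy p lborel g) \<le> ennreal B \<and>
     (\<forall>\<phi> b. test_function \<phi> \<longrightarrow> b \<in> Basis \<longrightarrow> \<bar>l g \<phi> b\<bar> \<le> E n \<phi> b)}" for n
  have vC: "v n \<in> C n" for n
    unfolding C_def using vm vB bdd by (auto simp: E_def intro!: cSUP_upper)
  have mid: "(\<lambda>x. (1/2) *\<^sub>R (g x + h x)) \<in> C n" if g: "g \<in> C n" and h: "h \<in> C n" for n g h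
  proof -
    have [measurable]: "g \<in> borel_measurable borel" "h \<in> borel_measurable borel" using g h by (auto simp: C_def)
    have "Lp_energy p lborel (\<lambda>x. (1/2) *\<^sub>R (g x + h x)) \<le>
      (\<integral>\<^sup>+x. ennreal (1/2) * ennreal (norm (g x) powr p) + ennreal (1/2) * ennreal (norm (h x) powr p) \<partial>lborel)"
    proof (rule nn_integral_mono)
      fix x
      have "norm ((1/2) *\<^sub>R (g x + h x)) powr p \<le> (1/2) * norm (g x) powr p + (1/2) * norm (h x) powr p"
        using convex_gap_nonneg[OF p, of "g x" "h x"] unfolding convex_gap_def add_divide_distrib by simp
      then have "ennreal (norm ((1/2) *\<^sub>R (g x + h x)) powr p) \<le> ennreal ((1/2) * norm (g x) powr p + (1/2) * norm (h x) powr p)"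
        by (rule ennreal_leI)
      also have "\<dots> = ennreal (1/2) * ennreal (norm (g x) powr p) + ennreal (1/2) * ennreal (norm (h x) powr p)"
      proof -
        have m: "ennreal (1/2) * ennreal t = ennreal (1/2 * t)" for t :: real
          by (rule ennreal_mult'[symmetric]) simp
        show ?thesis unfolding m by (rule ennreal_plus) auto
      qed
      finally show "ennreal (norm ((1/2) *\<^sub>R (g x + h x)) powr p) \<le>
        ennreal (1/2) * ennreal (norm (g x) powr p) + ennreal (1/2) * ennreal (norm (h x) powr p)" .
    qed
    also have "\<dots> = ennreal (1/2) * Lp_energy p lborel g + ennreal (1/2) * Lp_energy p lborel h"
    proof -
      have "(\<integral>\<^sup>+x. ennreal (1/2) * ennreal (norm (k x) powr p) \<partial>lborel) = ennreal (1/2) * Lp_energy p lborel k"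
        if [measurable]: "k \<in> borel_measurable borel" for k :: "'a \<Rightarrow> 'a"
        by (rule nn_integral_cmult) measurable
      then show ?thesis by (subst nn_integral_add) simp_all
    qed
    also have "\<dots> \<le> ennreal (1/2) * ennreal B + ennreal (1/2) * ennreal B"
      using g h by (intro add_mono mult_left_mono) (auto simp: C_def)
    also have "\<dots> = ennreal B"
    proof (cases "0 \<le> B")
      case True
      have "ennreal (1/2) * ennreal B + ennreal (1/2) * ennreal B = ennreal (1/2 * B) + ennreal (1/2 * B)"
        using True by (simp only: ennreal_mult'[of "1/2" B])
      also have "\<dots> = ennreal (1/2 * B + 1/2 * B)" using True by (intro ennreal_plus[symmetric]) auto
      finally show ?thesis by simp
    qed (simp add: ennreal_neg)
    finally have b: "Lp_energy p lborel (\<lambda>x. (1/2) *\<^sub>R (g x + h x)) \<le> ennreal B" .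
    \<comment> \<open>The error \<open>l\<close> is affine in \<open>g\<close>, so at a midpoint it
      is the average of the two errors.\<close>
    have "\<bar>l (\<lambda>x. (1/2) *\<^sub>R (g x + h x)) \<phi> b\<bar> \<le> E n \<phi> b" if t: "test_function \<phi>" "b \<in> Basis" for \<phi> b
    proof -
      have ig: "integrable lborel (\<lambda>x. (g x \<bullet> b) * \<phi> x)" and ih: "integrable lborel (\<lambda>x. (h x \<bullet> b) * \<phi> x)"
        using g h by (auto simp: C_def intro!: int t)
      have "(LINT x|lborel. ((1/2) *\<^sub>R (g x + h x) \<bullet> b) * \<phi> x) = (LINT x|lborel. (1/2) * ((g x \<bullet> b) * \<phi> x + (h x \<bullet> b) * \<phi> x))"
        by (intro Bochner_Integration.integral_cong) (auto simp: inner_add_left algebra_simps)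
      also have "\<dots> = (1/2) * (partial_pairing g b \<phi> + partial_pairing h b \<phi>)"
        using Bochner_Integration.integral_add[OF ig ih] by simp
      finally have "l (\<lambda>x. (1/2) *\<^sub>R (g x + h x)) \<phi> b = (1/2) * (l g \<phi> b + l h \<phi> b)"
        unfolding l_def by argo
      moreover have "\<bar>l g \<phi> b\<bar> \<le> E n \<phi> b" "\<bar>l h \<phi> b\<bar> \<le> E n \<phi> b" using g h t by (auto simp: C_def)
      ultimately show ?thesis by argo
    qed
    then show ?thesis using b unfolding C_def by simp
  qed
  have dec: "C m \<subseteq> C n" if "n \<le> m" for n m
  proof
    fix g assume g: "g \<in> C m"
    have "\<bar>l g \<phi> b\<bar> \<le> E n \<phi> b" if "test_function \<phi>" "b \<in> Basis" for \<phi> b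
    proof -
      have "\<bar>l g \<phi> b\<bar> \<le> E m \<phi> b" using g that by (simp add: C_def)
      also have "\<dots> \<le> E n \<phi> b"
        unfolding E_def using \<open>n \<le> m\<close> by (intro cSUP_subset_mono bdd that) auto
      finally show ?thesis .
    qed
    then show "g \<in> C n" using g by (simp add: C_def)
  qed
  obtain f g where f: "\<And>n. f n \<in> C n" and g: "g \<in> borel_measurable lborel"
    "Lp_energy p lborel g \<le> ennreal B"
    and fg: "(\<lambda>k. Lp_energy p lborel (\<lambda>x. f k x - g x)) \<longlonglongrightarrow> 0"
  proof -
    have "\<exists>f g. (\<forall>n. f n \<in> C n) \<and> g \<in> borel_measurable lborel \<and>
     (Lp_energy p lborel g) \<le> ennreal B \<and>
     (\<lambda>k. Lp_energy p lborel (\<lambda>x. f k x - g x)) \<longlonglongrightarrow> 0"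
    proof (rule Lp_nested_midpoint_convex[OF p])
      show "C n \<noteq> {}" for n using vC by blast
      show "g \<in> borel_measurable lborel" if "g \<in> C n" for n g using that by (simp add: C_def)
      show "Lp_energy p lborel g \<le> ennreal B" if "g \<in> C n" for n g
        using that by (simp add: C_def)
    qed (rule dec mid; assumption)+
    then show ?thesis using that by blast
  qed
  have gm[measurable]: "g \<in> borel_measurable borel" using g by simp
  have fm[measurable]: "f n \<in> borel_measurable borel" for n using f[of n] by (simp add: C_def)
  have fB: "Lp_energy p lborel (f n) \<le> ennreal B" for n using f[of n] by (simp add: C_def)
  have weak: "partial_pairing g b \<phi> = - derivative_pairing u b \<phi>"
    if t: "test_function \<phi>" "b \<in> Basis" for \<phi> b
  proof -
    obtain R C where RC: "C1_bound \<phi> R C" using test_function_C1_bound[OF t(1)] by blast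
    have "(\<lambda>n. \<integral>\<^sup>+x. ennreal (\<bar>f n x \<bullet> b - g x \<bullet> b\<bar> powr p) \<partial>lborel) \<longlonglongrightarrow> 0"
    proof (rule tendsto_sandwich[OF _ _ tendsto_const fg])
      show "\<forall>\<^sub>F n in sequentially. (\<integral>\<^sup>+x. ennreal (\<bar>f n x \<bullet> b - g x \<bullet> b\<bar> powr p) \<partial>lborel) \<le>
         (Lp_energy p lborel (\<lambda>x. f n x - g x))"
      proof (intro always_eventually allI nn_integral_mono ennreal_leI)
        fix n x
        have "\<bar>f n x \<bullet> b - g x \<bullet> b\<bar> \<le> norm (f n x - g x)"
          using Basis_le_norm[OF t(2), of "f n x - g x"] by (simp add: inner_diff_left)
        then show "\<bar>f n x \<bullet> b - g x \<bullet> b\<bar> powr p \<le> norm (f n x - g x) powr p"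
          using p by (intro powr_mono2) auto
      qed
    qed auto
    then have "(\<lambda>n. partial_pairing (f n) b \<phi>) \<longlonglongrightarrow> partial_pairing g b \<phi>"
      by (intro Lp_pairing_tendsto[OF p1 _ _ test_function_borel[OF t(1)] _ _ _ C1_boundD(5)[OF RC] C1_boundD(3)[OF RC]]
          integrable_component_powr(2)[OF p1 fm t(2) fB] integrable_component_powr(2)[OF p1 gm t(2) g(2)]) auto
    then have 1: "(\<lambda>n. l (f n) \<phi> b) \<longlonglongrightarrow> l g \<phi> b"
      unfolding l_def by (intro tendsto_add tendsto_const)
    have "(\<lambda>n. l (f n) \<phi> b) \<longlonglongrightarrow> 0"
    proof (rule Lim_null_comparison[OF _ E0[OF t]])
      show "\<forall>\<^sub>F n in sequentially. norm (l (f n) \<phi> b) \<le> E n \<phi> b"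
        using f t by (auto simp: C_def)
    qed
    with 1 have "l g \<phi> b = 0" by (rule LIMSEQ_unique)
    then show ?thesis by (simp add: l_def)
  qed
  have "g absolutely_integrable_on S" if S: "compact S" for S
    unfolding set_integrable_def
  proof -
    have [measurable]: "S \<in> sets borel" using S by (simp add: borel_compact)
    have i: "integrable lborel (\<lambda>x. indicator S x + norm (g x) powr p)"
      using integrable_component_powr(1)[OF p1 gm SOME_Basis g(2)] emeasure_compact_finite[OF S]
      by (intro Bochner_Integration.integrable_add integrable_real_indicator) auto
    have "integrable lborel (\<lambda>x. indicator S x *\<^sub>R g x)"
    proof (rule Bochner_Integration.integrable_bound[OF i])
      show "AE x in lborel. norm (indicator S x *\<^sub>R g x) \<le> norm (indicator S x + norm (g x) powr p)"
        using powr_young[of _ 1 p] p1 by (auto simp: indicator_def)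
    qed measurable
    then show "integrable lebesgue (\<lambda>x. indicator S x *\<^sub>R g x)"
      by (subst integrable_completion) auto
  qed
  moreover have "derivative_pairing u b \<phi> = - (LINT x|lebesgue. (g x \<bullet> b) * \<phi> x)"
    if t: "test_function \<phi>" "b \<in> Basis" for \<phi> b
  proof -
    have "(LINT x|lebesgue. (g x \<bullet> b) * \<phi> x) = partial_pairing g b \<phi>"
      using test_function_borel[OF t(1)] by (intro integral_completion) auto
    then show ?thesis using weak[OF t] by simp
  qed
  ultimately have "is_weak_gradient u g" unfolding is_weak_gradient_def by blast
  then show ?thesis using that gm g(2) by blast
qed

text \<open>Lower semicontinuity: for a fixed field of norm at most 1 every approximate pairing is
  at most \<open>B\<close> in absolute value, and this passes to the limit before the supremum is
  taken.\<close>

lemma total_variation_of_limit: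
  fixes u :: "'a::euclidean_space \<Rightarrow> real" and v :: "nat \<Rightarrow> 'a \<Rightarrow> 'a"
  assumes vm[measurable]: "\<And>n. v n \<in> borel_measurable borel" and B: "0 \<le> B"
    and vB: "\<And>n. (\<integral>\<^sup>+x. ennreal (norm (v n x)) \<partial>lborel) \<le> ennreal B"
    and lim: "\<And>\<phi> b. test_function \<phi> \<Longrightarrow> b \<in> Basis \<Longrightarrow>
       (\<lambda>n. partial_pairing (v n) b \<phi>) \<longlonglongrightarrow> - derivative_pairing u b \<phi>"
    and ui: "\<And>\<phi> b. test_function \<phi> \<Longrightarrow> b \<in> Basis \<Longrightarrow> integrable lebesgue (\<lambda>x. u x * frechet_derivative \<phi> (at x) b)"
  shows "total_variation u \<le> ennreal B"
  unfolding total_variation_def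
proof (rule SUP_least)
  fix \<phi> :: "'a \<Rightarrow> 'a" assume "\<phi> \<in> {\<phi>. test_function \<phi> \<and> (AE x in lebesgue. norm (\<phi> x) \<le> 1)}"
  then have t: "test_function \<phi>" and le1: "AE x in lborel. norm (\<phi> x) \<le> 1" by (auto simp: AE_completion_iff)
  have [measurable]: "\<phi> \<in> borel_measurable borel"
    by (rule test_function_borel[OF t])
  have vi: "integrable lborel (v n)" for n
    by (rule integrableI_bounded) (use le_less_trans[OF vB[of n] ennreal_less_top] in simp_all)
  have int: "integrable lborel (\<lambda>x. (v n x \<bullet> b) * (\<phi> x \<bullet> b))" if b: "b \<in> Basis" for n b
  proof (rule Bochner_Integration.integrable_bound[OF vi[of n]])
    show "AE x in lborel. norm ((v n x \<bullet> b) * (\<phi> x \<bullet> b)) \<le> norm (v n x)"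
      using le1
    proof eventually_elim
      case (elim x)
      have "\<bar>v n x \<bullet> b\<bar> * \<bar>\<phi> x \<bullet> b\<bar> \<le> norm (v n x) * 1"
        using Basis_le_norm[OF b, of "v n x"] Basis_le_norm[OF b, of "\<phi> x"] elim by (intro mult_mono) auto
      then show ?case by (simp add: abs_mult)
    qed
  qed measurable
  have eq: "(LINT x|lebesgue. u x * divergence \<phi> x) =
     (\<Sum>b\<in>Basis. LINT x|lebesgue. u x * frechet_derivative (\<lambda>x. \<phi> x \<bullet> b) (at x) b)"
    unfolding divergence_def sum_distrib_left test_function_inner(2)[OF t, symmetric]
    by (intro Bochner_Integration.integral_sum ui test_function_inner(1)[OF t])
  have "(\<lambda>n. \<Sum>b\<in>Basis. LINT x|lborel. (v n x \<bullet> b) * (\<phi> x \<bullet> b)) \<longlonglongrightarrow>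
     (\<Sum>b\<in>Basis. - (LINT x|lebesgue. u x * frechet_derivative (\<lambda>x. \<phi> x \<bullet> b) (at x) b))"
    by (intro tendsto_sum lim test_function_inner(1)[OF t])
  from tendsto_rabs[OF this]
  have "(\<lambda>n. \<bar>\<Sum>b\<in>Basis. LINT x|lborel. (v n x \<bullet> b) * (\<phi> x \<bullet> b)\<bar>) \<longlonglongrightarrow> \<bar>LINT x|lebesgue. u x * divergence \<phi> x\<bar>"
    unfolding eq sum_negf abs_minus_cancel .
  moreover have "\<bar>\<Sum>b\<in>Basis. LINT x|lborel. (v n x \<bullet> b) * (\<phi> x \<bullet> b)\<bar> \<le> B" for n
  proof -
    have ei: "v n x \<bullet> \<phi> x = (\<Sum>b\<in>Basis. (v n x \<bullet> b) * (\<phi> x \<bullet> b))" for x by (rule euclidean_inner)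
    have "(\<Sum>b\<in>Basis. LINT x|lborel. (v n x \<bullet> b) * (\<phi> x \<bullet> b)) = (LINT x|lborel. v n x \<bullet> \<phi> x)"
      unfolding ei by (intro Bochner_Integration.integral_sum[symmetric] int)
    also have "ennreal \<bar>\<dots>\<bar> \<le> (\<integral>\<^sup>+x. ennreal \<bar>v n x \<bullet> \<phi> x\<bar> \<partial>lborel)"
    proof -
      have "integrable lborel (\<lambda>x. v n x \<bullet> \<phi> x)"
        unfolding ei by (intro Bochner_Integration.integrable_sum int)
      from integral_norm_bound_ennreal[OF this] show ?thesis by simp
    qed
    also have "\<dots> \<le> (\<integral>\<^sup>+x. ennreal (norm (v n x)) \<partial>lborel)"
    proof (rule nn_integral_mono_AE, use le1 in eventually_elim)
      case (elim x)
      have "\<bar>v n x \<bullet> \<phi> x\<bar> \<le> norm (v n x) * norm (\<phi> x)" by (rule Cauchy_Schwarz_ineq2)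
      also have "\<dots> \<le> norm (v n x) * 1" using elim by (intro mult_left_mono) auto
      finally show ?case by (intro ennreal_leI) simp
    qed
    also have "\<dots> \<le> ennreal B" by (rule vB)
    finally show ?thesis using B by simp
  qed
  ultimately have "\<bar>LINT x|lebesgue. u x * divergence \<phi> x\<bar> \<le> B" using LIMSEQ_le_const2 by blast
  then show "ennreal \<bar>LINT x|lebesgue. u x * divergence \<phi> x\<bar> \<le> ennreal B" by (rule ennreal_leI)
qed

lemma Phi_bound:
  fixes u :: "'a::euclidean_space \<Rightarrow> real" and e :: 'a
  assumes p: "1 \<le> p" and \<gamma>: "\<gamma> < - p" and u: "in_Lp p u" and e: "norm e = 1" and A: "0 \<le> A" and l0: "0 < l0"
    and bd: "\<And>l. 0 < l \<Longrightarrow> l < l0 \<Longrightarrow> Phi_lam p \<gamma> l u \<le> ennreal A"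
  shows "Phi p u \<le> ennreal (A * \<bar>\<gamma>\<bar> / K_const e p)"
proof -
  obtain v :: "nat \<Rightarrow> 'a \<Rightarrow> 'a" where v: "\<And>n. v n \<in> borel_measurable borel"
    "\<And>n. ennreal (K_const e p) * Lp_energy p lborel (v n) \<le> ennreal (A * \<bar>\<gamma>\<bar>)"
    "\<And>\<phi> b. test_function \<phi> \<Longrightarrow> b \<in> Basis \<Longrightarrow>
       (\<lambda>n. partial_pairing (v n) b \<phi>) \<longlonglongrightarrow> - derivative_pairing u b \<phi>"
    "\<And>\<phi> b. test_function \<phi> \<Longrightarrow> b \<in> Basis \<Longrightarrow> integrable lebesgue (\<lambda>x. u x * frechet_derivative \<phi> (at x) b)"
    by (rule smooth_approximation[OF p \<gamma> u e A l0 bd]) (assumption | rule that)+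
  define B where "B = A * \<bar>\<gamma>\<bar> / K_const e p"
  have K: "K_const e p > 0" by (rule K_const_eq_nn_integral(2)[OF e p])
  have B0: "0 \<le> B" using A K by (simp add: B_def)
  have vB: "Lp_energy p lborel (v n) \<le> ennreal B" for n
    unfolding B_def by (rule ennreal_mult_le_imp_le_divide[OF K v(2)])
  show ?thesis
  proof (cases "p = 1")
    case True
    have "total_variation u \<le> ennreal B"
    proof (rule total_variation_of_limit[OF v(1) B0 _ v(3,4)])
      show "(\<integral>\<^sup>+x. ennreal (norm (v n x)) \<partial>lborel) \<le> ennreal B" for n using vB[of n] True by simp
    qed
    then show ?thesis using True by (simp add: Phi_def B_def)
  next
    case False
    then have p1: "1 < p" using p by simp
    obtain g where g[measurable]: "g \<in> borel_measurable borel"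
      and gB: "Lp_energy p lborel g \<le> ennreal B" and wg: "is_weak_gradient u g"
      using weak_gradient_of_limit[OF p1 v(1) vB v(3)] by blast
    have "integrable lebesgue (\<lambda>x. norm (g x) powr p)"
      using integrable_component_powr(1)[OF p g SOME_Basis gB] by (subst integrable_completion) auto
    then have "in_Lp p g" unfolding in_Lp_def by (auto intro!: measurable_completion)
    then have W: "in_W1p p u" unfolding in_W1p_def using u wg by blast
    \<comment> \<open>The chosen gradient may differ from \<open>g\<close>, but only on a null set,
      so the energy bound for \<open>g\<close> carries over.\<close>
    have "is_weak_gradient u (weak_gradient u)" unfolding weak_gradient_def using wg by (rule someI[of "is_weak_gradient u"])
    from weak_gradient_unique[OF this wg] have "AE x in lebesgue. weak_gradient u x = g x" .
    then have "AE x in lebesgue. ennreal (norm (weak_gradient u x) powr p) = ennreal (norm (g x) powr p)"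
      by eventually_elim simp
    then have "(\<integral>\<^sup>+x. ennreal (norm (weak_gradient u x) powr p) \<partial>lebesgue) = (\<integral>\<^sup>+x. ennreal (norm (g x) powr p) \<partial>lebesgue)"
      by (rule nn_integral_cong_AE)
    then show ?thesis using W p1 gB by (simp add: Phi_def B_def nn_integral_completion)
  qed
qed

theorem theorem2p1:
  fixes u :: "'a::euclidean_space \<Rightarrow> real" and p \<gamma> :: real
  assumes "1 \<le> p" and "\<gamma> < - p" and "in_Lp p u"
  shows "(\<forall>e\<in>sphere (0::'a) 1.
            ennreal (K_const e p / \<bar>\<gamma>\<bar>) * Phi p u \<le> Limsup (at_right 0) (\<lambda>l. Phi_lam p \<gamma> l u)) \<and>
         (Limsup (at_right 0) (\<lambda>l. Phi_lam p \<gamma> l u) < \<infinity> \<longrightarrow>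
            (1 < p \<longrightarrow> in_W1p p u) \<and> (p = 1 \<longrightarrow> in_BV u))"
proof -
  let ?L = "Limsup (at_right 0) (\<lambda>l. Phi_lam p \<gamma> l u)"
  have \<gamma>: "\<bar>\<gamma>\<bar> > 0" using assms by auto
  have Phi_le: "Phi p u \<le> ennreal (A * \<bar>\<gamma>\<bar> / K_const e p)"
    if e: "norm e = 1" and A: "0 \<le> A" "?L < ennreal A" for e :: 'a and A
  proof -
    have "\<forall>\<^sub>F l in at_right 0. Phi_lam p \<gamma> l u < ennreal A" by (rule Limsup_lessD[OF A(2)])
    then obtain l0 where l0: "l0 > 0" "\<And>l. 0 < l \<Longrightarrow> l < l0 \<Longrightarrow> Phi_lam p \<gamma> l u < ennreal A"
      unfolding eventually_at_right_field by auto
    show ?thesis by (rule Phi_bound[OF assms e A(1) l0(1)]) (use l0(2) in \<open>auto intro: less_imp_le\<close>)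
  qed
  have main: "ennreal (K_const e p / \<bar>\<gamma>\<bar>) * Phi p u \<le> ?L" if e: "norm e = 1" for e :: 'a
  \<comment> \<open>The estimate needs a bound strictly above the limsup, valid for all small
    levels; every such \<open>a\<close> is admissible, and an infinite one is trivial.\<close>
  proof (rule dense_ge)
    fix a assume a: "?L < a"
    have K: "K_const e p > 0" by (rule K_const_eq_nn_integral(2)[OF e assms(1)])
    show "ennreal (K_const e p / \<bar>\<gamma>\<bar>) * Phi p u \<le> a"
    proof (cases a)
      case (real A)
      then have "ennreal (K_const e p / \<bar>\<gamma>\<bar>) * Phi p u \<le> ennreal (K_const e p / \<bar>\<gamma>\<bar>) * ennreal (A * \<bar>\<gamma>\<bar> / K_const e p)"
        using Phi_le[OF e, of A] a by (intro mult_left_mono) auto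
      also have "\<dots> = a"
        using K \<gamma> real by (subst ennreal_mult'[symmetric]) auto
      finally show ?thesis .
    qed simp
  qed
  have second: "(1 < p \<longrightarrow> in_W1p p u) \<and> (p = 1 \<longrightarrow> in_BV u)" if L: "?L < \<infinity>"
  proof -
    \<comment> \<open>Any unit vector serves to evaluate \<open>K_const\<close>; a basis vector
      always exists.\<close>
    have e: "norm (SOME b. b \<in> Basis :: 'a) = 1" by (rule norm_Basis[OF SOME_Basis])
    obtain L' where L': "?L < ennreal L'" "0 \<le> L'"
    proof -
      obtain y where "?L < y" "y < \<infinity>" using dense[OF L] by blast
      then show ?thesis using that by (cases y) auto
    qed
    \<comment> \<open>Finiteness already means membership: \<open>Phi\<close> is infinite off the
      Sobolev space, and for p = 1 it is the total variation.\<close>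
    have "Phi p u < \<infinity>" using Phi_le[OF e L'(2,1)] by (auto simp: le_less_trans)
    then show ?thesis using assms by (auto simp: Phi_def in_BV_def split: if_splits)
  qed
  show ?thesis
  proof (intro conjI[OF ballI impI])
    show "ennreal (K_const e p / \<bar>\<gamma>\<bar>) * Phi p u \<le> ?L" if "e \<in> sphere (0::'a) 1" for e
      using that by (intro main) simp
  qed (rule second)
qed

end
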